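(* Let $K$ and $H$ be Hopf algebras over $\mathbb{K}$, with $H$ having invertible antipode, let $A$ be a $(K,H)$-bicomodule algebra, $B=A^{coH}$, and let $\sigma:K\otimes K\to\mathbb{K}$ be a 2-cocycle. Then $B\subset A$ is an $H$-Hopf-Galois extension if and only if ${}_\sigma B\subset{}_\sigma A$ is an $H$-Hopf-Galois extension.
   Context: $\mathbb{K}$ denotes $\mathbb{C}$ or $\mathbb{C}[[\hbar]]$. Sweedler notation (sums understood): $\Delta(h)=h_{(1)}\otimes h_{(2)}$, right $H$-coactions $\delta^A(a)=a_{(0)}\otimes a_{(1)}\in A\otimes H$, left $K$-coactions $\rho^A(a)=a_{(-1)}\otimes a_{(0)}\in K\otimes A$; $\varepsilon$ counit. A $(K,H)$-bicomodule algebra is a unital associative algebra $A$ with a left $K$-coaction $\rho^A$ and a right $H$-coaction $\delta^A$, both unital algebra maps, such that $(\rho^A\otimes\mathrm{id})\circ\delta^A=(\mathrm{id}\otimes\delta^A)\circ\rho^A$. $A^{coH}=\{b\in A:\delta^A(b)=b\otimes1_H\}$. For a right $H$-comodule algebra $A$ with $B=A^{coH}$, $B\subset A$ is an $H$-Hopf-Galois extension if $\chi:A\otimes_B A\to A\otimes H$, $a\otimes_B a'\mapsto a\,a'_{(0)}\otimes a'_{(1)}$, is bijective. A 2-cocycle on $K$ is a linear $\sigma:K\otimes K\to\mathbb{K}$ with $\sigma(g_{(1)}\otimes h_{(1)})\sigma(g_{(2)}h_{(2)}\otimes k)=\sigma(h_{(1)}\otimes k_{(1)})\sigma(g\otimes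 h_{(2)}k_{(2)})$ for all $g,h,k\in K$, convolution invertible, and $\sigma(h\otimes1)=\varepsilon(h)=\sigma(1\otimes h)$. ${}_\sigma A$ is the right $H$-comodule algebra with the same underlying space, unit and $H$-coaction as $A$, and product $a\,{}_\sigma\bullet\,a'=\sigma(a_{(-1)}\otimes a'_{(-1)})\,a_{(0)}a'_{(0)}$. ${}_\sigma B=({}_\sigma A)^{coH}$ is $B$ with the restricted deformed product. *)

theory Defs
  imports
    "HOL-Algebra.Free_Abelian_Groups"
    "HOL-Algebra.Module"
    "HOL-Algebra.QuotRing"
    "HOL-Algebra.Algebraic_Closure_Type"
    "HOL-Computational_Algebra.Formal_Power_Series"
begin

section \<open>Tensor products\<close>

text \<open>
  The balanced tensor product of \<open>M\<close> and \<open>N\<close> over a set \<open>S\<close> of scalars, acting on \<open>M\<close> from the right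
  by \<open>ra\<close> and on \<open>N\<close> from the left by \<open>la\<close>: the free abelian group on \<open>carrier M \<times> carrier N\<close> modulo
  the subgroup generated by the biadditivity and balancing relations. Its elements are cosets.
  Tensor products are algebraic: no topological completion is taken over formal power series.
\<close>

type_synonym ('a, 'b) tensors = "('a \<times> 'b \<Rightarrow>\<^sub>0 int) set"

definition tensor_rels ::
  "('a, 'm) ring_scheme \<Rightarrow> ('b, 'n) ring_scheme \<Rightarrow> 's set \<Rightarrow> ('a \<Rightarrow> 's \<Rightarrow> 'a) \<Rightarrow> ('s \<Rightarrow> 'b \<Rightarrow> 'b)
    \<Rightarrow> ('a \<times> 'b \<Rightarrow>\<^sub>0 int) set"
  where "tensor_rels M N S ra la =
    {frag_of (x \<oplus>\<^bsub>M\<^esub> x', y) - frag_of (x, y) - frag_of (x', y) | x x' y.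
       x \<in> carrier M \<and> x' \<in> carrier M \<and> y \<in> carrier N} \<union>
    {frag_of (x, y \<oplus>\<^bsub>N\<^esub> y') - frag_of (x, y) - frag_of (x, y') | x y y'.
       x \<in> carrier M \<and> y \<in> carrier N \<and> y' \<in> carrier N} \<union>
    {frag_of (ra x s, y) - frag_of (x, la s y) | x s y.
       x \<in> carrier M \<and> s \<in> S \<and> y \<in> carrier N}"

definition balanced_tensor ::
  "('a, 'm) ring_scheme \<Rightarrow> ('b, 'n) ring_scheme \<Rightarrow> 's set \<Rightarrow> ('a \<Rightarrow> 's \<Rightarrow> 'a) \<Rightarrow> ('s \<Rightarrow> 'b \<Rightarrow> 'b)
    \<Rightarrow> ('a, 'b) tensors monoid"
  where "balanced_tensor M N S ra la =
    (let F = free_Abelian_group (carrier M \<times> carrier N)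
     in F Mod (generate F (tensor_rels M N S ra la)))"

text \<open>
  The map on a balanced tensor product induced by \<open>f\<close>, with values in the commutative group \<open>G\<close>
  (written multiplicatively): \<open>x \<otimes> y \<mapsto> f x y\<close>. The value does not depend on the chosen
  representative whenever \<open>f\<close> is biadditive and balanced, as it is in every use below. Applied to a
  coproduct or a coaction, this is the sum understood in Sweedler notation.
\<close>

definition tensor_lift ::
  "('c, 'm) monoid_scheme \<Rightarrow> ('a \<Rightarrow> 'b \<Rightarrow> 'c) \<Rightarrow> ('a, 'b) tensors \<Rightarrow> 'c"
  where "tensor_lift G f t =
    (let p = (SOME p. p \<in> t)
     in finprod G (\<lambda>(x, y). f x y [^]\<^bsub>G\<^esub> Poly_Mapping.lookup p (x, y)) (Poly_Mapping.keys p))"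

definition tensor_group ::
  "('k, 'l) ring_scheme \<Rightarrow> ('k, 'a) module \<Rightarrow> ('k, 'b) module \<Rightarrow> ('a, 'b) tensors monoid"
  where "tensor_group R M N =
    balanced_tensor M N (carrier R) (\<lambda>x r. r \<odot>\<^bsub>M\<^esub> x) (\<lambda>r y. r \<odot>\<^bsub>N\<^esub> y)"

definition pure_tensor ::
  "('k, 'l) ring_scheme \<Rightarrow> ('k, 'a) module \<Rightarrow> ('k, 'b) module \<Rightarrow> 'a \<Rightarrow> 'b \<Rightarrow> ('a, 'b) tensors"
  where "pure_tensor R M N x y =
    (let F = free_Abelian_group (carrier M \<times> carrier N)
     in generate F (tensor_rels M N (carrier R) (\<lambda>x r. r \<odot>\<^bsub>M\<^esub> x) (\<lambda>r y. r \<odot>\<^bsub>N\<^esub> y))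
          #>\<^bsub>F\<^esub> frag_of (x, y))"

text \<open>The tensor product over \<open>R\<close> of two \<open>R\<close>-algebras, with its factorwise product.\<close>

definition tensor ::
  "('k, 'l) ring_scheme \<Rightarrow> ('k, 'a) module \<Rightarrow> ('k, 'b) module \<Rightarrow> ('k, ('a, 'b) tensors) module"
  where "tensor R M N =
    (let T = tensor_group R M N; tens = pure_tensor R M N in
     \<lparr>carrier = carrier T,
      monoid.mult = (\<lambda>t u. tensor_lift T (\<lambda>x y.
                tensor_lift T (\<lambda>x' y'. tens (x \<otimes>\<^bsub>M\<^esub> x') (y \<otimes>\<^bsub>N\<^esub> y')) u) t),
      one = tens \<one>\<^bsub>M\<^esub> \<one>\<^bsub>N\<^esub>,
      ring.zero = \<one>\<^bsub>T\<^esub>,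
      add = monoid.mult T,
      module.smult = (\<lambda>r. tensor_lift T (\<lambda>x y. tens (r \<odot>\<^bsub>M\<^esub> x) y))\<rparr>)"

text \<open>\<open>f \<otimes> g\<close> as a map into \<open>M \<otimes> N\<close>.\<close>

definition tensor_map ::
  "('k, 'l) ring_scheme \<Rightarrow> ('k, 'c) module \<Rightarrow> ('k, 'd) module \<Rightarrow> ('a \<Rightarrow> 'c) \<Rightarrow> ('b \<Rightarrow> 'd)
    \<Rightarrow> ('a, 'b) tensors \<Rightarrow> ('c, 'd) tensors"
  where "tensor_map R M N f g =
    tensor_lift (tensor_group R M N) (\<lambda>x y. pure_tensor R M N (f x) (g y))"

text \<open>The associativity isomorphism \<open>(L \<otimes> M) \<otimes> N \<rightarrow> L \<otimes> (M \<otimes> N)\<close>.\<close>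

definition tensor_assoc ::
  "('k, 'l) ring_scheme \<Rightarrow> ('k, 'a) module \<Rightarrow> ('k, 'b) module \<Rightarrow> ('k, 'c) module
    \<Rightarrow> (('a, 'b) tensors, 'c) tensors \<Rightarrow> ('a, ('b, 'c) tensors) tensors"
  where "tensor_assoc R L M N =
    (let T = tensor_group R L (tensor R M N) in
     tensor_lift T (\<lambda>t z. tensor_lift T (\<lambda>x y.
       pure_tensor R L (tensor R M N) x (pure_tensor R M N y z)) t))"


section \<open>Algebras, Hopf algebras and comodule algebras\<close>

text \<open>The locale \<open>algebra\<close> of HOL-Algebra is restricted to commutative algebras.\<close>

locale assoc_algebra = module R A + A?: ring A for R (structure) and A (structure) +
  assumes smult_mult_left:
      "\<lbrakk>r \<in> carrier R; x \<in> carrier A; y \<in> carrier A\<rbrakk>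
        \<Longrightarrow> (r \<odot>\<^bsub>A\<^esub> x) \<otimes>\<^bsub>A\<^esub> y = r \<odot>\<^bsub>A\<^esub> (x \<otimes>\<^bsub>A\<^esub> y)"
    and smult_mult_right:
      "\<lbrakk>r \<in> carrier R; x \<in> carrier A; y \<in> carrier A\<rbrakk>
        \<Longrightarrow> x \<otimes>\<^bsub>A\<^esub> (r \<odot>\<^bsub>A\<^esub> y) = r \<odot>\<^bsub>A\<^esub> (x \<otimes>\<^bsub>A\<^esub> y)"

definition ground_algebra :: "('k, 'l) ring_scheme \<Rightarrow> ('k, 'k) module"
  where "ground_algebra R =
    \<lparr>carrier = carrier R, monoid.mult = monoid.mult R, one = \<one>\<^bsub>R\<^esub>, ring.zero = \<zero>\<^bsub>R\<^esub>, add = add R,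
     module.smult = monoid.mult R\<rparr>"

definition linear_maps ::
  "('k, 'l) ring_scheme \<Rightarrow> ('k, 'a) module \<Rightarrow> ('k, 'b) module \<Rightarrow> ('a \<Rightarrow> 'b) set"
  where "linear_maps R M N = {f. f \<in> carrier M \<rightarrow> carrier N \<and>
    (\<forall>x\<in>carrier M. \<forall>y\<in>carrier M. f (x \<oplus>\<^bsub>M\<^esub> y) = f x \<oplus>\<^bsub>N\<^esub> f y) \<and>
    (\<forall>r\<in>carrier R. \<forall>x\<in>carrier M. f (r \<odot>\<^bsub>M\<^esub> x) = r \<odot>\<^bsub>N\<^esub> f x)}"

definition algebra_homs ::
  "('k, 'l) ring_scheme \<Rightarrow> ('k, 'a) module \<Rightarrow> ('k, 'b) module \<Rightarrow> ('a \<Rightarrow> 'b) set"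
  where "algebra_homs R A B = linear_maps R A B \<inter> ring_hom A B"

locale hopf_algebra = assoc_algebra R H
  for R :: "('k, 'l) ring_scheme" (structure) and H :: "('k, 'h) module" (structure)
    and \<Delta> :: "'h \<Rightarrow> ('h, 'h) tensors" and \<epsilon> :: "'h \<Rightarrow> 'k" and S :: "'h \<Rightarrow> 'h" +
  assumes comult_hom: "\<Delta> \<in> algebra_homs R H (tensor R H H)"
    and counit_hom: "\<epsilon> \<in> algebra_homs R H (ground_algebra R)"
    and antipode_linear: "S \<in> linear_maps R H H"
    and coassoc: "h \<in> carrier H \<Longrightarrow>
      tensor_assoc R H H H (tensor_map R (tensor R H H) H \<Delta> id (\<Delta> h))
        = tensor_map R H (tensor R H H) id \<Delta> (\<Delta> h)"
    and counit_left: "h \<in> carrier H \<Longrightarrow>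
      tensor_lift (add_monoid H) (\<lambda>x y. \<epsilon> x \<odot>\<^bsub>H\<^esub> y) (\<Delta> h) = h"
    and counit_right: "h \<in> carrier H \<Longrightarrow>
      tensor_lift (add_monoid H) (\<lambda>x y. \<epsilon> y \<odot>\<^bsub>H\<^esub> x) (\<Delta> h) = h"
    and antipode_left: "h \<in> carrier H \<Longrightarrow>
      tensor_lift (add_monoid H) (\<lambda>x y. S x \<otimes>\<^bsub>H\<^esub> y) (\<Delta> h) = \<epsilon> h \<odot>\<^bsub>H\<^esub> \<one>\<^bsub>H\<^esub>"
    and antipode_right: "h \<in> carrier H \<Longrightarrow>
      tensor_lift (add_monoid H) (\<lambda>x y. x \<otimes>\<^bsub>H\<^esub> S y) (\<Delta> h) = \<epsilon> h \<odot>\<^bsub>H\<^esub> \<one>\<^bsub>H\<^esub>"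

locale right_comodule_algebra = assoc_algebra R A
  for R :: "('k, 'l) ring_scheme" (structure) and H :: "('k, 'h) module"
    and \<Delta> :: "'h \<Rightarrow> ('h, 'h) tensors" and \<epsilon> :: "'h \<Rightarrow> 'k"
    and A :: "('k, 'a) module" (structure) and \<delta> :: "'a \<Rightarrow> ('a, 'h) tensors" +
  assumes right_coaction_hom: "\<delta> \<in> algebra_homs R A (tensor R A H)"
    and right_coaction_coassoc: "a \<in> carrier A \<Longrightarrow>
      tensor_assoc R A H H (tensor_map R (tensor R A H) H \<delta> id (\<delta> a))
        = tensor_map R A (tensor R H H) id \<Delta> (\<delta> a)"
    and right_coaction_counit: "a \<in> carrier A \<Longrightarrow>
      tensor_lift (add_monoid A) (\<lambda>x h. \<epsilon> h \<odot>\<^bsub>A\<^esub> x) (\<delta> a) = a"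

locale left_comodule_algebra = assoc_algebra R A
  for R :: "('k, 'l) ring_scheme" (structure) and K :: "('k, 'g) module"
    and \<Delta> :: "'g \<Rightarrow> ('g, 'g) tensors" and \<epsilon> :: "'g \<Rightarrow> 'k"
    and A :: "('k, 'a) module" (structure) and \<rho> :: "'a \<Rightarrow> ('g, 'a) tensors" +
  assumes left_coaction_hom: "\<rho> \<in> algebra_homs R A (tensor R K A)"
    and left_coaction_coassoc: "a \<in> carrier A \<Longrightarrow>
      tensor_assoc R K K A (tensor_map R (tensor R K K) A \<Delta> id (\<rho> a))
        = tensor_map R K (tensor R K A) id \<rho> (\<rho> a)"
    and left_coaction_counit: "a \<in> carrier A \<Longrightarrow>
      tensor_lift (add_monoid A) (\<lambda>k x. \<epsilon> k \<odot>\<^bsub>A\<^esub> x) (\<rho> a) = a"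

locale bicomodule_algebra =
  left_comodule_algebra R K \<Delta>K \<epsilon>K A \<rho> + right_comodule_algebra R H \<Delta>H \<epsilon>H A \<delta>
  for R :: "('k, 'l) ring_scheme" (structure)
    and K :: "('k, 'g) module" and \<Delta>K :: "'g \<Rightarrow> ('g, 'g) tensors" and \<epsilon>K :: "'g \<Rightarrow> 'k"
    and H :: "('k, 'h) module" and \<Delta>H :: "'h \<Rightarrow> ('h, 'h) tensors" and \<epsilon>H :: "'h \<Rightarrow> 'k"
    and A :: "('k, 'a) module" (structure)
    and \<rho> :: "'a \<Rightarrow> ('g, 'a) tensors" and \<delta> :: "'a \<Rightarrow> ('a, 'h) tensors" +
  assumes coactions_commute: "a \<in> carrier A \<Longrightarrow>
      tensor_assoc R K A H (tensor_map R (tensor R K A) H \<rho> id (\<delta> a))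
        = tensor_map R K (tensor R A H) id \<delta> (\<rho> a)"


section \<open>Hopf-Galois extensions\<close>

definition coinvariants ::
  "('k, 'l) ring_scheme \<Rightarrow> ('k, 'h) module \<Rightarrow> ('k, 'a) module \<Rightarrow> ('a \<Rightarrow> ('a, 'h) tensors) \<Rightarrow> 'a set"
  where "coinvariants R H A \<delta> = {b \<in> carrier A. \<delta> b = pure_tensor R A H b \<one>\<^bsub>H\<^esub>}"

text \<open>\<open>A \<otimes>\<^sub>B A\<close> for a subalgebra \<open>B\<close> acting on \<open>A\<close> by multiplication.\<close>

definition tensor_over :: "('k, 'a) module \<Rightarrow> 'a set \<Rightarrow> ('a, 'a) tensors monoid"
  where "tensor_over A B = balanced_tensor A A B (monoid.mult A) (monoid.mult A)"

definition canonical_map ::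
  "('k, 'l) ring_scheme \<Rightarrow> ('k, 'h) module \<Rightarrow> ('k, 'a) module \<Rightarrow> ('a \<Rightarrow> ('a, 'h) tensors)
    \<Rightarrow> ('a, 'a) tensors \<Rightarrow> ('a, 'h) tensors"
  where "canonical_map R H A \<delta> =
    (let T = tensor_group R A H in
     tensor_lift T (\<lambda>a a'. tensor_lift T (\<lambda>x h. pure_tensor R A H (a \<otimes>\<^bsub>A\<^esub> x) h) (\<delta> a')))"

text \<open>For a right \<open>H\<close>-comodule algebra \<open>A\<close>: \<open>A\<^sup>c\<^sup>o\<^sup>H \<subseteq> A\<close> is an \<open>H\<close>-Hopf-Galois extension.\<close>

definition hopf_galois_extension ::
  "('k, 'l) ring_scheme \<Rightarrow> ('k, 'h) module \<Rightarrow> ('k, 'a) module \<Rightarrow> ('a \<Rightarrow> ('a, 'h) tensors)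
    \<Rightarrow> 'a set \<Rightarrow> bool"
  where "hopf_galois_extension R H A \<delta> B \<longleftrightarrow> B = coinvariants R H A \<delta> \<and>
    bij_betw (canonical_map R H A \<delta>) (carrier (tensor_over A B)) (carrier (tensor R A H))"


section \<open>Twisting by 2-cocycles\<close>

text \<open>The product on \<open>Hom(K \<otimes> K, R)\<close> dual to the tensor coproduct of \<open>K \<otimes> K\<close>, as a function on pure
  tensors: \<open>(\<sigma> * \<tau>) (g \<otimes> h) = \<sigma> (g\<^sub>1 \<otimes> h\<^sub>1) \<tau> (g\<^sub>2 \<otimes> h\<^sub>2)\<close>.\<close>

definition convolution ::
  "('k, 'l) ring_scheme \<Rightarrow> ('k, 'g) module \<Rightarrow> ('g \<Rightarrow> ('g, 'g) tensors)
    \<Rightarrow> (('g, 'g) tensors \<Rightarrow> 'k) \<Rightarrow> (('g, 'g) tensors \<Rightarrow> 'k) \<Rightarrow> 'g \<Rightarrow> 'g \<Rightarrow> 'k"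
  where "convolution R K \<Delta> \<sigma> \<tau> g h =
    tensor_lift (add_monoid R) (\<lambda>g1 g2. tensor_lift (add_monoid R) (\<lambda>h1 h2.
      \<sigma> (pure_tensor R K K g1 h1) \<otimes>\<^bsub>R\<^esub> \<tau> (pure_tensor R K K g2 h2)) (\<Delta> h)) (\<Delta> g)"

definition two_cocycle ::
  "('k, 'l) ring_scheme \<Rightarrow> ('k, 'g) module \<Rightarrow> ('g \<Rightarrow> ('g, 'g) tensors) \<Rightarrow> ('g \<Rightarrow> 'k)
    \<Rightarrow> (('g, 'g) tensors \<Rightarrow> 'k) \<Rightarrow> bool"
  where "two_cocycle R K \<Delta> \<epsilon> \<sigma> \<longleftrightarrow>
    \<sigma> \<in> linear_maps R (tensor R K K) (ground_algebra R) \<and>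
    (\<forall>g\<in>carrier K. \<forall>h\<in>carrier K. \<forall>k\<in>carrier K.
       tensor_lift (add_monoid R) (\<lambda>g1 g2. tensor_lift (add_monoid R) (\<lambda>h1 h2.
         \<sigma> (pure_tensor R K K g1 h1) \<otimes>\<^bsub>R\<^esub> \<sigma> (pure_tensor R K K (g2 \<otimes>\<^bsub>K\<^esub> h2) k)) (\<Delta> h)) (\<Delta> g)
       = tensor_lift (add_monoid R) (\<lambda>h1 h2. tensor_lift (add_monoid R) (\<lambda>k1 k2.
         \<sigma> (pure_tensor R K K h1 k1) \<otimes>\<^bsub>R\<^esub> \<sigma> (pure_tensor R K K g (h2 \<otimes>\<^bsub>K\<^esub> k2))) (\<Delta> k)) (\<Delta> h)) \<and>
    (\<exists>\<tau> \<in> linear_maps R (tensor R K K) (ground_algebra R).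
       \<forall>g\<in>carrier K. \<forall>h\<in>carrier K.
         convolution R K \<Delta> \<sigma> \<tau> g h = \<epsilon> g \<otimes>\<^bsub>R\<^esub> \<epsilon> h \<and>
         convolution R K \<Delta> \<tau> \<sigma> g h = \<epsilon> g \<otimes>\<^bsub>R\<^esub> \<epsilon> h) \<and>
    (\<forall>h\<in>carrier K. \<sigma> (pure_tensor R K K h \<one>\<^bsub>K\<^esub>) = \<epsilon> h \<and> \<sigma> (pure_tensor R K K \<one>\<^bsub>K\<^esub> h) = \<epsilon> h)"

definition twisted_algebra ::
  "('k, 'l) ring_scheme \<Rightarrow> ('k, 'g) module \<Rightarrow> (('g, 'g) tensors \<Rightarrow> 'k) \<Rightarrow> ('a \<Rightarrow> ('g, 'a) tensors)
    \<Rightarrow> ('k, 'a) module \<Rightarrow> ('k, 'a) module"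
  where "twisted_algebra R K \<sigma> \<rho> A = A\<lparr>monoid.mult := \<lambda>a a'.
    tensor_lift (add_monoid A) (\<lambda>g x. tensor_lift (add_monoid A) (\<lambda>g' x'.
      \<sigma> (pure_tensor R K K g g') \<odot>\<^bsub>A\<^esub> (x \<otimes>\<^bsub>A\<^esub> x')) (\<rho> a')) (\<rho> a)\<rparr>"

end

theory Submission
  imports Defs
begin

text \<open>
  Write \<open>s (g, h) = \<sigma> (g \<otimes> h)\<close>, let \<open>t\<close> be the convolution inverse of \<open>s\<close>, and let \<open>A\<sigma>\<close> carry the twisted
  product \<open>a \<bullet> a' = s (a\<^sub>-\<^sub>1, a'\<^sub>-\<^sub>1) a\<^sub>0 a'\<^sub>0\<close>. Neither the coaction \<open>\<delta>\<close> nor the module \<open>A \<otimes> H\<close> involves the product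
  of \<open>A\<close>, so \<open>A\<close> and \<open>A\<sigma>\<close> have the same set \<open>B\<close> of coinvariants. The theorem follows once
  
    \<open>\<Phi> : A\<sigma> \<otimes>\<^sub>B A\<sigma> \<rightarrow> A \<otimes>\<^sub>B A, a \<otimes> a' \<mapsto> s (a\<^sub>-\<^sub>1, a'\<^sub>-\<^sub>1) a\<^sub>0 \<otimes> a'\<^sub>0\<close>
  
  is known to be a well defined bijection (\<open>\<Phi>_bij\<close>): since the two coactions commute, the canonical map
  of \<open>A\<sigma>\<close> is the canonical map of \<open>A\<close> composed with \<open>\<Phi>\<close> (\<open>canonical_map_A'_eq\<close>), so one is bijective if
  and only if the other is.
  
  All formulas are instances of one operation. A bilinear functional \<open>f\<close> on \<open>K\<close> acts on a bilinear map
  \<open>F\<close> on \<open>A\<close> by \<open>(f \<triangleright> F) (a, a') = f (a\<^sub>-\<^sub>1, a'\<^sub>-\<^sub>1) F (a\<^sub>0, a'\<^sub>0)\<close>, and similarly with three arguments. The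
  twisted product is \<open>s \<triangleright> \<cdot>\<close>, the map \<open>\<Phi>\<close> is \<open>s \<triangleright> \<otimes>\<^sub>B\<close>, and the canonical map twists in the same way.
  Coassociativity gives \<open>f \<triangleright> (g \<triangleright> F) = (f * g) \<triangleright> F\<close> (\<open>act2_act2\<close>), so acting with \<open>t\<close> undoes acting with \<open>s\<close>,
  and \<open>\<Psi> = t \<triangleright> \<otimes>\<^sub>B\<close> is the inverse of \<open>\<Phi>\<close>.
  
  The real point is that \<open>\<Phi>\<close> and \<open>\<Psi>\<close> respect the balancing relations over \<open>B\<close>. Two facts carry it.
  First, for every bilinear \<open>W\<close> the maps \<open>(s \<triangleright> W) (a \<bullet> b, c)\<close> and \<open>(s \<triangleright> W) (a, b \<bullet> c)\<close> arise from
  \<open>W (a b, c)\<close> and \<open>W (a, b c)\<close> by letting the two sides of the cocycle identity act (\<open>act2_tprod_left\<close>,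
  \<open>act2_tprod_right\<close>, \<open>cocycle_act\<close>), that is, by one and the same invertible operation. Secondly, this
  operation and its inverse preserve the relation of agreeing whenever the middle argument lies in \<open>B\<close>
  (\<open>act2_cong_middle\<close>, \<open>act3_cong_middle\<close>). The reason is that \<open>f (b\<^sub>-\<^sub>1) b\<^sub>0\<close> is coinvariant for each coinvariant
  \<open>b\<close> and each linear functional \<open>f\<close> on \<open>K\<close> (\<open>coinvariants_stable\<close>). Passing through functionals avoids the
  claim that \<open>\<rho> b\<close> comes from \<open>K \<otimes> B\<close>, which can fail when \<open>K\<close> is not flat over the ground ring.
  
  Since elements of tensor products are cosets, a Sweedler sum is a finite sum over a representative that
  does not depend on the summand. Hence such sums can be interchanged and pulled through linear maps for
  arbitrary summands; multilinearity matters only where an identity between tensors is used. The first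
  sections set up this calculus.
\<close>

section \<open>Sums over representatives and the universal property of balanced tensor products\<close>

text \<open>
  \<open>tensor_lift\<close> sums over the keys of the representative chosen here; this bound on the keys is all that
  the purely combinatorial facts about such sums require.
\<close>

definition supported :: "'a set \<Rightarrow> 'b set \<Rightarrow> ('a, 'b) tensors \<Rightarrow> bool"
  where "supported U V t \<longleftrightarrow> Poly_Mapping.keys (SOME p. p \<in> t) \<subseteq> U \<times> V"

lemma (in comm_monoid) finprod_swap:
  assumes "finite I" "finite J" "\<And>i j. i \<in> I \<Longrightarrow> j \<in> J \<Longrightarrow> f i j \<in> carrier G"
  shows "finprod G (\<lambda>i. finprod G (f i) J) I = finprod G (\<lambda>j. finprod G (\<lambda>i. f i j) I) J"
  using assms(1,3)
proof (induction I rule: finite_induct)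
  case (insert i I)
  have "finprod G (\<lambda>j. finprod G (\<lambda>i. f i j) (insert i I)) J
      = finprod G (\<lambda>j. f i j \<otimes> finprod G (\<lambda>i. f i j) I) J"
    using insert by (intro finprod_cong') (auto simp: Pi_iff)
  also have "\<dots> = finprod G (f i) J \<otimes> finprod G (\<lambda>j. finprod G (\<lambda>i. f i j) I) J"
    using insert by (intro finprod_multf) (auto simp: Pi_iff)
  finally show ?case
    using insert by (simp add: Pi_iff)
qed simp

lemma hom_finprod:
  assumes "comm_group G" "comm_group G'" "h \<in> hom G G'" "finite I" "f \<in> I \<rightarrow> carrier G"
  shows "h (finprod G f I) = finprod G' (\<lambda>i. h (f i)) I"
proof -
  interpret G: comm_group G by fact
  interpret G': comm_group G' by fact
  interpret group_hom G G' h
    using assms by unfold_locales auto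
  show ?thesis
    using assms(4,5)
  proof (induction I rule: finite_induct)
    case (insert i I)
    moreover have "(\<lambda>i. h (f i)) \<in> I \<rightarrow> carrier G'"
      using insert by (auto simp: Pi_iff)
    ultimately show ?case
      by (simp add: Pi_iff)
  qed simp
qed

context comm_group begin

lemma tensor_lift_closed:
  assumes "supported U V t" "\<And>x y. x \<in> U \<Longrightarrow> y \<in> V \<Longrightarrow> f x y \<in> carrier G"
  shows "tensor_lift G f t \<in> carrier G"
  using assms unfolding tensor_lift_def supported_def Let_def
  by (intro finprod_closed) auto

lemma tensor_lift_cong:
  assumes "supported U V t" "\<And>x y. x \<in> U \<Longrightarrow> y \<in> V \<Longrightarrow> g x y \<in> carrier G"
    and "\<And>x y. x \<in> U \<Longrightarrow> y \<in> V \<Longrightarrow> f x y = g x y"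
  shows "tensor_lift G f t = tensor_lift G g t"
  using assms unfolding tensor_lift_def supported_def Let_def
  by (intro finprod_cong') auto

lemma tensor_lift_mult:
  assumes "supported U V t" "\<And>x y. x \<in> U \<Longrightarrow> y \<in> V \<Longrightarrow> f x y \<in> carrier G"
    and "\<And>x y. x \<in> U \<Longrightarrow> y \<in> V \<Longrightarrow> g x y \<in> carrier G"
  shows "tensor_lift G (\<lambda>x y. f x y \<otimes> g x y) t = tensor_lift G f t \<otimes> tensor_lift G g t"
proof -
  let ?p = "SOME p. p \<in> t"
  have sup: "Poly_Mapping.keys ?p \<subseteq> U \<times> V"
    using assms(1) by (simp add: supported_def)
  let ?a = "\<lambda>f (x, y). f x y [^] Poly_Mapping.lookup ?p (x, y)"
  have "finprod G (?a (\<lambda>x y. f x y \<otimes> g x y)) (Poly_Mapping.keys ?p)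
      = finprod G (\<lambda>z. ?a f z \<otimes> ?a g z) (Poly_Mapping.keys ?p)"
    using sup assms(2,3) by (intro finprod_cong') (auto simp: int_pow_distrib subset_iff)
  also have "\<dots> = finprod G (?a f) (Poly_Mapping.keys ?p) \<otimes> finprod G (?a g) (Poly_Mapping.keys ?p)"
    using sup assms(2,3) by (intro finprod_multf) auto
  finally show ?thesis
    by (simp add: tensor_lift_def Let_def)
qed

lemma tensor_lift_hom:
  assumes "comm_group G'" "h \<in> hom G G'"
    and "supported U V t" "\<And>x y. x \<in> U \<Longrightarrow> y \<in> V \<Longrightarrow> f x y \<in> carrier G"
  shows "h (tensor_lift G f t) = tensor_lift G' (\<lambda>x y. h (f x y)) t"
proof -
  interpret G': comm_group G' by fact
  let ?p = "SOME p. p \<in> t"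
  have sup: "Poly_Mapping.keys ?p \<subseteq> U \<times> V"
    using assms(3) by (simp add: supported_def)
  have h: "h x \<in> carrier G'" if "x \<in> carrier G" for x
    using assms(2) that by (auto simp: hom_def)
  have "h (tensor_lift G f t)
      = finprod G' (\<lambda>z. h (case z of (x, y) \<Rightarrow> f x y [^] Poly_Mapping.lookup ?p (x, y)))
          (Poly_Mapping.keys ?p)"
    unfolding tensor_lift_def Let_def
    using assms sup by (intro hom_finprod) (auto intro: comm_group_axioms)
  also have "\<dots> = tensor_lift G' (\<lambda>x y. h (f x y)) t"
    unfolding tensor_lift_def Let_def using sup assms h
    by (intro G'.finprod_cong') (auto simp: subset_iff intro!: hom_int_pow)
  finally show ?thesis .
qed

text \<open>
  The two chosen representatives are independent of each other and of the summand, so this is the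
  interchange of two finite sums; no linearity enters.
\<close>

lemma tensor_lift_swap:
  assumes "supported U V t" "supported Z W u"
    and "\<And>x y z w. x \<in> U \<Longrightarrow> y \<in> V \<Longrightarrow> z \<in> Z \<Longrightarrow> w \<in> W \<Longrightarrow> f x y z w \<in> carrier G"
  shows "tensor_lift G (\<lambda>x y. tensor_lift G (f x y) u) t
    = tensor_lift G (\<lambda>z w. tensor_lift G (\<lambda>x y. f x y z w) t) u"
proof -
  let ?p = "SOME p. p \<in> t" and ?q = "SOME q. q \<in> u"
  have p: "Poly_Mapping.keys ?p \<subseteq> U \<times> V" and q: "Poly_Mapping.keys ?q \<subseteq> Z \<times> W"
    using assms(1,2) by (simp_all add: supported_def)
  let ?n = "\<lambda>x y. Poly_Mapping.lookup ?p (x, y)" and ?m = "\<lambda>z w. Poly_Mapping.lookup ?q (z, w)"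
  have pow: "tensor_lift G g s [^] (n::int) = tensor_lift G (\<lambda>x y. g x y [^] n) s"
    if "supported U V s" "\<And>x y. x \<in> U \<Longrightarrow> y \<in> V \<Longrightarrow> g x y \<in> carrier G"
    for U :: "'x set" and V :: "'y set" and g s n
  proof -
    have "(\<lambda>x. x [^] n) \<in> hom G G"
      by (auto simp: hom_def int_pow_distrib)
    from tensor_lift_hom[OF comm_group_axioms this that] show ?thesis .
  qed
  have c1: "f x y z w \<in> carrier G" 
    if "(x, y) \<in> Poly_Mapping.keys ?p" "(z, w) \<in> Poly_Mapping.keys ?q" for x y z w
    using that p q assms(3) by blast
  have "tensor_lift G (\<lambda>x y. tensor_lift G (f x y) u) t
      = finprod G (\<lambda>(x, y). tensor_lift G (\<lambda>z w. f x y z w [^] ?n x y) u) (Poly_Mapping.keys ?p)"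
    unfolding tensor_lift_def[of G "\<lambda>x y. tensor_lift G (f x y) u"] Let_def
    using p assms(3)
    by (intro finprod_cong')
      (auto simp: subset_iff intro!: tensor_lift_closed[OF assms(2)] pow[OF assms(2)])
  also have "\<dots> = finprod G (\<lambda>i. finprod G (\<lambda>j. (f (fst i) (snd i) (fst j) (snd j)
      [^] ?n (fst i) (snd i)) [^] ?m (fst j) (snd j)) (Poly_Mapping.keys ?q)) (Poly_Mapping.keys ?p)"
    by (simp add: tensor_lift_def Let_def case_prod_unfold)
  also have "\<dots> = finprod G (\<lambda>i. finprod G (\<lambda>j. (f (fst i) (snd i) (fst j) (snd j)
      [^] ?m (fst j) (snd j)) [^] ?n (fst i) (snd i)) (Poly_Mapping.keys ?q)) (Poly_Mapping.keys ?p)"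
    using c1 by (intro finprod_cong' refl) (auto simp: int_pow_pow mult.commute intro!: finprod_closed)
  also have "\<dots> = finprod G (\<lambda>j. finprod G (\<lambda>i. (f (fst i) (snd i) (fst j) (snd j)
      [^] ?m (fst j) (snd j)) [^] ?n (fst i) (snd i)) (Poly_Mapping.keys ?p)) (Poly_Mapping.keys ?q)"
    using c1 by (intro finprod_swap) auto
  also have "\<dots> = finprod G (\<lambda>(z, w). tensor_lift G (\<lambda>x y. f x y z w [^] ?m z w) t) (Poly_Mapping.keys ?q)"
    by (simp add: tensor_lift_def Let_def case_prod_unfold)
  also have "\<dots> = tensor_lift G (\<lambda>z w. tensor_lift G (\<lambda>x y. f x y z w) t) u"
    unfolding tensor_lift_def[of G "\<lambda>z w. tensor_lift G (\<lambda>x y. f x y z w) t"] Let_def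
    using q assms(3)
    by (intro finprod_cong')
      (auto simp: subset_iff intro!: int_pow_closed tensor_lift_closed[OF assms(1)] pow[OF assms(1), symmetric])
  finally show ?thesis .
qed

end

text \<open>
  The right-hand side is the expression evaluated by \<open>tensor_lift\<close>. This is how homomorphisms on the free
  abelian group, for instance the projection to a balanced tensor product, are recognised as such sums.
\<close>

lemma hom_free_Abelian_group_expand:
  assumes "comm_group G" "h \<in> hom (free_Abelian_group S) G" "Poly_Mapping.keys p \<subseteq> S"
  shows "h p = finprod G (\<lambda>a. h (frag_of a) [^]\<^bsub>G\<^esub> Poly_Mapping.lookup p a) (Poly_Mapping.keys p)"
proof -
  interpret G: comm_group G by fact
  interpret h: group_hom "free_Abelian_group S" G h
    using assms by (auto simp: group_hom_def group_hom_axioms_def G.is_group)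
  have c: "h (frag_of a) \<in> carrier G" if "a \<in> S" for a
    using that h.hom_closed[of "frag_of a"] by simp
  have "h (\<Sum>a\<in>I. frag_cmul (Poly_Mapping.lookup p a) (frag_of a))
      = finprod G (\<lambda>a. h (frag_of a) [^]\<^bsub>G\<^esub> Poly_Mapping.lookup p a) I
    \<and> Poly_Mapping.keys (\<Sum>a\<in>I. frag_cmul (Poly_Mapping.lookup p a) (frag_of a)) \<subseteq> S"
    if "finite I" "I \<subseteq> S" for I
    using that
  proof (induction I rule: finite_induct)
    case empty
    then show ?case using h.hom_one by simp
  next
    case (insert a I)
    let ?r = "\<Sum>a\<in>I. frag_cmul (Poly_Mapping.lookup p a) (frag_of a)"
    let ?s = "frag_cmul (Poly_Mapping.lookup p a) (frag_of a)"
    have k: "Poly_Mapping.keys ?r \<subseteq> S" "Poly_Mapping.keys ?s \<subseteq> S"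
      using insert keys_cmul[of "Poly_Mapping.lookup p a" "frag_of a"] by auto
    have "h (?s + ?r) = h ?s \<otimes>\<^bsub>G\<^esub> h ?r"
      using h.hom_mult[of ?s ?r] k by simp
    moreover have "h ?s = h (frag_of a) [^]\<^bsub>G\<^esub> Poly_Mapping.lookup p a"
      using h.hom_int_pow[of "frag_of a" "Poly_Mapping.lookup p a"] insert.prems by simp
    ultimately show ?case
      using insert k c keys_add[of ?s ?r] by (auto simp: Pi_iff subset_iff)
  qed
  from this[of "Poly_Mapping.keys p"] have "h (frag_extend frag_of p)
      = finprod G (\<lambda>a. h (frag_of a) [^]\<^bsub>G\<^esub> Poly_Mapping.lookup p a) (Poly_Mapping.keys p)"
    using assms(3) by (simp add: frag_extend_def)
  then show ?thesis
    by (simp flip: frag_expansion)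
qed

locale balanced_data =
  fixes M :: "('a, 'm) ring_scheme" and N :: "('b, 'n) ring_scheme"
    and S :: "'s set" and ra :: "'a \<Rightarrow> 's \<Rightarrow> 'a" and la :: "'s \<Rightarrow> 'b \<Rightarrow> 'b"
  assumes M_group: "abelian_group M" and N_group: "abelian_group N"
    and ra_closed: "x \<in> carrier M \<Longrightarrow> s \<in> S \<Longrightarrow> ra x s \<in> carrier M"
    and la_closed: "s \<in> S \<Longrightarrow> y \<in> carrier N \<Longrightarrow> la s y \<in> carrier N"
begin

sublocale M: abelian_group M by (rule M_group)
sublocale N: abelian_group N by (rule N_group)

abbreviation "F \<equiv> free_Abelian_group (carrier M \<times> carrier N)"
abbreviation "rels \<equiv> tensor_rels M N S ra la"
abbreviation "T \<equiv> balanced_tensor M N S ra la"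

definition cls :: "'a \<Rightarrow> 'b \<Rightarrow> ('a, 'b) tensors"
  where "cls x y = generate F rels #>\<^bsub>F\<^esub> frag_of (x, y)"

sublocale F: comm_group F by (rule abelian_free_Abelian_group)

lemma rels_subset: "rels \<subseteq> carrier F"
proof -
  have "Poly_Mapping.keys (frag_of (x, y) - frag_of (x', y')) \<subseteq> carrier M \<times> carrier N"
    if "x \<in> carrier M" "y \<in> carrier N" "x' \<in> carrier M" "y' \<in> carrier N" for x y x' y'
    using that keys_diff[of "frag_of (x, y)" "frag_of (x', y')"] by auto
  moreover have "Poly_Mapping.keys (frag_of (x, y) - frag_of (x', y') - frag_of (x'', y'')) \<subseteq> carrier M \<times> carrier N"
    if "x \<in> carrier M" "y \<in> carrier N" "x' \<in> carrier M" "y' \<in> carrier N"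
      "x'' \<in> carrier M" "y'' \<in> carrier N" for x y x' y' x'' y''
    using that keys_diff[of "frag_of (x, y)" "frag_of (x', y')"]
      keys_diff[of "frag_of (x, y) - frag_of (x', y')" "frag_of (x'', y'')"] by auto
  ultimately show ?thesis
    using ra_closed la_closed by (auto simp: tensor_rels_def simp del: carrier_free_Abelian_group_iff
      simp: carrier_free_Abelian_group_iff[THEN iffD2])
qed

lemma normal_rels: "normal (generate F rels) F"
  using F.generate_is_subgroup[OF rels_subset] by (simp add: F.normal_iff_subgroup)

lemma T_eq: "T = F Mod generate F rels"
  by (simp add: balanced_tensor_def Let_def)

lemma T_group: "comm_group T"
  unfolding T_eq using F.generate_is_subgroup[OF rels_subset] by (rule F.abelian_FactGroup)

sublocale T: comm_group T by (rule T_group)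

lemma coset_hom: "(\<lambda>p. generate F rels #>\<^bsub>F\<^esub> p) \<in> hom F T"
  unfolding T_eq using normal.r_coset_hom_Mod[OF normal_rels] .

lemma coset_some:
  assumes "t \<in> carrier T"
  shows "(SOME p. p \<in> t) \<in> carrier F" "generate F rels #>\<^bsub>F\<^esub> (SOME p. p \<in> t) = t"
proof -
  obtain q where q: "q \<in> carrier F" "t = generate F rels #>\<^bsub>F\<^esub> q"
    using assms by (auto simp: T_eq carrier_FactGroup)
  have sub: "subgroup (generate F rels) F"
    using F.generate_is_subgroup[OF rels_subset] .
  have "q \<in> t"
    using F.rcos_self[OF q(1) sub] q(2) by simp
  then have p: "(SOME p. p \<in> t) \<in> t"
    by (rule someI)
  show "(SOME p. p \<in> t) \<in> carrier F"
    using p q F.r_coset_subset_G[OF subgroup.subset[OF sub] q(1)] by blast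
  show "generate F rels #>\<^bsub>F\<^esub> (SOME p. p \<in> t) = t"
    using F.repr_independence[OF _ q(1) sub] p q(2) by simp
qed

lemma supported_T: "t \<in> carrier T \<Longrightarrow> supported (carrier M) (carrier N) t"
  using coset_some(1) by (simp add: supported_def)

lemma cls_closed: "x \<in> carrier M \<Longrightarrow> y \<in> carrier N \<Longrightarrow> cls x y \<in> carrier T"
  using coset_hom by (auto simp: cls_def hom_def)

text \<open>
  The projection onto cosets is a homomorphism, so it takes the representative \<open>p\<close> of \<open>t\<close> to the sum of
  the classes of its generators. Consequently homomorphisms are determined by their values on classes of
  pairs.
\<close>

lemma tensor_lift_cls:
  assumes "t \<in> carrier T"
  shows "tensor_lift T cls t = t"
  using hom_free_Abelian_group_expand[OF T_group coset_hom, of "SOME p. p \<in> t"] coset_some[OF assms]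
  by (simp add: tensor_lift_def Let_def case_prod_unfold cls_def)

lemma rel_zero:
  assumes "p \<in> rels" shows "generate F rels #>\<^bsub>F\<^esub> p = \<one>\<^bsub>T\<^esub>"
proof -
  have "p \<in> generate F rels"
    using assms by (rule generate.incl)
  moreover have "p \<in> carrier F"
    using assms rels_subset by blast
  ultimately have "generate F rels #>\<^bsub>F\<^esub> p = generate F rels"
    using F.generate_is_subgroup[OF rels_subset] by (intro F.coset_join2)
  then show ?thesis
    by (simp add: T_eq)
qed

lemma coset_diff_eqD:
  assumes p: "p \<in> carrier F" and q: "q \<in> carrier F"
    and eq: "generate F rels #>\<^bsub>F\<^esub> (p - q) = \<one>\<^bsub>T\<^esub>"
  shows "generate F rels #>\<^bsub>F\<^esub> p = generate F rels #>\<^bsub>F\<^esub> q"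
proof -
  interpret c: group_hom F T "\<lambda>p. generate F rels #>\<^bsub>F\<^esub> p"
    using coset_hom by unfold_locales
  have d: "p - q \<in> carrier F"
    using p q keys_diff[of p q] by auto
  have "generate F rels #>\<^bsub>F\<^esub> ((p - q) + q) = (generate F rels #>\<^bsub>F\<^esub> (p - q)) \<otimes>\<^bsub>T\<^esub> (generate F rels #>\<^bsub>F\<^esub> q)"
    using c.hom_mult[OF d q] by simp
  then show ?thesis
    using eq c.hom_closed[OF q] by simp
qed

lemma coset_add:
  assumes "p \<in> carrier F" "q \<in> carrier F"
  shows "generate F rels #>\<^bsub>F\<^esub> (p + q) = (generate F rels #>\<^bsub>F\<^esub> p) \<otimes>\<^bsub>T\<^esub> (generate F rels #>\<^bsub>F\<^esub> q)"
  using coset_hom assms by (simp add: hom_def)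

lemma cls_add_left:
  assumes "x \<in> carrier M" "x' \<in> carrier M" "y \<in> carrier N"
  shows "cls (x \<oplus>\<^bsub>M\<^esub> x') y = cls x y \<otimes>\<^bsub>T\<^esub> cls x' y"
proof -
  have r: "frag_of (x \<oplus>\<^bsub>M\<^esub> x', y) - frag_of (x, y) - frag_of (x', y) \<in> rels"
    using assms unfolding tensor_rels_def by blast
  have c: "frag_of (x, y) + frag_of (x', y) \<in> carrier F"
    using assms keys_add[of "frag_of (x, y)" "frag_of (x', y)"] by auto
  have "cls (x \<oplus>\<^bsub>M\<^esub> x') y = generate F rels #>\<^bsub>F\<^esub> (frag_of (x, y) + frag_of (x', y))"
    unfolding cls_def using rel_zero[OF r] assms c by (intro coset_diff_eqD) (auto simp: diff_diff_add)
  then show ?thesis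
    using assms by (simp add: cls_def coset_add)
qed

lemma cls_add_right:
  assumes "x \<in> carrier M" "y \<in> carrier N" "y' \<in> carrier N"
  shows "cls x (y \<oplus>\<^bsub>N\<^esub> y') = cls x y \<otimes>\<^bsub>T\<^esub> cls x y'"
proof -
  have r: "frag_of (x, y \<oplus>\<^bsub>N\<^esub> y') - frag_of (x, y) - frag_of (x, y') \<in> rels"
    using assms unfolding tensor_rels_def by blast
  have c: "frag_of (x, y) + frag_of (x, y') \<in> carrier F"
    using assms keys_add[of "frag_of (x, y)" "frag_of (x, y')"] by auto
  have "cls x (y \<oplus>\<^bsub>N\<^esub> y') = generate F rels #>\<^bsub>F\<^esub> (frag_of (x, y) + frag_of (x, y'))"
    unfolding cls_def using rel_zero[OF r] assms c by (intro coset_diff_eqD) (auto simp: diff_diff_add)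
  then show ?thesis
    using assms by (simp add: cls_def coset_add)
qed

lemma cls_balanced:
  assumes "x \<in> carrier M" "s \<in> S" "y \<in> carrier N"
  shows "cls (ra x s) y = cls x (la s y)"
proof -
  have r: "frag_of (ra x s, y) - frag_of (x, la s y) \<in> rels"
    using assms unfolding tensor_rels_def by blast
  then show ?thesis
    unfolding cls_def using rel_zero[OF r] assms ra_closed la_closed
    by (intro coset_diff_eqD) auto
qed

text \<open>
  The homomorphism on the free abelian group induced by \<open>f\<close> kills the relations, so its value on the
  representative chosen by \<open>tensor_lift\<close> agrees with its value on any other one.
\<close>

lemma tensor_lift_universal:
  assumes G: "comm_group G"
    and f: "\<And>x y. x \<in> carrier M \<Longrightarrow> y \<in> carrier N \<Longrightarrow> f x y \<in> carrier G"
    and add_left: "\<And>x x' y. x \<in> carrier M \<Longrightarrow> x' \<in> carrier M \<Longrightarrow> y \<in> carrier N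
      \<Longrightarrow> f (x \<oplus>\<^bsub>M\<^esub> x') y = f x y \<otimes>\<^bsub>G\<^esub> f x' y"
    and add_right: "\<And>x y y'. x \<in> carrier M \<Longrightarrow> y \<in> carrier N \<Longrightarrow> y' \<in> carrier N
      \<Longrightarrow> f x (y \<oplus>\<^bsub>N\<^esub> y') = f x y \<otimes>\<^bsub>G\<^esub> f x y'"
    and balanced: "\<And>x s y. x \<in> carrier M \<Longrightarrow> s \<in> S \<Longrightarrow> y \<in> carrier N \<Longrightarrow> f (ra x s) y = f x (la s y)"
  shows "tensor_lift G f \<in> hom T G"
    and "\<And>x y. x \<in> carrier M \<Longrightarrow> y \<in> carrier N \<Longrightarrow> tensor_lift G f (cls x y) = f x y"
proof -
  interpret G: comm_group G by fact
  have "case_prod f ` (carrier M \<times> carrier N) \<subseteq> carrier G"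
    using f by auto
  then obtain h where h: "h \<in> hom F G"
    and h_of: "\<And>z. z \<in> carrier M \<times> carrier N \<Longrightarrow> h (frag_of z) = case_prod f z"
    by (rule G.free_Abelian_group_universal) blast
  interpret h: group_hom F G h
    using h by unfold_locales
  have diff: "h (p - q) = h p \<otimes>\<^bsub>G\<^esub> inv\<^bsub>G\<^esub> h q" if "p \<in> carrier F" "q \<in> carrier F" for p q
  proof -
    have "p - q = p \<otimes>\<^bsub>F\<^esub> inv\<^bsub>F\<^esub> q"
      using that by simp
    then show ?thesis
      using that by (metis h.hom_mult h.hom_inv F.inv_closed)
  qed
  have "h r = \<one>\<^bsub>G\<^esub>" if "r \<in> rels" for r
  proof -
    have d3: "h (frag_of z - frag_of z1 - frag_of z2)
        = h (frag_of z) \<otimes>\<^bsub>G\<^esub> inv\<^bsub>G\<^esub> h (frag_of z1) \<otimes>\<^bsub>G\<^esub> inv\<^bsub>G\<^esub> h (frag_of z2)"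
      if z: "z \<in> carrier M \<times> carrier N" "z1 \<in> carrier M \<times> carrier N" "z2 \<in> carrier M \<times> carrier N"
      for z z1 z2
    proof -
      have "frag_of z - frag_of z1 \<in> carrier F"
        using z keys_diff[of "frag_of z" "frag_of z1"] by auto
      then show ?thesis
        using z by (simp only: diff frag_of_in_free_Abelian_group)
    qed
    have d2: "h (frag_of z - frag_of z1) = h (frag_of z) \<otimes>\<^bsub>G\<^esub> inv\<^bsub>G\<^esub> h (frag_of z1)"
      if z: "z \<in> carrier M \<times> carrier N" "z1 \<in> carrier M \<times> carrier N" for z z1
      using z by (simp only: diff frag_of_in_free_Abelian_group)
    have gr: "(a \<otimes>\<^bsub>G\<^esub> b) \<otimes>\<^bsub>G\<^esub> inv\<^bsub>G\<^esub> a \<otimes>\<^bsub>G\<^esub> inv\<^bsub>G\<^esub> b = \<one>\<^bsub>G\<^esub>" 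
      if "a \<in> carrier G" "b \<in> carrier G" for a b
      using that by (metis G.inv_closed G.inv_mult_group G.m_assoc G.m_closed G.m_comm G.r_inv)
    show ?thesis
      using that unfolding tensor_rels_def
      by (auto simp: d3 d2 h_of f ra_closed la_closed add_left add_right balanced gr)
  qed
  then have "rels \<subseteq> kernel F G h"
    using rels_subset unfolding kernel_def by blast
  then have ker: "generate F rels \<subseteq> kernel F G h"
    by (intro F.generate_subgroup_incl h.subgroup_kernel)
  have lift: "tensor_lift G f (generate F rels #>\<^bsub>F\<^esub> p) = h p" if p: "p \<in> carrier F" for p
  proof -
    let ?t = "generate F rels #>\<^bsub>F\<^esub> p"
    have t: "?t \<in> carrier T"
      using coset_hom p by (auto simp: hom_def)
    let ?q = "SOME q. q \<in> ?t"
    have q: "?q \<in> carrier F"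
      using coset_some(1)[OF t] .
    have "?q \<in> generate F rels #>\<^bsub>F\<^esub> ?q"
      using F.rcos_self[OF q F.generate_is_subgroup[OF rels_subset]] .
    then have "?q \<in> ?t"
      using coset_some(2)[OF t] by simp
    then obtain r where r: "r \<in> generate F rels" "?q = r \<otimes>\<^bsub>F\<^esub> p"
      by (auto simp: r_coset_def)
    then have "r \<in> carrier F" "h r = \<one>\<^bsub>G\<^esub>"
      using ker unfolding kernel_def by blast+
    then have "h ?q = h p"
      unfolding r(2) using h.hom_mult[of r p] h.hom_closed[OF p] p by (simp del: mult_free_Abelian_group)
    moreover have "h ?q = finprod G (\<lambda>z. h (frag_of z) [^]\<^bsub>G\<^esub> Poly_Mapping.lookup ?q z) (Poly_Mapping.keys ?q)"
      using q by (intro hom_free_Abelian_group_expand[OF G h]) simp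
    moreover have "\<dots> = tensor_lift G f ?t"
      unfolding tensor_lift_def Let_def using q f
      by (intro G.finprod_cong') (auto simp: h_of subset_iff)
    ultimately show ?thesis
      by simp
  qed
  show "tensor_lift G f (cls x y) = f x y" if "x \<in> carrier M" "y \<in> carrier N" for x y
    using that by (simp add: cls_def lift h_of)
  show "tensor_lift G f \<in> hom T G"
  proof (rule homI)
    fix t u assume t: "t \<in> carrier T" and u: "u \<in> carrier T"
    obtain p q where p: "p \<in> carrier F" "t = generate F rels #>\<^bsub>F\<^esub> p"
      and q: "q \<in> carrier F" "u = generate F rels #>\<^bsub>F\<^esub> q"
      using t u by (auto simp: T_eq carrier_FactGroup)
    show "tensor_lift G f t \<in> carrier G"
      using h.hom_closed[OF p(1)] lift[OF p(1)] p(2) by simp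
    have "t \<otimes>\<^bsub>T\<^esub> u = generate F rels #>\<^bsub>F\<^esub> (p \<otimes>\<^bsub>F\<^esub> q)"
      using coset_add p q by simp
    then show "tensor_lift G f (t \<otimes>\<^bsub>T\<^esub> u) = tensor_lift G f t \<otimes>\<^bsub>G\<^esub> tensor_lift G f u"
      using lift p q F.m_closed[OF p(1) q(1)] h.hom_mult[OF p(1) q(1)] by simp
  qed
qed

end

section \<open>Linear maps, and balanced tensor products as modules\<close>

lemma linear_mapsI:
  assumes "\<And>x. x \<in> carrier M \<Longrightarrow> f x \<in> carrier N"
    and "\<And>x y. x \<in> carrier M \<Longrightarrow> y \<in> carrier M \<Longrightarrow> f (x \<oplus>\<^bsub>M\<^esub> y) = f x \<oplus>\<^bsub>N\<^esub> f y"
    and "\<And>r x. r \<in> carrier R \<Longrightarrow> x \<in> carrier M \<Longrightarrow> f (r \<odot>\<^bsub>M\<^esub> x) = r \<odot>\<^bsub>N\<^esub> f x"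
  shows "f \<in> linear_maps R M N"
  using assms by (auto simp: linear_maps_def)

lemma linear_mapsD:
  assumes "f \<in> linear_maps R M N"
  shows linear_closed: "x \<in> carrier M \<Longrightarrow> f x \<in> carrier N"
    and linear_add: "x \<in> carrier M \<Longrightarrow> y \<in> carrier M \<Longrightarrow> f (x \<oplus>\<^bsub>M\<^esub> y) = f x \<oplus>\<^bsub>N\<^esub> f y"
    and linear_smult: "r \<in> carrier R \<Longrightarrow> x \<in> carrier M \<Longrightarrow> f (r \<odot>\<^bsub>M\<^esub> x) = r \<odot>\<^bsub>N\<^esub> f x"
  using assms by (auto simp: linear_maps_def)

lemma linear_hom: "f \<in> linear_maps R M N \<Longrightarrow> f \<in> hom (add_monoid M) (add_monoid N)"
  by (auto simp: linear_maps_def hom_def)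

lemma module_add_group: "module R M \<Longrightarrow> comm_group (add_monoid M)"
  by (simp add: module_def abelian_group.a_comm_group)

lemma linear_zero:
  assumes "module R M" "module R N" "f \<in> linear_maps R M N"
  shows "f \<zero>\<^bsub>M\<^esub> = \<zero>\<^bsub>N\<^esub>"
proof -
  interpret M: module R M by fact
  interpret N: module R N by fact
  have "\<zero>\<^bsub>N\<^esub> = \<zero>\<^bsub>R\<^esub> \<odot>\<^bsub>N\<^esub> f \<zero>\<^bsub>M\<^esub>"
    using linear_closed[OF assms(3), of "\<zero>\<^bsub>M\<^esub>"] by simp
  also have "\<dots> = f (\<zero>\<^bsub>R\<^esub> \<odot>\<^bsub>M\<^esub> \<zero>\<^bsub>M\<^esub>)"
    using linear_smult[OF assms(3), of "\<zero>\<^bsub>R\<^esub>" "\<zero>\<^bsub>M\<^esub>"] by (simp only: M.R.zero_closed M.zero_closed)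
  finally show ?thesis by simp
qed

lemma linear_ident: "(\<lambda>x. x) \<in> linear_maps R M M"
  by (simp add: linear_maps_def)

lemma linear_compose:
  "f \<in> linear_maps R M N \<Longrightarrow> g \<in> linear_maps R N G \<Longrightarrow> (\<lambda>x. g (f x)) \<in> linear_maps R M G"
  by (auto simp: linear_maps_def Pi_iff)

lemma linear_scale:
  assumes "module R G" "f \<in> linear_maps R M G" "r \<in> carrier R"
  shows "(\<lambda>x. r \<odot>\<^bsub>G\<^esub> f x) \<in> linear_maps R M G"
proof -
  interpret G: module R G by fact
  show ?thesis
    using assms(2,3) linear_mapsD[OF assms(2)]
    by (intro linear_mapsI) (auto simp: G.smult_r_distr G.smult_assoc1[symmetric] G.m_comm)
qed

lemma ground_algebra_simps [simp]:
  "carrier (ground_algebra R) = carrier R" "add (ground_algebra R) = add R"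
  "zero (ground_algebra R) = zero R" "one (ground_algebra R) = one R"
  "monoid.mult (ground_algebra R) = monoid.mult R"
  "module.smult (ground_algebra R) = monoid.mult R"
  by (simp_all add: ground_algebra_def)

lemma module_ground:
  assumes "cring R" shows "module R (ground_algebra R)"
proof -
  interpret R: cring R by fact
  show ?thesis
    by (rule moduleI) (auto intro!: assms abelian_groupI simp: R.a_ac R.m_assoc R.l_distr R.r_distr
      intro: R.l_neg R.a_inv_closed bexI[of _ "\<ominus>\<^bsub>R\<^esub> _"])
qed

lemma linear_scalar_factor:
  assumes "module R G" "f \<in> linear_maps R M (ground_algebra R)" "y \<in> carrier G"
  shows "(\<lambda>x. f x \<odot>\<^bsub>G\<^esub> y) \<in> linear_maps R M G"
proof -
  interpret G: module R G by fact
  show ?thesis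
    using assms(3) linear_mapsD[OF assms(2)]
    by (intro linear_mapsI) (auto simp: G.smult_l_distr G.smult_assoc1)
qed

definition bilinear :: "('k, 'l) ring_scheme \<Rightarrow> ('k, 'a) module \<Rightarrow> ('k, 'b) module \<Rightarrow> ('k, 'c) module
    \<Rightarrow> ('a \<Rightarrow> 'b \<Rightarrow> 'c) \<Rightarrow> bool"
  where "bilinear R M N G f \<longleftrightarrow> (\<forall>y\<in>carrier N. (\<lambda>x. f x y) \<in> linear_maps R M G) \<and>
    (\<forall>x\<in>carrier M. f x \<in> linear_maps R N G)"

lemma bilinearI:
  assumes "\<And>y. y \<in> carrier N \<Longrightarrow> (\<lambda>x. f x y) \<in> linear_maps R M G"
    and "\<And>x. x \<in> carrier M \<Longrightarrow> (\<lambda>y. f x y) \<in> linear_maps R N G"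
  shows "bilinear R M N G f"
  using assms by (simp add: bilinear_def)

lemma bilinearD:
  assumes "bilinear R M N G f"
  shows bilinear_left: "y \<in> carrier N \<Longrightarrow> (\<lambda>x. f x y) \<in> linear_maps R M G"
    and bilinear_right: "x \<in> carrier M \<Longrightarrow> (\<lambda>y. f x y) \<in> linear_maps R N G"
    and bilinear_closed: "x \<in> carrier M \<Longrightarrow> y \<in> carrier N \<Longrightarrow> f x y \<in> carrier G"
  using assms by (auto simp: bilinear_def dest: linear_closed)

lemma lift_closed:
  assumes "module R G" "supported U V t" "\<And>x y. x \<in> U \<Longrightarrow> y \<in> V \<Longrightarrow> f x y \<in> carrier G"
  shows "tensor_lift (add_monoid G) f t \<in> carrier G"
  using comm_group.tensor_lift_closed[OF module_add_group[OF assms(1)] assms(2), of f] assms(3) by simp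

lemma lift_cong:
  assumes "module R G" "supported U V t" "\<And>x y. x \<in> U \<Longrightarrow> y \<in> V \<Longrightarrow> g x y \<in> carrier G"
    and "\<And>x y. x \<in> U \<Longrightarrow> y \<in> V \<Longrightarrow> f x y = g x y"
  shows "tensor_lift (add_monoid G) f t = tensor_lift (add_monoid G) g t"
  using comm_group.tensor_lift_cong[OF module_add_group[OF assms(1)] assms(2), of g f] assms(3,4) by simp

lemma lift_linear_out:
  assumes "module R G" "module R G'" "h \<in> linear_maps R G G'" "supported U V t"
    and "\<And>x y. x \<in> U \<Longrightarrow> y \<in> V \<Longrightarrow> f x y \<in> carrier G"
  shows "h (tensor_lift (add_monoid G) f t) = tensor_lift (add_monoid G') (\<lambda>x y. h (f x y)) t"
  using comm_group.tensor_lift_hom[OF module_add_group[OF assms(1)] module_add_group[OF assms(2)]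
    linear_hom[OF assms(3)] assms(4), of f] assms(5) by simp

lemma lift_param_linear:
  assumes G: "module R G" and sup: "supported U V t"
    and f: "\<And>x y. x \<in> U \<Longrightarrow> y \<in> V \<Longrightarrow> (\<lambda>p. f p x y) \<in> linear_maps R P G"
  shows "(\<lambda>p. tensor_lift (add_monoid G) (f p) t) \<in> linear_maps R P G"
proof (rule linear_mapsI)
  note fc = linear_closed[OF f]
  fix p assume p: "p \<in> carrier P"
  show "tensor_lift (add_monoid G) (f p) t \<in> carrier G"
    using fc p by (intro lift_closed[OF G sup])
  { fix q assume q: "q \<in> carrier P"
    have "tensor_lift (add_monoid G) (f (p \<oplus>\<^bsub>P\<^esub> q)) t
        = tensor_lift (add_monoid G) (\<lambda>x y. f p x y \<oplus>\<^bsub>G\<^esub> f q x y) t"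
    proof (rule lift_cong[OF G sup])
      interpret G: module R G by fact
      show "f p x y \<oplus>\<^bsub>G\<^esub> f q x y \<in> carrier G" if "x \<in> U" "y \<in> V" for x y
        using fc[OF that] p q by simp
    qed (use linear_add[OF f] p q in auto)
    then show "tensor_lift (add_monoid G) (f (p \<oplus>\<^bsub>P\<^esub> q)) t
        = tensor_lift (add_monoid G) (f p) t \<oplus>\<^bsub>G\<^esub> tensor_lift (add_monoid G) (f q) t"
      using comm_group.tensor_lift_mult[OF module_add_group[OF G] sup, of "f p" "f q"] fc p q by simp }
  fix r assume r: "r \<in> carrier R"
  have "tensor_lift (add_monoid G) (f (r \<odot>\<^bsub>P\<^esub> p)) t
      = tensor_lift (add_monoid G) (\<lambda>x y. r \<odot>\<^bsub>G\<^esub> f p x y) t"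
    using linear_smult[OF f] fc p r linear_closed[OF linear_scale[OF G linear_ident r]]
    by (intro lift_cong[OF G sup]) auto
  then show "tensor_lift (add_monoid G) (f (r \<odot>\<^bsub>P\<^esub> p)) t = r \<odot>\<^bsub>G\<^esub> tensor_lift (add_monoid G) (f p) t"
    using lift_linear_out[OF G G linear_scale[OF G linear_ident r] sup, of "f p"] fc p by simp
qed

lemma bilinear_compose:
  assumes "bilinear R M N G f" "h \<in> linear_maps R G G'"
  shows "bilinear R M N G' (\<lambda>x y. h (f x y))"
  using assms unfolding bilinear_def by (auto intro: linear_compose)

text \<open>
  The same group is met with different record extensions, as a bare monoid and as the additive group of a
  ring or module.
\<close>

lemma tensor_lift_monoid_cong:
  assumes "carrier G = carrier G'" "monoid.mult G = monoid.mult G'" "one G = one G'"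
  shows "tensor_lift G f t = tensor_lift G' f t"
proof -
  have inv: "m_inv G = m_inv G'"
    by (simp add: m_inv_def assms fun_eq_iff)
  have "pow G = (pow G' :: _ \<Rightarrow> nat \<Rightarrow> _)"
    by (simp add: nat_pow_def assms fun_eq_iff)
  then have "pow G = (pow G' :: _ \<Rightarrow> int \<Rightarrow> _)"
    unfolding int_pow_def inv by (simp add: assms)
  then show ?thesis
    by (simp add: tensor_lift_def finprod_def assms)
qed

text \<open>
  The module structure \<open>r (x \<otimes> y) = (r x) \<otimes> y\<close> on a balanced tensor product. It covers both the tensor
  product over the ground ring and \<open>A \<otimes>\<^sub>B A\<close>: the assumption that every scalar is induced by an element of
  \<open>S\<close> makes \<open>(x, y) \<mapsto> x \<otimes> y\<close> linear in its second argument too. The multiplication and the unit of \<open>U\<close> are left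
  open, because those of \<open>tensor\<close> are not wanted for \<open>A \<otimes>\<^sub>B A\<close>.
\<close>

locale balanced_module = balanced_data M N S ra la
  for R :: "('k, 'l) ring_scheme" and M :: "('k, 'a) module" and N :: "('k, 'b) module"
    and S :: "'s set" and ra la +
  fixes U :: "('k, ('a, 'b) tensors) module"
  assumes M_module: "module R M" and N_module: "module R N"
    and carrier_U: "carrier U = carrier (balanced_tensor M N S ra la)"
    and add_U: "add U = monoid.mult (balanced_tensor M N S ra la)"
    and zero_U: "zero U = one (balanced_tensor M N S ra la)"
    and smult_U: "\<And>r t. module.smult U r t
      = tensor_lift (balanced_tensor M N S ra la) (\<lambda>x y. balanced_data.cls M N S ra la (r \<odot>\<^bsub>M\<^esub> x) y) t"
    and scalars: "\<And>r. r \<in> carrier R \<Longrightarrow> \<exists>s\<in>S. (\<forall>x\<in>carrier M. ra x s = r \<odot>\<^bsub>M\<^esub> x) \<and>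
      (\<forall>y\<in>carrier N. la s y = r \<odot>\<^bsub>N\<^esub> y)"
    and ra_smult: "\<And>r x s. r \<in> carrier R \<Longrightarrow> x \<in> carrier M \<Longrightarrow> s \<in> S
      \<Longrightarrow> ra (r \<odot>\<^bsub>M\<^esub> x) s = r \<odot>\<^bsub>M\<^esub> ra x s"
begin

interpretation MM: module R M by (rule M_module)
interpretation NN: module R N by (rule N_module)

lemmas U_simps = carrier_U add_U zero_U

lemma cls_smult:
  assumes "r \<in> carrier R" "x \<in> carrier M" "y \<in> carrier N"
  shows "cls x (r \<odot>\<^bsub>N\<^esub> y) = cls (r \<odot>\<^bsub>M\<^esub> x) y"
  using scalars[OF assms(1)] cls_balanced assms by fastforce

lemma smult_cls_hom:
  assumes r: "r \<in> carrier R"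
  shows "tensor_lift T (\<lambda>x y. cls (r \<odot>\<^bsub>M\<^esub> x) y) \<in> hom T T"
    "x \<in> carrier M \<Longrightarrow> y \<in> carrier N \<Longrightarrow>
      tensor_lift T (\<lambda>x y. cls (r \<odot>\<^bsub>M\<^esub> x) y) (cls x y) = cls (r \<odot>\<^bsub>M\<^esub> x) y"
proof -
  have [simp]: "r \<odot>\<^bsub>M\<^esub> x \<in> carrier M" if "x \<in> carrier M" for x
    using that r by simp
  note * = tensor_lift_universal[OF T_group, of "\<lambda>x y. cls (r \<odot>\<^bsub>M\<^esub> x) y"]
  show "tensor_lift T (\<lambda>x y. cls (r \<odot>\<^bsub>M\<^esub> x) y) \<in> hom T T"
    by (rule *(1)) (use r in \<open>auto simp: cls_closed MM.smult_r_distr cls_add_left cls_add_right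
      cls_balanced ra_smult[symmetric]\<close>)
  show "tensor_lift T (\<lambda>x y. cls (r \<odot>\<^bsub>M\<^esub> x) y) (cls x y) = cls (r \<odot>\<^bsub>M\<^esub> x) y"
    if "x \<in> carrier M" "y \<in> carrier N"
    by (rule *(2)) (use r that in \<open>auto simp: cls_closed MM.smult_r_distr cls_add_left cls_add_right
      cls_balanced ra_smult[symmetric]\<close>)
qed

lemma module_U: "module R U"
proof (rule moduleI)
  show "cring R" by (rule MM.is_cring)
  show "abelian_group U"
    by (rule abelian_groupI) (auto simp: U_simps T.m_ac intro: T.l_inv_ex)
  fix r s t u assume t: "t \<in> carrier U"
  have t': "t \<in> carrier T"
    using t by (simp add: U_simps)
  note sup = supported_T[OF t']
  show "\<one>\<^bsub>R\<^esub> \<odot>\<^bsub>U\<^esub> t = t"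
    using tensor_lift_cls[OF t'] T.tensor_lift_cong[OF sup, of cls "\<lambda>x y. cls (\<one>\<^bsub>R\<^esub> \<odot>\<^bsub>M\<^esub> x) y"]
    by (simp add: smult_U cls_closed)
  assume r: "r \<in> carrier R"
  have [simp]: "r \<odot>\<^bsub>M\<^esub> x \<in> carrier M" if "x \<in> carrier M" for x
    using that r by simp
  show "r \<odot>\<^bsub>U\<^esub> t \<in> carrier U"
    using smult_cls_hom(1)[OF r] t' by (auto simp: smult_U U_simps hom_def)
  { assume u: "u \<in> carrier U"
    show "r \<odot>\<^bsub>U\<^esub> (t \<oplus>\<^bsub>U\<^esub> u) = r \<odot>\<^bsub>U\<^esub> t \<oplus>\<^bsub>U\<^esub> r \<odot>\<^bsub>U\<^esub> u"
      using smult_cls_hom(1)[OF r] t u by (simp add: smult_U U_simps hom_def) }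
  assume s: "s \<in> carrier R"
  have [simp]: "s \<odot>\<^bsub>M\<^esub> x \<in> carrier M" if "x \<in> carrier M" for x
    using that s by simp
  have "tensor_lift T (\<lambda>x y. cls ((r \<oplus>\<^bsub>R\<^esub> s) \<odot>\<^bsub>M\<^esub> x) y) t
      = tensor_lift T (\<lambda>x y. cls (r \<odot>\<^bsub>M\<^esub> x) y \<otimes>\<^bsub>T\<^esub> cls (s \<odot>\<^bsub>M\<^esub> x) y) t"
    using r s by (intro T.tensor_lift_cong[OF sup])
      (auto simp: cls_closed MM.smult_l_distr cls_add_left)
  then show "(r \<oplus>\<^bsub>R\<^esub> s) \<odot>\<^bsub>U\<^esub> t = r \<odot>\<^bsub>U\<^esub> t \<oplus>\<^bsub>U\<^esub> s \<odot>\<^bsub>U\<^esub> t"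
    using r s T.tensor_lift_mult[OF sup, of "\<lambda>x y. cls (r \<odot>\<^bsub>M\<^esub> x) y" "\<lambda>x y. cls (s \<odot>\<^bsub>M\<^esub> x) y"]
    by (simp add: smult_U U_simps cls_closed)
  have "r \<odot>\<^bsub>U\<^esub> (s \<odot>\<^bsub>U\<^esub> t) = tensor_lift T (\<lambda>x y. tensor_lift T (\<lambda>x y. cls (r \<odot>\<^bsub>M\<^esub> x) y) (cls (s \<odot>\<^bsub>M\<^esub> x) y)) t"
    unfolding smult_U using s by (intro T.tensor_lift_hom[OF T_group smult_cls_hom(1)[OF r] sup]) (simp add: cls_closed)
  also have "\<dots> = tensor_lift T (\<lambda>x y. cls ((r \<otimes>\<^bsub>R\<^esub> s) \<odot>\<^bsub>M\<^esub> x) y) t"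
    using r s by (intro T.tensor_lift_cong[OF sup]) (auto simp: cls_closed smult_cls_hom(2) MM.smult_assoc1)
  finally show "(r \<otimes>\<^bsub>R\<^esub> s) \<odot>\<^bsub>U\<^esub> t = r \<odot>\<^bsub>U\<^esub> (s \<odot>\<^bsub>U\<^esub> t)"
    by (simp add: smult_U)
qed

lemma cls_bilinear: "bilinear R M N U cls"
proof (intro bilinearI linear_mapsI)
  fix r x y assume r: "r \<in> carrier R" and x: "x \<in> carrier M" and y: "y \<in> carrier N"
  show "cls (r \<odot>\<^bsub>M\<^esub> x) y = r \<odot>\<^bsub>U\<^esub> cls x y"
    using smult_cls_hom(2)[OF r x y] by (simp add: smult_U)
  then show "cls x (r \<odot>\<^bsub>N\<^esub> y) = r \<odot>\<^bsub>U\<^esub> cls x y"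
    using cls_smult[OF r x y] by simp
qed (auto simp: U_simps cls_closed cls_add_left cls_add_right)

lemma lift_linear:
  assumes G: "module R G" and f: "bilinear R M N G f"
    and bal: "\<And>x s y. x \<in> carrier M \<Longrightarrow> s \<in> S \<Longrightarrow> y \<in> carrier N \<Longrightarrow> f (ra x s) y = f x (la s y)"
  shows "tensor_lift (add_monoid G) f \<in> linear_maps R U G"
    and "x \<in> carrier M \<Longrightarrow> y \<in> carrier N \<Longrightarrow> tensor_lift (add_monoid G) f (cls x y) = f x y"
proof -
  interpret G: module R G by fact
  have fc: "f x y \<in> carrier G" if "x \<in> carrier M" "y \<in> carrier N" for x y
    using bilinear_closed[OF f that] .
  note * = tensor_lift_universal[OF module_add_group[OF G], of f]
  have hom: "tensor_lift (add_monoid G) f \<in> hom T (add_monoid G)"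
    by (rule *(1)) (use linear_add[OF bilinear_left[OF f]] linear_add[OF bilinear_right[OF f]] bal fc in auto)
  show val: "tensor_lift (add_monoid G) f (cls x y) = f x y" if "x \<in> carrier M" "y \<in> carrier N" for x y
    by (rule *(2)) (use linear_add[OF bilinear_left[OF f]] linear_add[OF bilinear_right[OF f]] bal fc that in auto)
  show "tensor_lift (add_monoid G) f \<in> linear_maps R U G"
  proof (rule linear_mapsI)
    fix r t assume r: "r \<in> carrier R" and t: "t \<in> carrier U"
    have t': "t \<in> carrier T"
      using t by (simp add: U_simps)
    note sup = supported_T[OF t']
    have [simp]: "r \<odot>\<^bsub>M\<^esub> x \<in> carrier M" if "x \<in> carrier M" for x
      using that r by simp
    have "tensor_lift (add_monoid G) f (r \<odot>\<^bsub>U\<^esub> t)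
        = tensor_lift (add_monoid G) (\<lambda>x y. tensor_lift (add_monoid G) f (cls (r \<odot>\<^bsub>M\<^esub> x) y)) t"
      unfolding smult_U by (intro T.tensor_lift_hom[OF module_add_group[OF G] hom sup]) (simp add: cls_closed)
    also have "\<dots> = tensor_lift (add_monoid G) (\<lambda>x y. r \<odot>\<^bsub>G\<^esub> f x y) t"
      using r by (intro comm_group.tensor_lift_cong[OF module_add_group[OF G] sup]) (auto simp: fc val linear_smult[OF bilinear_left[OF f]])
    also have "\<dots> = r \<odot>\<^bsub>G\<^esub> tensor_lift (add_monoid G) f t"
      using linear_hom[OF linear_scale[OF G linear_ident r]]
      by (intro comm_group.tensor_lift_hom[OF module_add_group[OF G] module_add_group[OF G] _ sup, symmetric]) (auto simp: fc)
    finally show "tensor_lift (add_monoid G) f (r \<odot>\<^bsub>U\<^esub> t) = r \<odot>\<^bsub>G\<^esub> tensor_lift (add_monoid G) f t" .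
  qed (use hom in \<open>auto simp: hom_def U_simps\<close>)
qed

lemma lift_cls:
  assumes "u \<in> carrier U" shows "tensor_lift (add_monoid U) cls u = u"
proof -
  have "tensor_lift (add_monoid U) cls u = tensor_lift T cls u"
    by (rule tensor_lift_monoid_cong) (simp_all add: U_simps)
  then show ?thesis
    using tensor_lift_cls[of u] assms by (simp add: U_simps)
qed

lemma supported_U: "u \<in> carrier U \<Longrightarrow> supported (carrier M) (carrier N) u"
  using supported_T[of u] by (simp add: U_simps)

lemma linear_eqI:
  assumes G: "module R G" and h: "h \<in> linear_maps R U G" "h' \<in> linear_maps R U G"
    and eq: "\<And>x y. x \<in> carrier M \<Longrightarrow> y \<in> carrier N \<Longrightarrow> h (cls x y) = h' (cls x y)"
    and u: "u \<in> carrier U"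
  shows "h u = h' u"
proof -
  note sup = supported_U[OF u] and cls = bilinear_closed[OF cls_bilinear]
  have out: "h u = tensor_lift (add_monoid G) (\<lambda>x y. h (cls x y)) u" if "h \<in> linear_maps R U G" for h
    using lift_linear_out[where f = cls, OF module_U G that sup cls] by (simp only: lift_cls[OF u])
  have "tensor_lift (add_monoid G) (\<lambda>x y. h (cls x y)) u = tensor_lift (add_monoid G) (\<lambda>x y. h' (cls x y)) u"
    by (rule lift_cong[OF G sup]) (simp_all add: eq linear_closed[OF h(2)] cls)
  then show ?thesis
    by (simp only: out[OF h(1)] out[OF h(2)])
qed

end

lemma tensor_balanced_module:
  assumes "module R M" "module R N"
  shows "balanced_module R M N (carrier R) (\<lambda>x r. r \<odot>\<^bsub>M\<^esub> x) (\<lambda>r y. r \<odot>\<^bsub>N\<^esub> y) (tensor R M N)"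
proof -
  interpret M: module R M by fact
  interpret N: module R N by fact
  interpret balanced_data M N "carrier R" "\<lambda>x r. r \<odot>\<^bsub>M\<^esub> x" "\<lambda>r y. r \<odot>\<^bsub>N\<^esub> y"
    by unfold_locales auto
  have cls: "cls = pure_tensor R M N"
    by (intro ext) (simp add: cls_def pure_tensor_def Let_def)
  show ?thesis
    by unfold_locales
      (auto simp: assms tensor_def tensor_group_def Let_def cls T_eq FactGroup_def M.smult_assoc1[symmetric] M.m_comm)
qed

section \<open>Maps out of tensor products over the ground ring\<close>

lemma tensor_module:
  assumes "module R M" "module R N"
  shows "module R (tensor R M N)"
  using balanced_module.module_U[OF tensor_balanced_module[OF assms]] .

lemma pure_tensor_eq_cls:
  assumes "module R M" "module R N"
  shows "pure_tensor R M N = balanced_data.cls M N (carrier R) (\<lambda>x r. r \<odot>\<^bsub>M\<^esub> x) (\<lambda>r y. r \<odot>\<^bsub>N\<^esub> y)"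
proof -
  interpret balanced_module R M N "carrier R" "\<lambda>x r. r \<odot>\<^bsub>M\<^esub> x" "\<lambda>r y. r \<odot>\<^bsub>N\<^esub> y" "tensor R M N"
    using tensor_balanced_module[OF assms] .
  show ?thesis
    by (intro ext) (simp add: cls_def pure_tensor_def Let_def)
qed

lemma pure_tensor_bilinear:
  assumes "module R M" "module R N"
  shows "bilinear R M N (tensor R M N) (pure_tensor R M N)"
  using balanced_module.cls_bilinear[OF tensor_balanced_module[OF assms]]
  by (simp add: pure_tensor_eq_cls[OF assms])

lemma tensor_lift_pure:
  assumes "module R M" "module R N" "t \<in> carrier (tensor R M N)"
  shows "tensor_lift (add_monoid (tensor R M N)) (pure_tensor R M N) t = t"
  using balanced_module.lift_cls[OF tensor_balanced_module[OF assms(1,2)] assms(3)]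
  by (simp add: pure_tensor_eq_cls[OF assms(1,2)])

lemma tensor_lift_linear:
  assumes MN: "module R M" "module R N" and G: "module R G" and f: "bilinear R M N G f"
  shows "tensor_lift (add_monoid G) f \<in> linear_maps R (tensor R M N) G"
    and "x \<in> carrier M \<Longrightarrow> y \<in> carrier N \<Longrightarrow> tensor_lift (add_monoid G) f (pure_tensor R M N x y) = f x y"
proof -
  interpret balanced_module R M N "carrier R" "\<lambda>x r. r \<odot>\<^bsub>M\<^esub> x" "\<lambda>r y. r \<odot>\<^bsub>N\<^esub> y" "tensor R M N"
    using tensor_balanced_module[OF MN] .
  have bal: "f (r \<odot>\<^bsub>M\<^esub> x) y = f x (r \<odot>\<^bsub>N\<^esub> y)" if "x \<in> carrier M" "r \<in> carrier R" "y \<in> carrier N" for x r y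
    using that by (simp add: linear_smult[OF bilinear_left[OF f]] linear_smult[OF bilinear_right[OF f]])
  show "tensor_lift (add_monoid G) f \<in> linear_maps R (tensor R M N) G"
    using lift_linear(1)[OF G f bal] .
  show "tensor_lift (add_monoid G) f (pure_tensor R M N x y) = f x y" if "x \<in> carrier M" "y \<in> carrier N"
    using lift_linear(2)[OF G f bal that] by (simp add: pure_tensor_eq_cls[OF MN])
qed

lemma tensor_supported:
  assumes "module R M" "module R N" "t \<in> carrier (tensor R M N)"
  shows "supported (carrier M) (carrier N) t"
proof -
  interpret balanced_module R M N "carrier R" "\<lambda>x r. r \<odot>\<^bsub>M\<^esub> x" "\<lambda>r y. r \<odot>\<^bsub>N\<^esub> y" "tensor R M N"
    using tensor_balanced_module[OF assms(1,2)] .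
  show ?thesis
    using assms(3) by (intro supported_T) (simp add: U_simps)
qed

lemma tensor_lift_tensor_group:
  "tensor_lift (tensor_group R M N) = tensor_lift (add_monoid (tensor R M N))"
  by (intro ext tensor_lift_monoid_cong) (simp_all add: tensor_def Let_def)

lemma lift_tensor_map:
  assumes mods: "module R M" "module R N" "module R M'" "module R N'" "module R G"
    and f: "f \<in> linear_maps R M M'" and g: "g \<in> linear_maps R N N'"
    and F: "bilinear R M' N' G F" and t: "t \<in> carrier (tensor R M N)"
  shows "tensor_map R M' N' f g t \<in> carrier (tensor R M' N')"
    and "tensor_lift (add_monoid G) F (tensor_map R M' N' f g t)
      = tensor_lift (add_monoid G) (\<lambda>x y. F (f x) (g y)) t"
proof -
  note sup = tensor_supported[OF mods(1,2) t]
  have pc: "pure_tensor R M' N' (f x) (g y) \<in> carrier (tensor R M' N')"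
    if "x \<in> carrier M" "y \<in> carrier N" for x y
    using bilinear_closed[OF pure_tensor_bilinear[OF mods(3,4)]] linear_closed f g that by metis
  show "tensor_map R M' N' f g t \<in> carrier (tensor R M' N')"
    unfolding tensor_map_def tensor_lift_tensor_group
    using pc by (intro lift_closed[OF tensor_module[OF mods(3,4)] sup])
  have "tensor_lift (add_monoid G) F (tensor_map R M' N' f g t)
      = tensor_lift (add_monoid G) (\<lambda>x y. tensor_lift (add_monoid G) F (pure_tensor R M' N' (f x) (g y))) t"
    unfolding tensor_map_def tensor_lift_tensor_group
    by (intro lift_linear_out[OF tensor_module[OF mods(3,4)] mods(5)
        tensor_lift_linear(1)[OF mods(3-5) F] sup] pc)
  also have "\<dots> = tensor_lift (add_monoid G) (\<lambda>x y. F (f x) (g y)) t"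
    by (intro lift_cong[OF mods(5) sup] tensor_lift_linear(2)[OF mods(3-5) F] bilinear_closed[OF F]
      linear_closed[OF f] linear_closed[OF g])
  finally show "tensor_lift (add_monoid G) F (tensor_map R M' N' f g t)
      = tensor_lift (add_monoid G) (\<lambda>x y. F (f x) (g y)) t" .
qed

definition trilinear :: "('k, 'l) ring_scheme \<Rightarrow> ('k, 'a) module \<Rightarrow> ('k, 'b) module \<Rightarrow> ('k, 'c) module
    \<Rightarrow> ('k, 'd) module \<Rightarrow> ('a \<Rightarrow> 'b \<Rightarrow> 'c \<Rightarrow> 'd) \<Rightarrow> bool"
  where "trilinear R L M N G F \<longleftrightarrow> (\<forall>z\<in>carrier N. bilinear R L M G (\<lambda>x y. F x y z)) \<and>
    (\<forall>x\<in>carrier L. bilinear R M N G (F x))"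

lemma trilinearI:
  assumes "\<And>y z. y \<in> carrier M \<Longrightarrow> z \<in> carrier N \<Longrightarrow> (\<lambda>x. F x y z) \<in> linear_maps R L G"
    and "\<And>x z. x \<in> carrier L \<Longrightarrow> z \<in> carrier N \<Longrightarrow> (\<lambda>y. F x y z) \<in> linear_maps R M G"
    and "\<And>x y. x \<in> carrier L \<Longrightarrow> y \<in> carrier M \<Longrightarrow> (\<lambda>z. F x y z) \<in> linear_maps R N G"
  shows "trilinear R L M N G F"
  using assms by (auto simp: trilinear_def intro!: bilinearI)

lemma trilinearD:
  assumes "trilinear R L M N G F"
  shows trilinear_1: "y \<in> carrier M \<Longrightarrow> z \<in> carrier N \<Longrightarrow> (\<lambda>x. F x y z) \<in> linear_maps R L G"
    and trilinear_2: "x \<in> carrier L \<Longrightarrow> z \<in> carrier N \<Longrightarrow> (\<lambda>y. F x y z) \<in> linear_maps R M G"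
    and trilinear_3: "x \<in> carrier L \<Longrightarrow> y \<in> carrier M \<Longrightarrow> (\<lambda>z. F x y z) \<in> linear_maps R N G"
    and trilinear_12: "z \<in> carrier N \<Longrightarrow> bilinear R L M G (\<lambda>x y. F x y z)"
    and trilinear_23: "x \<in> carrier L \<Longrightarrow> bilinear R M N G (F x)"
    and trilinear_closed: "x \<in> carrier L \<Longrightarrow> y \<in> carrier M \<Longrightarrow> z \<in> carrier N \<Longrightarrow> F x y z \<in> carrier G"
  using assms by (auto simp: trilinear_def intro: bilinear_left bilinear_right bilinear_closed)

lemma trilinear_nested_left:
  assumes mods: "module R L" "module R M" "module R N" "module R G" and F: "trilinear R L M N G F"
  shows "bilinear R (tensor R L M) N G (\<lambda>t z. tensor_lift (add_monoid G) (\<lambda>x y. F x y z) t)"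
  by (intro bilinearI tensor_lift_linear(1)[OF mods(1,2,4)] trilinear_12[OF F]
    lift_param_linear[OF mods(4) tensor_supported[OF mods(1,2)]] trilinear_3[OF F])

lemma trilinear_nested_right:
  assumes mods: "module R L" "module R M" "module R N" "module R G" and F: "trilinear R L M N G F"
  shows "bilinear R L (tensor R M N) G (\<lambda>x t. tensor_lift (add_monoid G) (F x) t)"
  by (intro bilinearI tensor_lift_linear(1)[OF mods(2,3,4)] trilinear_23[OF F]
    lift_param_linear[OF mods(4) tensor_supported[OF mods(2,3)]] trilinear_1[OF F])

lemma lift_tensor_assoc:
  assumes mods: "module R L" "module R M" "module R N" "module R G" and F: "trilinear R L M N G F"
    and w: "w \<in> carrier (tensor R (tensor R L M) N)"
  shows "tensor_lift (add_monoid G) (\<lambda>x. tensor_lift (add_monoid G) (F x)) (tensor_assoc R L M N w)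
    = tensor_lift (add_monoid G) (\<lambda>t z. tensor_lift (add_monoid G) (\<lambda>x y. F x y z) t) w"
proof -
  let ?A = "tensor R L (tensor R M N)"
  let ?p = "\<lambda>x y z. pure_tensor R L (tensor R M N) x (pure_tensor R M N y z)"
  let ?h = "tensor_lift (add_monoid G) (\<lambda>x. tensor_lift (add_monoid G) (F x))"
  note LM = tensor_module[OF mods(1,2)] and MN = tensor_module[OF mods(2,3)]
  note A = tensor_module[OF mods(1) MN]
  note bl = trilinear_nested_right[OF mods F]
  note h = tensor_lift_linear[OF mods(1) MN mods(4) bl]
  have p: "trilinear R L M N ?A ?p"
  proof (intro trilinearI)
    fix x y assume xy: "x \<in> carrier L" "y \<in> carrier M"
    show "(\<lambda>z. ?p x y z) \<in> linear_maps R N ?A"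
      using linear_compose[OF bilinear_right[OF pure_tensor_bilinear[OF mods(2,3)] xy(2)]
        bilinear_right[OF pure_tensor_bilinear[OF mods(1) MN] xy(1)]] .
  next
    fix x z assume xz: "x \<in> carrier L" "z \<in> carrier N"
    show "(\<lambda>y. ?p x y z) \<in> linear_maps R M ?A"
      using linear_compose[OF bilinear_left[OF pure_tensor_bilinear[OF mods(2,3)] xz(2)]
        bilinear_right[OF pure_tensor_bilinear[OF mods(1) MN] xz(1)]] .
  next
    fix y z assume yz: "y \<in> carrier M" "z \<in> carrier N"
    then have "pure_tensor R M N y z \<in> carrier (tensor R M N)"
      using bilinear_closed[OF pure_tensor_bilinear[OF mods(2,3)]] by blast
    then show "(\<lambda>x. ?p x y z) \<in> linear_maps R L ?A"
      using bilinear_left[OF pure_tensor_bilinear[OF mods(1) MN]] by blast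
  qed
  have hp: "?h (?p x y z) = F x y z" if "x \<in> carrier L" "y \<in> carrier M" "z \<in> carrier N" for x y z
    using that bilinear_closed[OF pure_tensor_bilinear[OF mods(2,3)]]
    by (simp add: h(2) tensor_lift_linear(2)[OF mods(2,3,4) trilinear_23[OF F]])
  note sw = tensor_supported[OF LM mods(3) w]
  have "?h (tensor_assoc R L M N w)
      = tensor_lift (add_monoid G) (\<lambda>t z. ?h (tensor_lift (add_monoid ?A) (\<lambda>x y. ?p x y z) t)) w"
    unfolding tensor_assoc_def Let_def tensor_lift_tensor_group
    by (intro lift_linear_out[OF A mods(4) h(1) sw]
      bilinear_closed[OF trilinear_nested_left[OF mods(1-3) A p]])
  also have "\<dots> = tensor_lift (add_monoid G) (\<lambda>t z. tensor_lift (add_monoid G) (\<lambda>x y. F x y z) t) w"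
  proof (rule lift_cong[OF mods(4) sw])
    fix t z assume t: "t \<in> carrier (tensor R L M)" and z: "z \<in> carrier N"
    note st = tensor_supported[OF mods(1,2) t]
    have "?h (tensor_lift (add_monoid ?A) (\<lambda>x y. ?p x y z) t)
        = tensor_lift (add_monoid G) (\<lambda>x y. ?h (?p x y z)) t"
      using z by (intro lift_linear_out[OF A mods(4) h(1) st] trilinear_closed[OF p])
    also have "\<dots> = tensor_lift (add_monoid G) (\<lambda>x y. F x y z) t"
      using z by (intro lift_cong[OF mods(4) st] hp trilinear_closed[OF F])
    finally show "?h (tensor_lift (add_monoid ?A) (\<lambda>x y. ?p x y z) t)
        = tensor_lift (add_monoid G) (\<lambda>x y. F x y z) t" .
    show "tensor_lift (add_monoid G) (\<lambda>x y. F x y z) t \<in> carrier G"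
      using bilinear_closed[OF trilinear_nested_left[OF mods F] t z] .
  qed
  finally show ?thesis .
qed

text \<open>
  Together with the multiplicativity of a coaction this yields the usual rule
  \<open>(a b)\<^sub>0 \<otimes> (a b)\<^sub>1 = a\<^sub>0 b\<^sub>0 \<otimes> a\<^sub>1 b\<^sub>1\<close> inside Sweedler sums.
\<close>

lemma lift_tensor_mult:
  assumes mods: "module R M" "module R N" "module R G"
    and M: "bilinear R M M M (monoid.mult M)" and N: "bilinear R N N N (monoid.mult N)"
    and F: "bilinear R M N G F"
    and t: "t \<in> carrier (tensor R M N)" and u: "u \<in> carrier (tensor R M N)"
  shows "tensor_lift (add_monoid G) F (t \<otimes>\<^bsub>tensor R M N\<^esub> u)
    = tensor_lift (add_monoid G) (\<lambda>x y. tensor_lift (add_monoid G) (\<lambda>x' y'. F (x \<otimes>\<^bsub>M\<^esub> x') (y \<otimes>\<^bsub>N\<^esub> y')) u) t"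
proof -
  let ?T = "tensor R M N" and ?h = "tensor_lift (add_monoid G) F"
  note T = tensor_module[OF mods(1,2)]
  note st = tensor_supported[OF mods(1,2) t] and su = tensor_supported[OF mods(1,2) u]
  note h = tensor_lift_linear[OF mods F]
  have pc: "pure_tensor R M N (x \<otimes>\<^bsub>M\<^esub> x') (y \<otimes>\<^bsub>N\<^esub> y') \<in> carrier ?T"
    if "x \<in> carrier M" "x' \<in> carrier M" "y \<in> carrier N" "y' \<in> carrier N" for x x' y y'
    using that bilinear_closed[OF M] bilinear_closed[OF N]
      bilinear_closed[OF pure_tensor_bilinear[OF mods(1,2)]] by blast
  have "t \<otimes>\<^bsub>?T\<^esub> u = tensor_lift (add_monoid ?T) (\<lambda>x y. tensor_lift (add_monoid ?T)
      (\<lambda>x' y'. pure_tensor R M N (x \<otimes>\<^bsub>M\<^esub> x') (y \<otimes>\<^bsub>N\<^esub> y')) u) t"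
    unfolding tensor_lift_tensor_group[symmetric] by (simp add: tensor_def Let_def)
  then have "?h (t \<otimes>\<^bsub>?T\<^esub> u) = ?h \<dots>"
    by simp
  also have "\<dots> = tensor_lift (add_monoid G) (\<lambda>x y. ?h (tensor_lift (add_monoid ?T)
      (\<lambda>x' y'. pure_tensor R M N (x \<otimes>\<^bsub>M\<^esub> x') (y \<otimes>\<^bsub>N\<^esub> y')) u)) t"
    by (intro lift_linear_out[OF T mods(3) h(1) st] lift_closed[OF T su] pc)
  also have "\<dots> = tensor_lift (add_monoid G) (\<lambda>x y. tensor_lift (add_monoid G)
      (\<lambda>x' y'. F (x \<otimes>\<^bsub>M\<^esub> x') (y \<otimes>\<^bsub>N\<^esub> y')) u) t"
  proof (rule lift_cong[OF mods(3) st])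
    fix x y assume x: "x \<in> carrier M" and y: "y \<in> carrier N"
    have "?h (tensor_lift (add_monoid ?T) (\<lambda>x' y'. pure_tensor R M N (x \<otimes>\<^bsub>M\<^esub> x') (y \<otimes>\<^bsub>N\<^esub> y')) u)
        = tensor_lift (add_monoid G) (\<lambda>x' y'. ?h (pure_tensor R M N (x \<otimes>\<^bsub>M\<^esub> x') (y \<otimes>\<^bsub>N\<^esub> y'))) u"
      using x y by (intro lift_linear_out[OF T mods(3) h(1) su] pc)
    also have "\<dots> = tensor_lift (add_monoid G) (\<lambda>x' y'. F (x \<otimes>\<^bsub>M\<^esub> x') (y \<otimes>\<^bsub>N\<^esub> y')) u"
      using x y by (intro lift_cong[OF mods(3) su] h(2) bilinear_closed[OF F] bilinear_closed[OF M]
        bilinear_closed[OF N])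
    finally show "?h (tensor_lift (add_monoid ?T) (\<lambda>x' y'. pure_tensor R M N (x \<otimes>\<^bsub>M\<^esub> x') (y \<otimes>\<^bsub>N\<^esub> y')) u)
      = tensor_lift (add_monoid G) (\<lambda>x' y'. F (x \<otimes>\<^bsub>M\<^esub> x') (y \<otimes>\<^bsub>N\<^esub> y')) u" .
    show "tensor_lift (add_monoid G) (\<lambda>x' y'. F (x \<otimes>\<^bsub>M\<^esub> x') (y \<otimes>\<^bsub>N\<^esub> y')) u \<in> carrier G"
      using x y by (intro lift_closed[OF mods(3) su] bilinear_closed[OF F] bilinear_closed[OF M]
        bilinear_closed[OF N])
  qed
  finally show ?thesis .
qed

section \<open>Sweedler sums\<close>

text \<open>
  The Sweedler sum \<open>f (c\<^sub>0, c\<^sub>1)\<close> for \<open>\<rho> c = c\<^sub>0 \<otimes> c\<^sub>1\<close>. Cutting off \<open>f\<close> and \<open>\<rho>\<close> outside their carriers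
  changes nothing for the arguments of interest, but makes the congruence rule below unconditional, so
  that nested sums can be rewritten from the inside.
\<close>

definition sweedler :: "('k, 'c) module \<Rightarrow> ('k, 'a) module \<Rightarrow> ('k, 'b) module \<Rightarrow> ('c \<Rightarrow> ('a, 'b) tensors)
    \<Rightarrow> ('k, 'd) module \<Rightarrow> ('a \<Rightarrow> 'b \<Rightarrow> 'd) \<Rightarrow> 'c \<Rightarrow> 'd"
  where "sweedler C M N \<rho> G f c = (if c \<in> carrier C then tensor_lift (add_monoid G)
      (\<lambda>x y. if x \<in> carrier M \<and> y \<in> carrier N then f x y else \<zero>\<^bsub>G\<^esub>) (\<rho> c) else \<zero>\<^bsub>G\<^esub>)"

lemma sweedler_cong [cong]:
  assumes "c = c'" "\<And>x y. x \<in> carrier M \<Longrightarrow> y \<in> carrier N \<Longrightarrow> f x y = g x y"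
  shows "sweedler C M N \<rho> G f c = sweedler C M N \<rho> G g c'"
proof -
  have "(\<lambda>x y. if x \<in> carrier M \<and> y \<in> carrier N then f x y else \<zero>\<^bsub>G\<^esub>)
      = (\<lambda>x y. if x \<in> carrier M \<and> y \<in> carrier N then g x y else \<zero>\<^bsub>G\<^esub>)"
    using assms(2) by (intro ext) simp
  then show ?thesis
    by (simp add: sweedler_def assms(1))
qed

text \<open>
  Coproducts, left coactions and right coactions are treated alike: what Sweedler sums need is a linear map
  into a tensor product.
\<close>

locale tensor_valued_map =
  fixes R :: "('k, 'l) ring_scheme" and C :: "('k, 'c) module" and M :: "('k, 'a) module"
    and N :: "('k, 'b) module" and \<rho> :: "'c \<Rightarrow> ('a, 'b) tensors"
  assumes C_module: "module R C" and M_module: "module R M" and N_module: "module R N"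
    and \<rho>_linear: "\<rho> \<in> linear_maps R C (tensor R M N)"
begin

abbreviation "sw \<equiv> sweedler C M N \<rho>"

lemma supp: "c \<in> carrier C \<Longrightarrow> supported (carrier M) (carrier N) (\<rho> c)"
  using tensor_supported[OF M_module N_module linear_closed[OF \<rho>_linear]] .

lemma sw_eq:
  assumes "module R G" "c \<in> carrier C"
    and "\<And>x y. x \<in> carrier M \<Longrightarrow> y \<in> carrier N \<Longrightarrow> f x y \<in> carrier G"
  shows "sw G f c = tensor_lift (add_monoid G) f (\<rho> c)"
  unfolding sweedler_def if_P[OF assms(2)]
  by (rule lift_cong[OF assms(1) supp[OF assms(2)] assms(3)]) simp_all

lemma sw_undefined: "c \<notin> carrier C \<Longrightarrow> sw G f c = \<zero>\<^bsub>G\<^esub>"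
  by (simp add: sweedler_def)

lemma sw_closed:
  assumes G: "module R G"
    and f: "\<And>x y. x \<in> carrier M \<Longrightarrow> y \<in> carrier N \<Longrightarrow> f x y \<in> carrier G"
  shows "sw G f c \<in> carrier G"
proof (cases "c \<in> carrier C")
  case True
  have "sw G f c = tensor_lift (add_monoid G) f (\<rho> c)"
    by (rule sw_eq[OF G True f])
  also have "\<dots> \<in> carrier G"
    by (rule lift_closed[OF G supp[OF True] f])
  finally show ?thesis .
next
  case False
  interpret G: module R G by fact
  show ?thesis
    unfolding sw_undefined[OF False] by (rule G.zero_closed)
qed

lemma sw_out:
  assumes G: "module R G" "module R G'" and h: "h \<in> linear_maps R G G'"
    and f: "\<And>x y. x \<in> carrier M \<Longrightarrow> y \<in> carrier N \<Longrightarrow> f x y \<in> carrier G"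
  shows "h (sw G f c) = sw G' (\<lambda>x y. h (f x y)) c"
proof (cases "c \<in> carrier C")
  case True
  have hf: "h (f x y) \<in> carrier G'" if "x \<in> carrier M" "y \<in> carrier N" for x y
    using f[OF that] by (rule linear_closed[OF h])
  have "sw G f c = tensor_lift (add_monoid G) f (\<rho> c)"
    by (rule sw_eq[OF G(1) True f])
  then have "h (sw G f c) = h (tensor_lift (add_monoid G) f (\<rho> c))"
    by (rule arg_cong)
  also have "\<dots> = tensor_lift (add_monoid G') (\<lambda>x y. h (f x y)) (\<rho> c)"
    by (rule lift_linear_out[OF G h supp[OF True] f])
  also have "\<dots> = sw G' (\<lambda>x y. h (f x y)) c"
    by (rule sw_eq[OF G(2) True hf, symmetric])
  finally show ?thesis .
qed (simp add: sw_undefined linear_zero[OF G h])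

lemma sw_scale:
  assumes G: "module R G" and r: "r \<in> carrier R"
    and f: "\<And>x y. x \<in> carrier M \<Longrightarrow> y \<in> carrier N \<Longrightarrow> f x y \<in> carrier G"
  shows "r \<odot>\<^bsub>G\<^esub> sw G f c = sw G (\<lambda>x y. r \<odot>\<^bsub>G\<^esub> f x y) c"
  by (rule sw_out[OF G G linear_scale[OF G linear_ident r] f])

lemma sw_scalar_out:
  assumes G: "module R G" and z: "z \<in> carrier G"
    and f: "\<And>x y. x \<in> carrier M \<Longrightarrow> y \<in> carrier N \<Longrightarrow> f x y \<in> carrier R"
  shows "sw (ground_algebra R) f c \<odot>\<^bsub>G\<^esub> z = sw G (\<lambda>x y. f x y \<odot>\<^bsub>G\<^esub> z) c"
proof -
  have ground: "module R (ground_algebra R)"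
    using G by (intro module_ground) (simp add: module_def)
  show ?thesis
    by (rule sw_out[OF ground G linear_scalar_factor[OF G linear_ident z]]) (simp add: f)
qed

lemma sw_linear:
  assumes G: "module R G" and f: "bilinear R M N G f"
  shows "sw G f \<in> linear_maps R C G"
proof -
  interpret C: module R C by (rule C_module)
  have lin: "(\<lambda>c. tensor_lift (add_monoid G) f (\<rho> c)) \<in> linear_maps R C G"
    by (rule linear_compose[OF \<rho>_linear tensor_lift_linear(1)[OF M_module N_module G f]])
  have eq: "sw G f c = tensor_lift (add_monoid G) f (\<rho> c)" if "c \<in> carrier C" for c
    using that by (rule sw_eq[OF G]) (rule bilinear_closed[OF f])
  show ?thesis
    by (rule linear_mapsI) (simp_all add: eq linear_mapsD[OF lin])
qed

lemma sw_param_linear: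
  assumes G: "module R G"
    and f: "\<And>x y. x \<in> carrier M \<Longrightarrow> y \<in> carrier N \<Longrightarrow> (\<lambda>p. f p x y) \<in> linear_maps R P G"
  shows "(\<lambda>p. sw G (f p) c) \<in> linear_maps R P G"
proof (cases "c \<in> carrier C")
  case True
  interpret G: module R G by fact
  have "(\<lambda>p. if x \<in> carrier M \<and> y \<in> carrier N then f p x y else \<zero>\<^bsub>G\<^esub>) \<in> linear_maps R P G"
    if "x \<in> carrier M" "y \<in> carrier N" for x y
    using that f by simp
  note lin = lift_param_linear[where f = "\<lambda>p x y. if x \<in> carrier M \<and> y \<in> carrier N then f p x y else \<zero>\<^bsub>G\<^esub>",
      OF G supp[OF True] this]
  show ?thesis
    unfolding sweedler_def if_P[OF True] by (rule lin)
next
  case False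
  interpret G: module R G by fact
  show ?thesis
    using False by (simp add: sweedler_def linear_maps_def)
qed

lemma sw_param_bilinear:
  assumes G: "module R G"
    and f: "\<And>x y. x \<in> carrier M \<Longrightarrow> y \<in> carrier N \<Longrightarrow> bilinear R P Q G (\<lambda>p q. f p q x y)"
  shows "bilinear R P Q G (\<lambda>p q. sw G (f p q) c)"
  by (rule bilinearI; rule sw_param_linear[OF G])
    ((rule bilinear_left[OF f] bilinear_right[OF f]; assumption)+)

lemma sw_param_trilinear:
  assumes G: "module R G"
    and f: "\<And>x y. x \<in> carrier M \<Longrightarrow> y \<in> carrier N \<Longrightarrow> trilinear R P Q Z G (\<lambda>p q r. f p q r x y)"
  shows "trilinear R P Q Z G (\<lambda>p q r. sw G (f p q r) c)"
  by (rule trilinearI; rule sw_param_linear[OF G])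
    ((rule trilinear_1[OF f] trilinear_2[OF f] trilinear_3[OF f]; assumption)+)

lemma sw_mult:
  assumes G: "module R G" and mult: "\<And>c c'. c \<in> carrier C \<Longrightarrow> c' \<in> carrier C
      \<Longrightarrow> c \<otimes>\<^bsub>C\<^esub> c' \<in> carrier C \<and> \<rho> (c \<otimes>\<^bsub>C\<^esub> c') = \<rho> c \<otimes>\<^bsub>tensor R M N\<^esub> \<rho> c'"
    and M: "bilinear R M M M (monoid.mult M)" and N: "bilinear R N N N (monoid.mult N)"
    and F: "bilinear R M N G F" and c: "c \<in> carrier C" "c' \<in> carrier C"
  shows "sw G F (c \<otimes>\<^bsub>C\<^esub> c') = sw G (\<lambda>x y. sw G (\<lambda>x' y'. F (x \<otimes>\<^bsub>M\<^esub> x') (y \<otimes>\<^bsub>N\<^esub> y')) c') c"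
proof -
  have cl: "F (x \<otimes>\<^bsub>M\<^esub> x') (y \<otimes>\<^bsub>N\<^esub> y') \<in> carrier G"
    if "x \<in> carrier M" "x' \<in> carrier M" "y \<in> carrier N" "y' \<in> carrier N" for x x' y y'
    using that bilinear_closed[OF M] bilinear_closed[OF N] bilinear_closed[OF F] by blast
  have "sw G (\<lambda>x y. sw G (\<lambda>x' y'. F (x \<otimes>\<^bsub>M\<^esub> x') (y \<otimes>\<^bsub>N\<^esub> y')) c') c
      = sw G (\<lambda>x y. tensor_lift (add_monoid G) (\<lambda>x' y'. F (x \<otimes>\<^bsub>M\<^esub> x') (y \<otimes>\<^bsub>N\<^esub> y')) (\<rho> c')) c"
    using c cl by (intro sweedler_cong refl sw_eq[OF G])
  also have "\<dots> = tensor_lift (add_monoid G) (\<lambda>x y. tensor_lift (add_monoid G)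
      (\<lambda>x' y'. F (x \<otimes>\<^bsub>M\<^esub> x') (y \<otimes>\<^bsub>N\<^esub> y')) (\<rho> c')) (\<rho> c)"
    using c cl by (intro sw_eq[OF G] lift_closed[OF G supp[of c']])
  also have "\<dots> = tensor_lift (add_monoid G) F (\<rho> c \<otimes>\<^bsub>tensor R M N\<^esub> \<rho> c')"
    using c linear_closed[OF \<rho>_linear]
    by (intro lift_tensor_mult[OF M_module N_module G M N F, symmetric])
  also have "\<dots> = sw G F (c \<otimes>\<^bsub>C\<^esub> c')"
    using mult[OF c] sw_eq[OF G, of "c \<otimes>\<^bsub>C\<^esub> c'" F] bilinear_closed[OF F] by simp
  finally show ?thesis ..
qed

end

lemma sweedler_swap:
  assumes "tensor_valued_map R C M N \<rho>" "tensor_valued_map R C' M' N' \<rho>'" and G: "module R G"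
    and f: "\<And>x y z w. x \<in> carrier M \<Longrightarrow> y \<in> carrier N \<Longrightarrow> z \<in> carrier M' \<Longrightarrow> w \<in> carrier N'
      \<Longrightarrow> f x y z w \<in> carrier G"
  shows "sweedler C M N \<rho> G (\<lambda>x y. sweedler C' M' N' \<rho>' G (\<lambda>z w. f x y z w) c') c
    = sweedler C' M' N' \<rho>' G (\<lambda>z w. sweedler C M N \<rho> G (\<lambda>x y. f x y z w) c) c'"
proof -
  interpret one: tensor_valued_map R C M N \<rho> by fact
  interpret two: tensor_valued_map R C' M' N' \<rho>' by fact
  interpret G: module R G by fact
  have z1: "one.sw G (\<lambda>x y. \<zero>\<^bsub>G\<^esub>) c = \<zero>\<^bsub>G\<^esub>" and z2: "two.sw G (\<lambda>x y. \<zero>\<^bsub>G\<^esub>) c' = \<zero>\<^bsub>G\<^esub>"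
    using one.sw_out[OF G G, of "\<lambda>_. \<zero>\<^bsub>G\<^esub>" "\<lambda>_ _. \<zero>\<^bsub>G\<^esub>" c] two.sw_out[OF G G, of "\<lambda>_. \<zero>\<^bsub>G\<^esub>" "\<lambda>_ _. \<zero>\<^bsub>G\<^esub>" c']
    by (auto simp: linear_maps_def)
  show ?thesis
  proof (cases "c \<in> carrier C \<and> c' \<in> carrier C'")
    case True
    then have c: "c \<in> carrier C" "c' \<in> carrier C'" by auto
    have "one.sw G (\<lambda>x y. two.sw G (\<lambda>z w. f x y z w) c') c
        = one.sw G (\<lambda>x y. tensor_lift (add_monoid G) (\<lambda>z w. f x y z w) (\<rho>' c')) c"
      using c f by (intro sweedler_cong refl two.sw_eq[OF G])
    also have "\<dots> = tensor_lift (add_monoid G) (\<lambda>x y. tensor_lift (add_monoid G) (\<lambda>z w. f x y z w) (\<rho>' c')) (\<rho> c)"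
      using c f by (intro one.sw_eq[OF G] lift_closed[OF G two.supp[OF c(2)]])
    also have "\<dots> = tensor_lift (add_monoid G) (\<lambda>z w. tensor_lift (add_monoid G) (\<lambda>x y. f x y z w) (\<rho> c)) (\<rho>' c')"
      using comm_group.tensor_lift_swap[OF module_add_group[OF G] one.supp[OF c(1)] two.supp[OF c(2)], of f] f
      by simp
    also have "\<dots> = two.sw G (\<lambda>z w. tensor_lift (add_monoid G) (\<lambda>x y. f x y z w) (\<rho> c)) c'"
      using c f by (intro two.sw_eq[OF G, symmetric] lift_closed[OF G one.supp[OF c(1)]])
    also have "\<dots> = two.sw G (\<lambda>z w. one.sw G (\<lambda>x y. f x y z w) c) c'"
      using c f by (intro sweedler_cong refl one.sw_eq[OF G, symmetric])
    finally show ?thesis .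
  next
    case False
    then consider "c \<notin> carrier C" | "c' \<notin> carrier C'" by blast
    then show ?thesis
    proof cases
      case 1
      then have "one.sw G g c = \<zero>\<^bsub>G\<^esub>" for g
        by (simp add: sweedler_def)
      then show ?thesis
        by (simp only: z2)
    next
      case 2
      then have "two.sw G g c' = \<zero>\<^bsub>G\<^esub>" for g
        by (simp add: sweedler_def)
      then show ?thesis
        by (simp only: z1)
    qed
  qed
qed

lemma linear_id: "id \<in> linear_maps R M M"
  by (simp add: linear_maps_def)

text \<open>
  This common shape covers the coassociativity of a left coaction (\<open>\<alpha> = \<gamma> = \<kappa> = \<rho>\<close> and \<open>\<beta> = \<Delta>\<close>) and the
  compatibility of two coactions (\<open>\<alpha> = \<kappa> = \<delta>\<close> and \<open>\<beta> = \<gamma> = \<rho>\<close>).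
\<close>

lemma sweedler_coassoc:
  assumes \<alpha>: "tensor_valued_map R C P N \<alpha>" and \<beta>: "tensor_valued_map R P L M \<beta>"
    and \<gamma>: "tensor_valued_map R C L Q \<gamma>" and \<kappa>: "tensor_valued_map R Q M N \<kappa>"
    and coassoc: "tensor_assoc R L M N (tensor_map R (tensor R L M) N \<beta> id (\<alpha> c))
      = tensor_map R L (tensor R M N) id \<kappa> (\<gamma> c)"
    and c: "c \<in> carrier C" and G: "module R G" and F: "trilinear R L M N G F"
  shows "sweedler C P N \<alpha> G (\<lambda>p z. sweedler P L M \<beta> G (\<lambda>x y. F x y z) p) c
    = sweedler C L Q \<gamma> G (\<lambda>x q. sweedler Q M N \<kappa> G (\<lambda>y z. F x y z) q) c"
proof -
  interpret \<alpha>: tensor_valued_map R C P N \<alpha> by fact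
  interpret \<beta>: tensor_valued_map R P L M \<beta> by fact
  interpret \<gamma>: tensor_valued_map R C L Q \<gamma> by fact
  interpret \<kappa>: tensor_valued_map R Q M N \<kappa> by fact
  let ?l = "tensor_lift (add_monoid G)"
  note mods = \<beta>.M_module \<beta>.N_module \<alpha>.N_module
  note LM = tensor_module[OF mods(1,2)] and MN = tensor_module[OF mods(2,3)]
  note left = trilinear_nested_left[OF mods G F] and right = trilinear_nested_right[OF mods G F]
  note t = linear_closed[OF \<alpha>.\<rho>_linear c] and u = linear_closed[OF \<gamma>.\<rho>_linear c]
  note mapl = lift_tensor_map[OF \<alpha>.M_module \<alpha>.N_module LM \<alpha>.N_module G \<beta>.\<rho>_linear linear_id left t]
  note mapr = lift_tensor_map[OF \<gamma>.M_module \<gamma>.N_module \<gamma>.M_module MN G linear_id \<kappa>.\<rho>_linear right u]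
  have cl: "?l (\<lambda>x y. F x y z) (\<beta> p) \<in> carrier G" if "p \<in> carrier P" "z \<in> carrier N" for p z
    using bilinear_closed[OF left linear_closed[OF \<beta>.\<rho>_linear that(1)] that(2)] .
  have cr: "?l (F x) (\<kappa> q) \<in> carrier G" if "x \<in> carrier L" "q \<in> carrier Q" for x q
    using bilinear_closed[OF right that(1) linear_closed[OF \<kappa>.\<rho>_linear that(2)]] .
  have "\<alpha>.sw G (\<lambda>p z. \<beta>.sw G (\<lambda>x y. F x y z) p) c = \<alpha>.sw G (\<lambda>p z. ?l (\<lambda>x y. F x y z) (\<beta> p)) c"
    by (intro sweedler_cong refl \<beta>.sw_eq[OF G] trilinear_closed[OF F])
  also have "\<dots> = ?l (\<lambda>p z. ?l (\<lambda>x y. F x y z) (\<beta> p)) (\<alpha> c)"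
    by (intro \<alpha>.sw_eq[OF G c] cl)
  also have "\<dots> = ?l (\<lambda>t z. ?l (\<lambda>x y. F x y z) t) (tensor_map R (tensor R L M) N \<beta> id (\<alpha> c))"
    using mapl(2) by simp
  also have "\<dots> = ?l (\<lambda>x. ?l (F x)) (tensor_map R L (tensor R M N) id \<kappa> (\<gamma> c))"
    using lift_tensor_assoc[OF mods G F mapl(1)] by (simp add: coassoc)
  also have "\<dots> = ?l (\<lambda>x q. ?l (F x) (\<kappa> q)) (\<gamma> c)"
    using mapr(2) by simp
  also have "\<dots> = \<gamma>.sw G (\<lambda>x q. ?l (F x) (\<kappa> q)) c"
    by (intro \<gamma>.sw_eq[OF G c, symmetric] cr)
  also have "\<dots> = \<gamma>.sw G (\<lambda>x q. \<kappa>.sw G (\<lambda>y z. F x y z) q) c"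
    by (intro sweedler_cong refl \<kappa>.sw_eq[OF G, symmetric] trilinear_closed[OF F])
  finally show ?thesis .
qed

lemma bilinear_scaled:
  assumes "module R G" "f \<in> linear_maps R M (ground_algebra R)" "g \<in> linear_maps R N G"
  shows "bilinear R M N G (\<lambda>x y. f x \<odot>\<^bsub>G\<^esub> g y)"
  using linear_closed[OF assms(2)]
  by (intro bilinearI linear_scalar_factor[OF assms(1,2)] linear_scale[OF assms(1,3)] linear_closed[OF assms(3)]) auto

lemma trilinear_scaled:
  assumes "module R G" "f \<in> linear_maps R L (ground_algebra R)" "bilinear R M N G g"
  shows "trilinear R L M N G (\<lambda>x y z. f x \<odot>\<^bsub>G\<^esub> g y z)"
  using linear_closed[OF assms(2)]
  by (intro trilinearI linear_scalar_factor[OF assms(1,2)] linear_scale[OF assms(1)]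
    bilinear_left[OF assms(3)] bilinear_right[OF assms(3)] bilinear_closed[OF assms(3)]) auto

section \<open>Comodule algebras\<close>

lemma assoc_algebra_module: "assoc_algebra R A \<Longrightarrow> module R A"
  by (simp add: assoc_algebra_def)

lemma mult_bilinear:
  assumes "assoc_algebra R A"
  shows "bilinear R A A A (monoid.mult A)"
proof -
  interpret A: assoc_algebra R A by fact
  show ?thesis
    by (intro bilinearI linear_mapsI)
      (auto simp: A.smult_mult_left A.smult_mult_right A.A.l_distr A.A.r_distr)
qed

locale left_comodule_setting =
  fixes R :: "('k, 'l) ring_scheme" and K :: "('k, 'g) module"
    and \<Delta> :: "'g \<Rightarrow> ('g, 'g) tensors" and \<epsilon> :: "'g \<Rightarrow> 'k" and S :: "'g \<Rightarrow> 'g"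
    and A :: "('k, 'a) module" and \<rho> :: "'a \<Rightarrow> ('g, 'a) tensors"
  assumes hopf_K: "hopf_algebra R K \<Delta> \<epsilon> S"
    and comodule_A: "left_comodule_algebra R K \<Delta> \<epsilon> A \<rho>"
begin

lemma K_assoc_algebra: "assoc_algebra R K"
  using hopf_K by (simp add: hopf_algebra_def)

lemma A_assoc_algebra: "assoc_algebra R A"
  using comodule_A by (simp add: left_comodule_algebra_def)

lemma K_module: "module R K"
  using assoc_algebra_module[OF K_assoc_algebra] .

lemma A_module: "module R A"
  using assoc_algebra_module[OF A_assoc_algebra] .

lemma R_cring: "cring R"
  using K_module by (simp add: module_def)

lemma ground_module: "module R (ground_algebra R)"
  using module_ground[OF R_cring] .

sublocale Kc: tensor_valued_map R K K K \<Delta>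
  using K_module hopf_algebra.comult_hom[OF hopf_K] by (simp add: tensor_valued_map_def algebra_homs_def)

sublocale Ac: tensor_valued_map R A K A \<rho>
  using K_module A_module left_comodule_algebra.left_coaction_hom[OF comodule_A]
  by (simp add: tensor_valued_map_def algebra_homs_def)

abbreviation "cop \<equiv> sweedler K K K \<Delta>"
abbreviation "coact \<equiv> sweedler A K A \<rho>"

lemmas swap_AA = sweedler_swap[OF Ac.tensor_valued_map_axioms Ac.tensor_valued_map_axioms]
lemmas swap_KA = sweedler_swap[OF Kc.tensor_valued_map_axioms Ac.tensor_valued_map_axioms]

lemma K_mult_closed: "k \<in> carrier K \<Longrightarrow> k' \<in> carrier K \<Longrightarrow> k \<otimes>\<^bsub>K\<^esub> k' \<in> carrier K"
  by (rule bilinear_closed[OF mult_bilinear[OF K_assoc_algebra]])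

lemma A_mult_closed: "x \<in> carrier A \<Longrightarrow> x' \<in> carrier A \<Longrightarrow> x \<otimes>\<^bsub>A\<^esub> x' \<in> carrier A"
  by (rule bilinear_closed[OF mult_bilinear[OF A_assoc_algebra]])

lemma coact_coassoc:
  assumes "module R G" "trilinear R K K A G F"
  shows "coact G (\<lambda>k x. coact G (\<lambda>l y. F k l y) x) a = coact G (\<lambda>k x. cop G (\<lambda>k1 k2. F k1 k2 x) k) a"
proof (cases "a \<in> carrier A")
  case True
  show ?thesis
    using sweedler_coassoc[OF Ac.tensor_valued_map_axioms Kc.tensor_valued_map_axioms Ac.tensor_valued_map_axioms Ac.tensor_valued_map_axioms
        left_comodule_algebra.left_coaction_coassoc[OF comodule_A True] True assms] by (rule sym)
qed (simp add: sweedler_def)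

lemma \<epsilon>_linear: "\<epsilon> \<in> linear_maps R K (ground_algebra R)"
  using hopf_algebra.counit_hom[OF hopf_K] by (simp add: algebra_homs_def)

lemma \<epsilon>_mult: "k \<in> carrier K \<Longrightarrow> k' \<in> carrier K \<Longrightarrow> \<epsilon> (k \<otimes>\<^bsub>K\<^esub> k') = \<epsilon> k \<otimes>\<^bsub>R\<^esub> \<epsilon> k'"
  using hopf_algebra.counit_hom[OF hopf_K] by (simp add: algebra_homs_def ring_hom_def)

lemma \<epsilon>_closed: "k \<in> carrier K \<Longrightarrow> \<epsilon> k \<in> carrier R"
  using linear_closed[OF \<epsilon>_linear] by simp

lemma coact_counit:
  assumes G: "module R G" and F: "F \<in> linear_maps R A G" and a: "a \<in> carrier A"
  shows "coact G (\<lambda>k x. \<epsilon> k \<odot>\<^bsub>G\<^esub> F x) a = F a"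
proof -
  interpret A: module R A by (rule A_module)
  have "a = coact A (\<lambda>k x. \<epsilon> k \<odot>\<^bsub>A\<^esub> x) a"
    using left_comodule_algebra.left_coaction_counit[OF comodule_A a]
    by (subst Ac.sw_eq[OF A_module a]) (simp_all add: \<epsilon>_closed)
  then have "F a = F (coact A (\<lambda>k x. \<epsilon> k \<odot>\<^bsub>A\<^esub> x) a)"
    by (rule arg_cong)
  also have "\<dots> = coact G (\<lambda>k x. F (\<epsilon> k \<odot>\<^bsub>A\<^esub> x)) a"
    by (rule Ac.sw_out[OF A_module G F]) (simp add: \<epsilon>_closed)
  also have "\<dots> = coact G (\<lambda>k x. \<epsilon> k \<odot>\<^bsub>G\<^esub> F x) a"
    by (intro sweedler_cong refl linear_smult[OF F] \<epsilon>_closed)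
  finally show ?thesis by (rule sym)
qed

lemma cop_mult:
  assumes "module R G" "bilinear R K K G F" "k \<in> carrier K" "k' \<in> carrier K"
  shows "cop G F (k \<otimes>\<^bsub>K\<^esub> k')
    = cop G (\<lambda>k1 k2. cop G (\<lambda>k1' k2'. F (k1 \<otimes>\<^bsub>K\<^esub> k1') (k2 \<otimes>\<^bsub>K\<^esub> k2')) k') k"
  using hopf_algebra.comult_hom[OF hopf_K] K_mult_closed
  by (intro Kc.sw_mult assms mult_bilinear K_assoc_algebra) (simp add: algebra_homs_def ring_hom_def)

lemma coact_mult:
  assumes "module R G" "bilinear R K A G F" "a \<in> carrier A" "b \<in> carrier A"
  shows "coact G F (a \<otimes>\<^bsub>A\<^esub> b)
    = coact G (\<lambda>k x. coact G (\<lambda>k' x'. F (k \<otimes>\<^bsub>K\<^esub> k') (x \<otimes>\<^bsub>A\<^esub> x')) b) a"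
  using left_comodule_algebra.left_coaction_hom[OF comodule_A] A_mult_closed
  by (intro Ac.sw_mult assms mult_bilinear K_assoc_algebra A_assoc_algebra)
    (simp add: algebra_homs_def ring_hom_def)

text \<open>
  Coassociativity in two variables at once. The sums are interchanged so that the two applications of the
  coaction to the same variable become adjacent.
\<close>

lemma coact_coassoc2:
  assumes G: "module R G"
    and H1: "\<And>k' l' y'. k' \<in> carrier K \<Longrightarrow> l' \<in> carrier K \<Longrightarrow> y' \<in> carrier A
      \<Longrightarrow> trilinear R K K A G (\<lambda>k l y. H k l y k' l' y')"
    and H2: "\<And>k l y. k \<in> carrier K \<Longrightarrow> l \<in> carrier K \<Longrightarrow> y \<in> carrier A
      \<Longrightarrow> trilinear R K K A G (\<lambda>k' l' y'. H k l y k' l' y')"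
  shows "coact G (\<lambda>k x. coact G (\<lambda>k' x'. coact G (\<lambda>l y. coact G (\<lambda>l' y'. H k l y k' l' y') x') x) b) a
    = coact G (\<lambda>k x. coact G (\<lambda>k' x'. cop G (\<lambda>k1 k2. cop G (\<lambda>k1' k2'. H k1 k2 x k1' k2' x') k') k) b) a"
proof -
  note c = trilinear_closed[OF H2]
  have "coact G (\<lambda>k x. coact G (\<lambda>k' x'. coact G (\<lambda>l y. coact G (\<lambda>l' y'. H k l y k' l' y') x') x) b) a
      = coact G (\<lambda>k x. coact G (\<lambda>l y. coact G (\<lambda>k' x'. coact G (\<lambda>l' y'. H k l y k' l' y') x') b) x) a"
    by (rule sweedler_cong[OF refl], rule swap_AA[OF G]) (intro Ac.sw_closed[OF G] c; assumption)
  also have "\<dots> = coact G (\<lambda>k x. coact G (\<lambda>l y. coact G (\<lambda>k' x'. cop G (\<lambda>k1' k2'. H k l y k1' k2' x') k') b) x) a"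
    by (rule sweedler_cong[OF refl], rule sweedler_cong[OF refl], rule coact_coassoc[OF G])
      (rule H2; assumption)
  also have "\<dots> = coact G (\<lambda>k x. cop G (\<lambda>k1 k2. coact G (\<lambda>k' x'. cop G (\<lambda>k1' k2'. H k1 k2 x k1' k2' x') k') b) k) a"
    by (rule coact_coassoc[OF G], rule Ac.sw_param_trilinear[OF G], rule Kc.sw_param_trilinear[OF G])
      (rule H1; assumption)
  also have "\<dots> = coact G (\<lambda>k x. coact G (\<lambda>k' x'. cop G (\<lambda>k1 k2. cop G (\<lambda>k1' k2'. H k1 k2 x k1' k2' x') k') k) b) a"
    by (rule sweedler_cong[OF refl], rule swap_KA[OF G]) (intro Kc.sw_closed[OF G] c; assumption)
  finally show ?thesis .
qed

lemma coact_coassoc3: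
  assumes G: "module R G"
    and H1: "\<And>k' l' y' k'' l'' y''. k' \<in> carrier K \<Longrightarrow> l' \<in> carrier K \<Longrightarrow> y' \<in> carrier A
      \<Longrightarrow> k'' \<in> carrier K \<Longrightarrow> l'' \<in> carrier K \<Longrightarrow> y'' \<in> carrier A
      \<Longrightarrow> trilinear R K K A G (\<lambda>k l y. H k l y k' l' y' k'' l'' y'')"
    and H2: "\<And>k l y k'' l'' y''. k \<in> carrier K \<Longrightarrow> l \<in> carrier K \<Longrightarrow> y \<in> carrier A
      \<Longrightarrow> k'' \<in> carrier K \<Longrightarrow> l'' \<in> carrier K \<Longrightarrow> y'' \<in> carrier A
      \<Longrightarrow> trilinear R K K A G (\<lambda>k' l' y'. H k l y k' l' y' k'' l'' y'')"
    and H3: "\<And>k l y k' l' y'. k \<in> carrier K \<Longrightarrow> l \<in> carrier K \<Longrightarrow> y \<in> carrier A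
      \<Longrightarrow> k' \<in> carrier K \<Longrightarrow> l' \<in> carrier K \<Longrightarrow> y' \<in> carrier A
      \<Longrightarrow> trilinear R K K A G (\<lambda>k'' l'' y''. H k l y k' l' y' k'' l'' y'')"
  shows "coact G (\<lambda>k x. coact G (\<lambda>k' x'. coact G (\<lambda>k'' x''.
      coact G (\<lambda>l y. coact G (\<lambda>l' y'. coact G (\<lambda>l'' y''. H k l y k' l' y' k'' l'' y'') x'') x') x) c) b) a
    = coact G (\<lambda>k x. coact G (\<lambda>k' x'. coact G (\<lambda>k'' x''.
      cop G (\<lambda>k1 k2. cop G (\<lambda>k1' k2'. cop G (\<lambda>k1'' k2''. H k1 k2 x k1' k2' x' k1'' k2'' x'') k'') k') k) c) b) a"
proof -
  note cl = trilinear_closed[OF H3]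
  have "coact G (\<lambda>k x. coact G (\<lambda>k' x'. coact G (\<lambda>k'' x''.
      coact G (\<lambda>l y. coact G (\<lambda>l' y'. coact G (\<lambda>l'' y''. H k l y k' l' y' k'' l'' y'') x'') x') x) c) b) a
    = coact G (\<lambda>k x. coact G (\<lambda>k' x'. coact G (\<lambda>l y. coact G (\<lambda>k'' x''.
      coact G (\<lambda>l' y'. coact G (\<lambda>l'' y''. H k l y k' l' y' k'' l'' y'') x'') x') c) x) b) a"
    by (rule sweedler_cong[OF refl], rule sweedler_cong[OF refl], rule swap_AA[OF G])
      (intro Ac.sw_closed[OF G] cl; assumption)
  also have "\<dots> = coact G (\<lambda>k x. coact G (\<lambda>k' x'. coact G (\<lambda>l y. coact G (\<lambda>l' y'.
      coact G (\<lambda>k'' x''. coact G (\<lambda>l'' y''. H k l y k' l' y' k'' l'' y'') x'') c) x') x) b) a"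
    by (rule sweedler_cong[OF refl], rule sweedler_cong[OF refl], rule sweedler_cong[OF refl], rule swap_AA[OF G])
      (intro Ac.sw_closed[OF G] cl; assumption)
  also have "\<dots> = coact G (\<lambda>k x. coact G (\<lambda>k' x'. coact G (\<lambda>l y. coact G (\<lambda>l' y'.
      coact G (\<lambda>k'' x''. cop G (\<lambda>k1'' k2''. H k l y k' l' y' k1'' k2'' x'') k'') c) x') x) b) a"
    by (rule sweedler_cong[OF refl], rule sweedler_cong[OF refl], rule sweedler_cong[OF refl],
        rule sweedler_cong[OF refl], rule coact_coassoc[OF G]) (rule H3; assumption)
  also have "\<dots> = coact G (\<lambda>k x. coact G (\<lambda>k' x'. cop G (\<lambda>k1 k2. cop G (\<lambda>k1' k2'.
      coact G (\<lambda>k'' x''. cop G (\<lambda>k1'' k2''. H k1 k2 x k1' k2' x' k1'' k2'' x'') k'') c) k') k) b) a"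
    by (rule coact_coassoc2[OF G]; rule Ac.sw_param_trilinear[OF G], rule Kc.sw_param_trilinear[OF G])
      (rule H1 H2; assumption)+
  also have "\<dots> = coact G (\<lambda>k x. coact G (\<lambda>k' x'. cop G (\<lambda>k1 k2. coact G (\<lambda>k'' x''.
      cop G (\<lambda>k1' k2'. cop G (\<lambda>k1'' k2''. H k1 k2 x k1' k2' x' k1'' k2'' x'') k'') k') c) k) b) a"
    by (rule sweedler_cong[OF refl], rule sweedler_cong[OF refl], rule sweedler_cong[OF refl], rule swap_KA[OF G])
      (intro Kc.sw_closed[OF G] cl; assumption)
  also have "\<dots> = coact G (\<lambda>k x. coact G (\<lambda>k' x'. coact G (\<lambda>k'' x''. cop G (\<lambda>k1 k2.
      cop G (\<lambda>k1' k2'. cop G (\<lambda>k1'' k2''. H k1 k2 x k1' k2' x' k1'' k2'' x'') k'') k') k) c) b) a"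
    by (rule sweedler_cong[OF refl], rule sweedler_cong[OF refl], rule swap_KA[OF G])
      (intro Kc.sw_closed[OF G] cl; assumption)
  finally show ?thesis .
qed

section \<open>The action of functionals on multilinear maps\<close>

text \<open>
  The action \<open>f \<triangleright> F\<close> of a functional \<open>f\<close> on \<open>K \<times> K\<close> on a map \<open>F\<close> on \<open>A \<times> A\<close>; \<open>act3\<close> is its analogue in
  three variables. For \<open>F\<close> the multiplication of \<open>A\<close> it is the twisted product.
\<close>

definition act2 :: "('k, 'd) module \<Rightarrow> ('g \<Rightarrow> 'g \<Rightarrow> 'k) \<Rightarrow> ('a \<Rightarrow> 'a \<Rightarrow> 'd) \<Rightarrow> 'a \<Rightarrow> 'a \<Rightarrow> 'd"
  where "act2 G f F a b = coact G (\<lambda>k x. coact G (\<lambda>k' x'. f k k' \<odot>\<^bsub>G\<^esub> F x x') b) a"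

definition act3 :: "('k, 'd) module \<Rightarrow> ('g \<Rightarrow> 'g \<Rightarrow> 'g \<Rightarrow> 'k) \<Rightarrow> ('a \<Rightarrow> 'a \<Rightarrow> 'a \<Rightarrow> 'd)
    \<Rightarrow> 'a \<Rightarrow> 'a \<Rightarrow> 'a \<Rightarrow> 'd"
  where "act3 G f F a b c = coact G (\<lambda>k x. coact G (\<lambda>k' x'. coact G (\<lambda>k'' x''.
    f k k' k'' \<odot>\<^bsub>G\<^esub> F x x' x'') c) b) a"

definition conv2 :: "('g \<Rightarrow> 'g \<Rightarrow> 'k) \<Rightarrow> ('g \<Rightarrow> 'g \<Rightarrow> 'k) \<Rightarrow> 'g \<Rightarrow> 'g \<Rightarrow> 'k"
  where "conv2 f g k k' = cop (ground_algebra R) (\<lambda>k1 k2. cop (ground_algebra R) (\<lambda>k1' k2'.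
    f k1 k1' \<otimes>\<^bsub>R\<^esub> g k2 k2') k') k"

abbreviation "bifunctional \<equiv> bilinear R K K (ground_algebra R)"
abbreviation "trifunctional \<equiv> trilinear R K K K (ground_algebra R)"

lemma bifunctional_closed: "bifunctional f \<Longrightarrow> k \<in> carrier K \<Longrightarrow> k' \<in> carrier K \<Longrightarrow> f k k' \<in> carrier R"
  using bilinear_closed[of R K K "ground_algebra R" f] by simp

lemma trifunctional_closed:
  "trifunctional f \<Longrightarrow> k \<in> carrier K \<Longrightarrow> k' \<in> carrier K \<Longrightarrow> k'' \<in> carrier K \<Longrightarrow> f k k' k'' \<in> carrier R"
  using trilinear_closed[of R K K K "ground_algebra R" f] by simp

lemma smult_closed: "module R G \<Longrightarrow> r \<in> carrier R \<Longrightarrow> x \<in> carrier G \<Longrightarrow> r \<odot>\<^bsub>G\<^esub> x \<in> carrier G"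
  by (rule module.smult_closed)

lemma act2_bilinear:
  assumes G: "module R G" and f: "bifunctional f" and F: "bilinear R A A G F"
  shows "bilinear R A A G (act2 G f F)"
proof (rule bilinearI)
  show "(\<lambda>a. act2 G f F a b) \<in> linear_maps R A G" for b
    unfolding act2_def
    by (rule Ac.sw_linear[OF G], rule Ac.sw_param_bilinear[OF G])
      (rule bilinear_scaled[OF G bilinear_left[OF f] bilinear_left[OF F]]; assumption)
  show "(\<lambda>b. act2 G f F a b) \<in> linear_maps R A G" for a
    unfolding act2_def
    by (rule Ac.sw_param_linear[OF G], rule Ac.sw_linear[OF G])
      (rule bilinear_scaled[OF G bilinear_right[OF f] bilinear_right[OF F]]; assumption)
qed

lemma act3_trilinear:
  assumes G: "module R G" and f: "trifunctional f" and F: "trilinear R A A A G F"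
  shows "trilinear R A A A G (act3 G f F)"
proof (rule trilinearI)
  show "(\<lambda>a. act3 G f F a b c) \<in> linear_maps R A G" for b c
    unfolding act3_def
    by (rule Ac.sw_linear[OF G], rule Ac.sw_param_bilinear[OF G], rule Ac.sw_param_bilinear[OF G])
      (rule bilinear_scaled[OF G trilinear_1[OF f] trilinear_1[OF F]]; assumption)
  show "(\<lambda>b. act3 G f F a b c) \<in> linear_maps R A G" for a c
    unfolding act3_def
    by (rule Ac.sw_param_linear[OF G], rule Ac.sw_linear[OF G], rule Ac.sw_param_bilinear[OF G])
      (rule bilinear_scaled[OF G trilinear_2[OF f] trilinear_2[OF F]]; assumption)
  show "(\<lambda>c. act3 G f F a b c) \<in> linear_maps R A G" for a b
    unfolding act3_def
    by (rule Ac.sw_param_linear[OF G], rule Ac.sw_param_linear[OF G], rule Ac.sw_linear[OF G])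
      (rule bilinear_scaled[OF G trilinear_3[OF f] trilinear_3[OF F]]; assumption)
qed

lemma cop2_scalar_out:
  assumes G: "module R G" and z: "z \<in> carrier G"
    and f: "\<And>k1 k2 k1' k2'. k1 \<in> carrier K \<Longrightarrow> k2 \<in> carrier K \<Longrightarrow> k1' \<in> carrier K \<Longrightarrow> k2' \<in> carrier K
      \<Longrightarrow> f k1 k1' \<in> carrier R \<and> g k2 k2' \<in> carrier R"
  shows "cop G (\<lambda>k1 k2. cop G (\<lambda>k1' k2'. f k1 k1' \<odot>\<^bsub>G\<^esub> (g k2 k2' \<odot>\<^bsub>G\<^esub> z)) k') k
    = cop (ground_algebra R) (\<lambda>k1 k2. cop (ground_algebra R) (\<lambda>k1' k2'. f k1 k1' \<otimes>\<^bsub>R\<^esub> g k2 k2') k') k \<odot>\<^bsub>G\<^esub> z"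
proof -
  interpret G: module R G by fact
  let ?g = "ground_algebra R"
  have "cop ?g (\<lambda>k1 k2. cop ?g (\<lambda>k1' k2'. f k1 k1' \<otimes>\<^bsub>R\<^esub> g k2 k2') k') k \<odot>\<^bsub>G\<^esub> z
      = cop G (\<lambda>k1 k2. cop ?g (\<lambda>k1' k2'. f k1 k1' \<otimes>\<^bsub>R\<^esub> g k2 k2') k' \<odot>\<^bsub>G\<^esub> z) k"
    using Kc.sw_closed[OF ground_module] f by (intro Kc.sw_scalar_out[OF G z]) simp
  also have "\<dots> = cop G (\<lambda>k1 k2. cop G (\<lambda>k1' k2'. (f k1 k1' \<otimes>\<^bsub>R\<^esub> g k2 k2') \<odot>\<^bsub>G\<^esub> z) k') k"
    using f by (intro sweedler_cong refl Kc.sw_scalar_out[OF G z]) simp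
  also have "\<dots> = cop G (\<lambda>k1 k2. cop G (\<lambda>k1' k2'. f k1 k1' \<odot>\<^bsub>G\<^esub> (g k2 k2' \<odot>\<^bsub>G\<^esub> z)) k') k"
    using f z by (intro sweedler_cong refl G.smult_assoc1) auto
  finally show ?thesis by (rule sym)
qed

text \<open>
  Expanding both actions applies the coaction twice to each variable; coassociativity replaces the second
  application by the coproduct of \<open>K\<close>, which turns the two scalars into a convolution.
\<close>

lemma act2_act2:
  assumes G: "module R G" and f: "bifunctional f" and g: "bifunctional g" and F: "bilinear R A A G F"
  shows "act2 G f (act2 G g F) a b = act2 G (conv2 f g) F a b"
proof -
  note fc = bifunctional_closed[OF f] and gc = bifunctional_closed[OF g] and Fc = bilinear_closed[OF F]
  have "act2 G f (act2 G g F) a b = coact G (\<lambda>k x. coact G (\<lambda>k' x'.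
      coact G (\<lambda>l y. f k k' \<odot>\<^bsub>G\<^esub> coact G (\<lambda>l' y'. g l l' \<odot>\<^bsub>G\<^esub> F y y') x') x) b) a"
    unfolding act2_def
    by (rule sweedler_cong[OF refl], rule sweedler_cong[OF refl], rule Ac.sw_scale[OF G])
      (intro fc gc Fc Ac.sw_closed[OF G] smult_closed[OF G]; assumption)+
  also have "\<dots> = coact G (\<lambda>k x. coact G (\<lambda>k' x'. coact G (\<lambda>l y. coact G (\<lambda>l' y'.
      f k k' \<odot>\<^bsub>G\<^esub> (g l l' \<odot>\<^bsub>G\<^esub> F y y')) x') x) b) a"
    by (rule sweedler_cong[OF refl], rule sweedler_cong[OF refl], rule sweedler_cong[OF refl], rule Ac.sw_scale[OF G])
      (intro fc gc Fc Ac.sw_closed[OF G] smult_closed[OF G]; assumption)+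
  also have "\<dots> = coact G (\<lambda>k x. coact G (\<lambda>k' x'. cop G (\<lambda>k1 k2. cop G (\<lambda>k1' k2'.
      f k1 k1' \<odot>\<^bsub>G\<^esub> (g k2 k2' \<odot>\<^bsub>G\<^esub> F x x')) k') k) b) a"
    by (rule coact_coassoc2[OF G])
      (rule trilinear_scaled[OF G bilinear_left[OF f] bilinear_scaled[OF G bilinear_left[OF g] bilinear_left[OF F]]]
        trilinear_scaled[OF G bilinear_right[OF f] bilinear_scaled[OF G bilinear_right[OF g] bilinear_right[OF F]]];
        assumption)+
  also have "\<dots> = act2 G (conv2 f g) F a b"
    unfolding act2_def conv2_def using fc gc Fc
    by (intro sweedler_cong refl cop2_scalar_out[OF G]) auto
  finally show ?thesis .
qed

lemma act2_counit:
  assumes G: "module R G" and F: "bilinear R A A G F"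
    and f: "\<And>k k'. k \<in> carrier K \<Longrightarrow> k' \<in> carrier K \<Longrightarrow> f k k' = \<epsilon> k \<otimes>\<^bsub>R\<^esub> \<epsilon> k'"
    and ab: "a \<in> carrier A" "b \<in> carrier A"
  shows "act2 G f F a b = F a b"
proof -
  interpret G: module R G by fact
  note Fc = bilinear_closed[OF F]
  have "act2 G f F a b = coact G (\<lambda>k x. coact G (\<lambda>k' x'. \<epsilon> k \<odot>\<^bsub>G\<^esub> (\<epsilon> k' \<odot>\<^bsub>G\<^esub> F x x')) b) a"
    unfolding act2_def using \<epsilon>_closed Fc
    by (intro sweedler_cong refl) (simp add: f G.smult_assoc1)
  also have "\<dots> = coact G (\<lambda>k x. \<epsilon> k \<odot>\<^bsub>G\<^esub> coact G (\<lambda>k' x'. \<epsilon> k' \<odot>\<^bsub>G\<^esub> F x x') b) a"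
    by (rule sweedler_cong[OF refl], rule Ac.sw_scale[OF G, symmetric])
      (intro \<epsilon>_closed Fc smult_closed[OF G]; assumption)+
  also have "\<dots> = coact G (\<lambda>k x. \<epsilon> k \<odot>\<^bsub>G\<^esub> F x b) a"
    by (rule sweedler_cong[OF refl], rule arg_cong, rule coact_counit[OF G bilinear_right[OF F] ab(2)])
  also have "\<dots> = F a b"
    by (rule coact_counit[OF G bilinear_left[OF F ab(2)] ab(1)])
  finally show ?thesis .
qed

lemma act2_inverse:
  assumes G: "module R G" and f: "bifunctional f" and g: "bifunctional g" and F: "bilinear R A A G F"
    and inv: "\<And>k k'. k \<in> carrier K \<Longrightarrow> k' \<in> carrier K \<Longrightarrow> conv2 f g k k' = \<epsilon> k \<otimes>\<^bsub>R\<^esub> \<epsilon> k'"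
    and ab: "a \<in> carrier A" "b \<in> carrier A"
  shows "act2 G f (act2 G g F) a b = F a b"
  unfolding act2_act2[OF G f g F] by (rule act2_counit[OF G F inv ab])

text \<open>
  The functional \<open>(k, k', l) \<mapsto> f (k k', l)\<close>; its action computes \<open>f \<triangleright> W\<close> on a product \<open>(a b, c)\<close>, since the
  coaction is multiplicative.
\<close>

definition pull_mult :: "('g \<Rightarrow> 'g \<Rightarrow> 'k) \<Rightarrow> 'g \<Rightarrow> 'g \<Rightarrow> 'g \<Rightarrow> 'k"
  where "pull_mult f k k' l = f (k \<otimes>\<^bsub>K\<^esub> k') l"

lemma pull_mult_trifunctional:
  assumes f: "bifunctional f"
  shows "trifunctional (pull_mult f)"
  unfolding pull_mult_def
proof (rule trilinearI)
  note m = mult_bilinear[OF K_assoc_algebra]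
  show "(\<lambda>x. f (x \<otimes>\<^bsub>K\<^esub> y) z) \<in> linear_maps R K (ground_algebra R)" if "y \<in> carrier K" "z \<in> carrier K" for y z
    by (rule linear_compose[OF bilinear_left[OF m that(1)] bilinear_left[OF f that(2)]])
  show "(\<lambda>y. f (x \<otimes>\<^bsub>K\<^esub> y) z) \<in> linear_maps R K (ground_algebra R)" if "x \<in> carrier K" "z \<in> carrier K" for x z
    by (rule linear_compose[OF bilinear_right[OF m that(1)] bilinear_left[OF f that(2)]])
  show "(\<lambda>z. f (x \<otimes>\<^bsub>K\<^esub> y) z) \<in> linear_maps R K (ground_algebra R)" if "x \<in> carrier K" "y \<in> carrier K" for x y
    by (rule bilinear_right[OF f K_mult_closed[OF that]])
qed

lemma pull_mult_trifunctional_right: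
  assumes f: "bifunctional f"
  shows "trifunctional (\<lambda>k k' l. f k (k' \<otimes>\<^bsub>K\<^esub> l))"
proof (rule trilinearI)
  note m = mult_bilinear[OF K_assoc_algebra]
  show "(\<lambda>x. f x (y \<otimes>\<^bsub>K\<^esub> z)) \<in> linear_maps R K (ground_algebra R)" if "y \<in> carrier K" "z \<in> carrier K" for y z
    by (rule bilinear_left[OF f K_mult_closed[OF that]])
  show "(\<lambda>y. f x (y \<otimes>\<^bsub>K\<^esub> z)) \<in> linear_maps R K (ground_algebra R)" if "x \<in> carrier K" "z \<in> carrier K" for x z
    by (rule linear_compose[OF bilinear_left[OF m that(2)] bilinear_right[OF f that(1)]])
  show "(\<lambda>z. f x (y \<otimes>\<^bsub>K\<^esub> z)) \<in> linear_maps R K (ground_algebra R)" if "x \<in> carrier K" "y \<in> carrier K" for x y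
    by (rule linear_compose[OF bilinear_right[OF m that(2)] bilinear_right[OF f that(1)]])
qed

text \<open>
  Pulling back along the multiplication of \<open>K\<close> commutes with convolution because the coproduct is
  multiplicative, so the pulled back functionals are again inverse to each other.
\<close>

lemma act3_inverse:
  assumes G: "module R G" and f: "bifunctional f" and g: "bifunctional g" and F: "trilinear R A A A G F"
    and inv: "\<And>k k'. k \<in> carrier K \<Longrightarrow> k' \<in> carrier K \<Longrightarrow> conv2 f g k k' = \<epsilon> k \<otimes>\<^bsub>R\<^esub> \<epsilon> k'"
    and abc: "a \<in> carrier A" "b \<in> carrier A" "c \<in> carrier A"
  shows "act3 G (pull_mult f) (act3 G (pull_mult g) F) a b c = F a b c"
proof -
  interpret G: module R G by fact
  note f3 = pull_mult_trifunctional[OF f] and g3 = pull_mult_trifunctional[OF g]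
  note fc = trifunctional_closed[OF f3] and gc = trifunctional_closed[OF g3] and Fc = trilinear_closed[OF F]
  let ?f = "pull_mult f" and ?g = "pull_mult g"
  have "act3 G ?f (act3 G ?g F) a b c = coact G (\<lambda>k x. coact G (\<lambda>k' x'. coact G (\<lambda>k'' x''.
      coact G (\<lambda>l y. ?f k k' k'' \<odot>\<^bsub>G\<^esub> coact G (\<lambda>l' y'. coact G (\<lambda>l'' y''. ?g l l' l'' \<odot>\<^bsub>G\<^esub> F y y' y'') x'') x') x) c) b) a"
    unfolding act3_def
    by (rule sweedler_cong[OF refl], rule sweedler_cong[OF refl], rule sweedler_cong[OF refl], rule Ac.sw_scale[OF G])
      (intro fc gc Fc Ac.sw_closed[OF G] smult_closed[OF G]; assumption)+
  also have "\<dots> = coact G (\<lambda>k x. coact G (\<lambda>k' x'. coact G (\<lambda>k'' x''.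
      coact G (\<lambda>l y. coact G (\<lambda>l' y'. ?f k k' k'' \<odot>\<^bsub>G\<^esub> coact G (\<lambda>l'' y''. ?g l l' l'' \<odot>\<^bsub>G\<^esub> F y y' y'') x'') x') x) c) b) a"
    by (rule sweedler_cong[OF refl], rule sweedler_cong[OF refl], rule sweedler_cong[OF refl],
        rule sweedler_cong[OF refl], rule Ac.sw_scale[OF G])
      (intro fc gc Fc Ac.sw_closed[OF G] smult_closed[OF G]; assumption)+
  also have "\<dots> = coact G (\<lambda>k x. coact G (\<lambda>k' x'. coact G (\<lambda>k'' x''.
      coact G (\<lambda>l y. coact G (\<lambda>l' y'. coact G (\<lambda>l'' y''. ?f k k' k'' \<odot>\<^bsub>G\<^esub> (?g l l' l'' \<odot>\<^bsub>G\<^esub> F y y' y'')) x'') x') x) c) b) a"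
    by (rule sweedler_cong[OF refl], rule sweedler_cong[OF refl], rule sweedler_cong[OF refl],
        rule sweedler_cong[OF refl], rule sweedler_cong[OF refl], rule Ac.sw_scale[OF G])
      (intro fc gc Fc Ac.sw_closed[OF G] smult_closed[OF G]; assumption)+
  also have "\<dots> = coact G (\<lambda>k x. coact G (\<lambda>k' x'. coact G (\<lambda>k'' x''.
      cop G (\<lambda>k1 k2. cop G (\<lambda>k1' k2'. cop G (\<lambda>k1'' k2''.
        ?f k1 k1' k1'' \<odot>\<^bsub>G\<^esub> (?g k2 k2' k2'' \<odot>\<^bsub>G\<^esub> F x x' x'')) k'') k') k) c) b) a"
    by (rule coact_coassoc3[OF G])
      (rule trilinear_scaled[OF G trilinear_1[OF f3] bilinear_scaled[OF G trilinear_1[OF g3] trilinear_1[OF F]]]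
        trilinear_scaled[OF G trilinear_2[OF f3] bilinear_scaled[OF G trilinear_2[OF g3] trilinear_2[OF F]]]
        trilinear_scaled[OF G trilinear_3[OF f3] bilinear_scaled[OF G trilinear_3[OF g3] trilinear_3[OF F]]];
        assumption)+
  also have "\<dots> = coact G (\<lambda>k x. coact G (\<lambda>k' x'. coact G (\<lambda>k'' x''.
      \<epsilon> k \<odot>\<^bsub>G\<^esub> (\<epsilon> k' \<odot>\<^bsub>G\<^esub> (\<epsilon> k'' \<odot>\<^bsub>G\<^esub> F x x' x''))) c) b) a"
  proof (intro sweedler_cong refl)
    fix k x k' x' k'' x''
    assume k: "k \<in> carrier K" "k' \<in> carrier K" "k'' \<in> carrier K"
      and x: "x \<in> carrier A" "x' \<in> carrier A" "x'' \<in> carrier A"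
    \<comment> \<open>The coproducts of \<open>k\<close> and \<open>k'\<close> combine to that of \<open>k k'\<close>.\<close>
    let ?H = "\<lambda>p q. cop G (\<lambda>k1'' k2''. f p k1'' \<odot>\<^bsub>G\<^esub> (g q k2'' \<odot>\<^bsub>G\<^esub> F x x' x'')) k''"
    have H: "bilinear R K K G ?H"
    proof (rule Kc.sw_param_bilinear[OF G], rule bilinear_scaled[OF G])
      fix u v assume uv: "u \<in> carrier K" "v \<in> carrier K"
      show "(\<lambda>p. f p u) \<in> linear_maps R K (ground_algebra R)"
        by (rule bilinear_left[OF f uv(1)])
      show "(\<lambda>q. g q v \<odot>\<^bsub>G\<^esub> F x x' x'') \<in> linear_maps R K G"
        by (rule linear_scalar_factor[OF G bilinear_left[OF g uv(2)] Fc[OF x]])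
    qed
    have "cop G (\<lambda>k1 k2. cop G (\<lambda>k1' k2'. cop G (\<lambda>k1'' k2''.
        ?f k1 k1' k1'' \<odot>\<^bsub>G\<^esub> (?g k2 k2' k2'' \<odot>\<^bsub>G\<^esub> F x x' x'')) k'') k') k = cop G ?H (k \<otimes>\<^bsub>K\<^esub> k')"
      unfolding pull_mult_def by (rule cop_mult[OF G H k(1,2), symmetric])
    also have "\<dots> = conv2 f g (k \<otimes>\<^bsub>K\<^esub> k') k'' \<odot>\<^bsub>G\<^esub> F x x' x''"
      unfolding conv2_def using bifunctional_closed[OF f] bifunctional_closed[OF g]
      by (intro cop2_scalar_out[OF G Fc[OF x]]) auto
    also have "\<dots> = \<epsilon> k \<odot>\<^bsub>G\<^esub> (\<epsilon> k' \<odot>\<^bsub>G\<^esub> (\<epsilon> k'' \<odot>\<^bsub>G\<^esub> F x x' x''))"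
      using k x Fc by (simp add: inv K_mult_closed \<epsilon>_mult \<epsilon>_closed G.smult_assoc1)
    finally show "cop G (\<lambda>k1 k2. cop G (\<lambda>k1' k2'. cop G (\<lambda>k1'' k2''.
        ?f k1 k1' k1'' \<odot>\<^bsub>G\<^esub> (?g k2 k2' k2'' \<odot>\<^bsub>G\<^esub> F x x' x'')) k'') k') k
      = \<epsilon> k \<odot>\<^bsub>G\<^esub> (\<epsilon> k' \<odot>\<^bsub>G\<^esub> (\<epsilon> k'' \<odot>\<^bsub>G\<^esub> F x x' x''))" .
  qed
  also have "\<dots> = coact G (\<lambda>k x. coact G (\<lambda>k' x'. \<epsilon> k \<odot>\<^bsub>G\<^esub> (\<epsilon> k' \<odot>\<^bsub>G\<^esub> F x x' c)) b) a"
  proof (intro sweedler_cong refl)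
    fix k x k' x' assume k: "k \<in> carrier K" "k' \<in> carrier K" and x: "x \<in> carrier A" "x' \<in> carrier A"
    have lin: "(\<lambda>z. \<epsilon> k \<odot>\<^bsub>G\<^esub> (\<epsilon> k' \<odot>\<^bsub>G\<^esub> z)) \<in> linear_maps R G G"
      by (intro linear_scale[OF G] linear_ident \<epsilon>_closed k)
    have "coact G (\<lambda>k'' x''. \<epsilon> k \<odot>\<^bsub>G\<^esub> (\<epsilon> k' \<odot>\<^bsub>G\<^esub> (\<epsilon> k'' \<odot>\<^bsub>G\<^esub> F x x' x''))) c
        = \<epsilon> k \<odot>\<^bsub>G\<^esub> (\<epsilon> k' \<odot>\<^bsub>G\<^esub> coact G (\<lambda>k'' x''. \<epsilon> k'' \<odot>\<^bsub>G\<^esub> F x x' x'') c)"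
      by (rule Ac.sw_out[OF G G lin, symmetric]) (intro smult_closed[OF G] \<epsilon>_closed Fc x; assumption)
    then show "coact G (\<lambda>k'' x''. \<epsilon> k \<odot>\<^bsub>G\<^esub> (\<epsilon> k' \<odot>\<^bsub>G\<^esub> (\<epsilon> k'' \<odot>\<^bsub>G\<^esub> F x x' x''))) c
        = \<epsilon> k \<odot>\<^bsub>G\<^esub> (\<epsilon> k' \<odot>\<^bsub>G\<^esub> F x x' c)"
      by (simp only: coact_counit[OF G trilinear_3[OF F x] abc(3)])
  qed
  also have "\<dots> = act2 G (\<lambda>k k'. \<epsilon> k \<otimes>\<^bsub>R\<^esub> \<epsilon> k') (\<lambda>x x'. F x x' c) a b"
    unfolding act2_def using Fc abc(3)
    by (intro sweedler_cong refl) (simp add: G.smult_assoc1 \<epsilon>_closed)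
  also have "\<dots> = F a b c"
    by (rule act2_counit[OF G trilinear_12[OF F abc(3)] refl abc(1,2)])
  finally show ?thesis .
qed

text \<open>
  With \<open>g (k, k', l) = f (k k', l)\<close> the resulting functional is one side of the cocycle identity;
  \<open>act2_act3_right\<close> produces the other.
\<close>

lemma act2_act3_left:
  assumes G: "module R G" and f: "bifunctional f" and g: "trifunctional g" and F: "trilinear R A A A G F"
  shows "act2 G f (\<lambda>a b. act3 G g F a b c) a b = act3 G (\<lambda>k k' l. conv2 f (\<lambda>k k'. g k k' l) k k') F a b c"
proof -
  note fc = bifunctional_closed[OF f] and gc = trifunctional_closed[OF g] and Fc = trilinear_closed[OF F]
  have "act2 G f (\<lambda>a b. act3 G g F a b c) a b = coact G (\<lambda>k x. coact G (\<lambda>k' x'.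
      coact G (\<lambda>l y. f k k' \<odot>\<^bsub>G\<^esub> coact G (\<lambda>l' y'. coact G (\<lambda>m z. g l l' m \<odot>\<^bsub>G\<^esub> F y y' z) c) x') x) b) a"
    unfolding act2_def act3_def
    by (rule sweedler_cong[OF refl], rule sweedler_cong[OF refl], rule Ac.sw_scale[OF G])
      (intro fc gc Fc Ac.sw_closed[OF G] smult_closed[OF G]; assumption)+
  also have "\<dots> = coact G (\<lambda>k x. coact G (\<lambda>k' x'. coact G (\<lambda>l y. coact G (\<lambda>l' y'.
      f k k' \<odot>\<^bsub>G\<^esub> coact G (\<lambda>m z. g l l' m \<odot>\<^bsub>G\<^esub> F y y' z) c) x') x) b) a"
    by (rule sweedler_cong[OF refl], rule sweedler_cong[OF refl], rule sweedler_cong[OF refl], rule Ac.sw_scale[OF G])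
      (intro fc gc Fc Ac.sw_closed[OF G] smult_closed[OF G]; assumption)+
  also have "\<dots> = coact G (\<lambda>k x. coact G (\<lambda>k' x'. coact G (\<lambda>l y. coact G (\<lambda>l' y'.
      coact G (\<lambda>m z. f k k' \<odot>\<^bsub>G\<^esub> (g l l' m \<odot>\<^bsub>G\<^esub> F y y' z)) c) x') x) b) a"
    by (rule sweedler_cong[OF refl], rule sweedler_cong[OF refl], rule sweedler_cong[OF refl],
        rule sweedler_cong[OF refl], rule Ac.sw_scale[OF G])
      (intro fc gc Fc Ac.sw_closed[OF G] smult_closed[OF G]; assumption)+
  also have "\<dots> = coact G (\<lambda>k x. coact G (\<lambda>k' x'. cop G (\<lambda>k1 k2. cop G (\<lambda>k1' k2'.
      coact G (\<lambda>m z. f k1 k1' \<odot>\<^bsub>G\<^esub> (g k2 k2' m \<odot>\<^bsub>G\<^esub> F x x' z)) c) k') k) b) a"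
    by (rule coact_coassoc2[OF G]; rule Ac.sw_param_trilinear[OF G])
      (rule trilinear_scaled[OF G bilinear_left[OF f] bilinear_scaled[OF G trilinear_1[OF g] trilinear_1[OF F]]]
        trilinear_scaled[OF G bilinear_right[OF f] bilinear_scaled[OF G trilinear_2[OF g] trilinear_2[OF F]]];
        assumption)+
  also have "\<dots> = coact G (\<lambda>k x. coact G (\<lambda>k' x'. cop G (\<lambda>k1 k2. coact G (\<lambda>m z. cop G (\<lambda>k1' k2'.
      f k1 k1' \<odot>\<^bsub>G\<^esub> (g k2 k2' m \<odot>\<^bsub>G\<^esub> F x x' z)) k') c) k) b) a"
    by (rule sweedler_cong[OF refl], rule sweedler_cong[OF refl], rule sweedler_cong[OF refl], rule swap_KA[OF G])
      (intro fc gc Fc smult_closed[OF G]; assumption)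
  also have "\<dots> = coact G (\<lambda>k x. coact G (\<lambda>k' x'. coact G (\<lambda>m z. cop G (\<lambda>k1 k2. cop G (\<lambda>k1' k2'.
      f k1 k1' \<odot>\<^bsub>G\<^esub> (g k2 k2' m \<odot>\<^bsub>G\<^esub> F x x' z)) k') k) c) b) a"
    by (rule sweedler_cong[OF refl], rule sweedler_cong[OF refl], rule swap_KA[OF G])
      (intro fc gc Fc Kc.sw_closed[OF G] smult_closed[OF G]; assumption)
  also have "\<dots> = act3 G (\<lambda>k k' l. conv2 f (\<lambda>k k'. g k k' l) k k') F a b c"
    unfolding act3_def conv2_def using fc gc Fc
    by (intro sweedler_cong refl cop2_scalar_out[OF G]) auto
  finally show ?thesis .
qed

lemma act2_act3_right:
  assumes G: "module R G" and f: "bifunctional f" and g: "trifunctional g" and F: "trilinear R A A A G F"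
  shows "act2 G f (\<lambda>b c. act3 G g F a b c) b c = act3 G (\<lambda>k k' l. conv2 f (g k) k' l) F a b c"
proof -
  note fc = bifunctional_closed[OF f] and gc = trifunctional_closed[OF g] and Fc = trilinear_closed[OF F]
  have inner: "act2 G f (act2 G (g m) (F z)) b c = act2 G (conv2 f (g m)) (F z) b c"
    if "m \<in> carrier K" "z \<in> carrier A" for m z
    by (rule act2_act2[OF G f trilinear_23[OF g that(1)] trilinear_23[OF F that(2)]])
  have "act2 G f (\<lambda>b c. act3 G g F a b c) b c = coact G (\<lambda>k x. coact G (\<lambda>k' x'.
      coact G (\<lambda>m z. f k k' \<odot>\<^bsub>G\<^esub> act2 G (g m) (F z) x x') a) c) b"
    unfolding act2_def act3_def
    by (rule sweedler_cong[OF refl], rule sweedler_cong[OF refl], rule Ac.sw_scale[OF G])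
      (intro fc gc Fc Ac.sw_closed[OF G] smult_closed[OF G]; assumption)+
  also have "\<dots> = coact G (\<lambda>k x. coact G (\<lambda>m z. coact G (\<lambda>k' x'.
      f k k' \<odot>\<^bsub>G\<^esub> act2 G (g m) (F z) x x') c) a) b"
    unfolding act2_def
    by (rule sweedler_cong[OF refl], rule swap_AA[OF G])
      (intro fc gc Fc Ac.sw_closed[OF G] smult_closed[OF G]; assumption)
  also have "\<dots> = coact G (\<lambda>m z. act2 G f (act2 G (g m) (F z)) b c) a"
    unfolding act2_def
    by (rule swap_AA[OF G])
      (intro fc gc Fc Ac.sw_closed[OF G] smult_closed[OF G]; assumption)
  also have "\<dots> = coact G (\<lambda>m z. act2 G (conv2 f (g m)) (F z) b c) a"
    by (rule sweedler_cong[OF refl inner])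
  finally show ?thesis
    by (simp only: act2_def act3_def)
qed

section \<open>Cocycles and balanced maps\<close>

lemma act2_out:
  assumes G: "module R G" "module R G'" and h: "h \<in> linear_maps R G G'" and f: "bifunctional f"
    and F: "\<And>x y. x \<in> carrier A \<Longrightarrow> y \<in> carrier A \<Longrightarrow> F x y \<in> carrier G"
  shows "h (act2 G f F a b) = act2 G' f (\<lambda>x y. h (F x y)) a b"
proof -
  note fc = bifunctional_closed[OF f]
  have "h (act2 G f F a b) = coact G' (\<lambda>k x. h (coact G (\<lambda>k' x'. f k k' \<odot>\<^bsub>G\<^esub> F x x') b)) a"
    unfolding act2_def
    by (rule Ac.sw_out[OF G h]) (intro fc F Ac.sw_closed[OF G(1)] smult_closed[OF G(1)]; assumption)
  also have "\<dots> = coact G' (\<lambda>k x. coact G' (\<lambda>k' x'. h (f k k' \<odot>\<^bsub>G\<^esub> F x x')) b) a"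
    by (rule sweedler_cong[OF refl], rule Ac.sw_out[OF G h])
      (intro fc F smult_closed[OF G(1)]; assumption)
  also have "\<dots> = act2 G' f (\<lambda>x y. h (F x y)) a b"
    unfolding act2_def by (intro sweedler_cong refl linear_smult[OF h] fc F)
  finally show ?thesis .
qed

text \<open>
  In \<open>f (a\<^sub>-\<^sub>1, b\<^sub>-\<^sub>1) F (a\<^sub>0, b\<^sub>0) = F (a\<^sub>0, f (a\<^sub>-\<^sub>1, b\<^sub>-\<^sub>1) b\<^sub>0)\<close> the second argument on the right lies in
  \<open>B\<close>, because \<open>f (k, _)\<close> is a linear functional for every \<open>k\<close>. So only the values of \<open>F\<close> on \<open>A \<times> B\<close> matter.
\<close>

lemma act2_cong_middle:
  assumes G: "module R G" and f: "bifunctional f"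
    and stable: "\<And>b f. b \<in> B \<Longrightarrow> f \<in> linear_maps R K (ground_algebra R) \<Longrightarrow> coact A (\<lambda>k x. f k \<odot>\<^bsub>A\<^esub> x) b \<in> B"
    and F: "\<And>a. a \<in> carrier A \<Longrightarrow> F a \<in> linear_maps R A G" 
    and F': "\<And>a. a \<in> carrier A \<Longrightarrow> F' a \<in> linear_maps R A G"
    and eq: "\<And>a b. a \<in> carrier A \<Longrightarrow> b \<in> B \<Longrightarrow> F a b = F' a b"
    and b: "b \<in> B"
  shows "act2 G f F a b = act2 G f F' a b"
proof -
  interpret A: module R A by (rule A_module)
  note fc = bifunctional_closed[OF f]
  have out: "coact G (\<lambda>k' x'. f k k' \<odot>\<^bsub>G\<^esub> F x x') b = F x (coact A (\<lambda>k' x'. f k k' \<odot>\<^bsub>A\<^esub> x') b)"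
    if k: "k \<in> carrier K" and x: "x \<in> carrier A" and F: "\<And>a. a \<in> carrier A \<Longrightarrow> F a \<in> linear_maps R A G" for k x F
  proof -
    have "F x (coact A (\<lambda>k' x'. f k k' \<odot>\<^bsub>A\<^esub> x') b) = coact G (\<lambda>k' x'. F x (f k k' \<odot>\<^bsub>A\<^esub> x')) b"
      by (rule Ac.sw_out[OF A_module G F[OF x]]) (simp add: fc k)
    also have "\<dots> = coact G (\<lambda>k' x'. f k k' \<odot>\<^bsub>G\<^esub> F x x') b"
      by (intro sweedler_cong refl linear_smult[OF F[OF x]] fc k)
    finally show ?thesis by (rule sym)
  qed
  show ?thesis
    unfolding act2_def
  proof (rule sweedler_cong[OF refl])
    fix k x assume k: "k \<in> carrier K" and x: "x \<in> carrier A"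
    have "coact A (\<lambda>k' x'. f k k' \<odot>\<^bsub>A\<^esub> x') b \<in> B"
      using b bilinear_right[OF f k] by (rule stable)
    note eq' = eq[OF x this]
    show "coact G (\<lambda>k' x'. f k k' \<odot>\<^bsub>G\<^esub> F x x') b = coact G (\<lambda>k' x'. f k k' \<odot>\<^bsub>G\<^esub> F' x x') b"
      by (rule trans[OF out[of k x F, OF k x F] trans[OF eq' out[of k x F', OF k x F', symmetric]]])
  qed
qed

text \<open>
  Moving the sum over the third variable outside reduces this to two variables, with the functional leg and the
  element of \<open>A\<close> coming from the third variable held fixed.
\<close>

lemma act3_cong_middle:
  assumes G: "module R G" and f: "trifunctional f"
    and stable: "\<And>b f. b \<in> B \<Longrightarrow> f \<in> linear_maps R K (ground_algebra R) \<Longrightarrow> coact A (\<lambda>k x. f k \<odot>\<^bsub>A\<^esub> x) b \<in> B"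
    and F: "trilinear R A A A G F" and F': "trilinear R A A A G F'"
    and eq: "\<And>a b c. a \<in> carrier A \<Longrightarrow> b \<in> B \<Longrightarrow> c \<in> carrier A \<Longrightarrow> F a b c = F' a b c"
    and b: "b \<in> B"
  shows "act3 G f F a b c = act3 G f F' a b c"
proof -
  have swap: "act3 G f F a b c = coact G (\<lambda>l z. act2 G (\<lambda>k k'. f k k' l) (\<lambda>x x'. F x x' z) a b) c"
    if F: "trilinear R A A A G F" for F
  proof -
    note fc = trifunctional_closed[OF f] and Fc = trilinear_closed[OF F]
    have "act3 G f F a b c = coact G (\<lambda>k x. coact G (\<lambda>l z. coact G (\<lambda>k' x'. f k k' l \<odot>\<^bsub>G\<^esub> F x x' z) b) c) a"
      unfolding act3_def by (rule sweedler_cong[OF refl], rule swap_AA[OF G])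
        (intro fc Fc smult_closed[OF G]; assumption)
    also have "\<dots> = coact G (\<lambda>l z. act2 G (\<lambda>k k'. f k k' l) (\<lambda>x x'. F x x' z) a b) c"
      unfolding act2_def by (rule swap_AA[OF G])
        (intro fc Fc Ac.sw_closed[OF G] smult_closed[OF G]; assumption)
    finally show ?thesis .
  qed
  have "act2 G (\<lambda>k k'. f k k' l) (\<lambda>x x'. F x x' z) a b = act2 G (\<lambda>k k'. f k k' l) (\<lambda>x x'. F' x x' z) a b"
    if "l \<in> carrier K" "z \<in> carrier A" for l z
    by (rule act2_cong_middle[OF G trilinear_12[OF f that(1)] stable trilinear_2[OF F _ that(2)]
          trilinear_2[OF F' _ that(2)] eq[OF _ _ that(2)] b])
  then show ?thesis
    unfolding swap[OF F] swap[OF F'] by (rule sweedler_cong[OF refl])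
qed

abbreviation tprod :: "('g \<Rightarrow> 'g \<Rightarrow> 'k) \<Rightarrow> 'a \<Rightarrow> 'a \<Rightarrow> 'a"
  where "tprod s \<equiv> act2 A s (monoid.mult A)"

lemma A_mult_bilinear: "bilinear R A A A (monoid.mult A)"
  by (rule mult_bilinear[OF A_assoc_algebra])

lemma left_mult_trilinear:
  assumes "bilinear R A A G W" shows "trilinear R A A A G (\<lambda>a b c. W (a \<otimes>\<^bsub>A\<^esub> b) c)"
proof (rule trilinearI)
  show "(\<lambda>x. W (x \<otimes>\<^bsub>A\<^esub> y) z) \<in> linear_maps R A G" if "y \<in> carrier A" "z \<in> carrier A" for y z
    by (rule linear_compose[OF bilinear_left[OF A_mult_bilinear that(1)] bilinear_left[OF assms that(2)]])
  show "(\<lambda>y. W (x \<otimes>\<^bsub>A\<^esub> y) z) \<in> linear_maps R A G" if "x \<in> carrier A" "z \<in> carrier A" for x z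
    by (rule linear_compose[OF bilinear_right[OF A_mult_bilinear that(1)] bilinear_left[OF assms that(2)]])
  show "(\<lambda>z. W (x \<otimes>\<^bsub>A\<^esub> y) z) \<in> linear_maps R A G" if "x \<in> carrier A" "y \<in> carrier A" for x y
    by (rule bilinear_right[OF assms A_mult_closed[OF that]])
qed

lemma right_mult_trilinear:
  assumes "bilinear R A A G W" shows "trilinear R A A A G (\<lambda>a b c. W a (b \<otimes>\<^bsub>A\<^esub> c))"
proof (rule trilinearI)
  show "(\<lambda>x. W x (y \<otimes>\<^bsub>A\<^esub> z)) \<in> linear_maps R A G" if "y \<in> carrier A" "z \<in> carrier A" for y z
    by (rule bilinear_left[OF assms A_mult_closed[OF that]])
  show "(\<lambda>y. W x (y \<otimes>\<^bsub>A\<^esub> z)) \<in> linear_maps R A G" if "x \<in> carrier A" "z \<in> carrier A" for x z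
    by (rule linear_compose[OF bilinear_left[OF A_mult_bilinear that(2)] bilinear_right[OF assms that(1)]])
  show "(\<lambda>z. W x (y \<otimes>\<^bsub>A\<^esub> z)) \<in> linear_maps R A G" if "x \<in> carrier A" "y \<in> carrier A" for x y
    by (rule linear_compose[OF bilinear_right[OF A_mult_bilinear that(2)] bilinear_right[OF assms that(1)]])
qed

text \<open>
  The twisted product is a sum of products in \<open>A\<close>, and \<open>s \<triangleright> W\<close> is linear in its first argument, so the
  outer action appears; multiplicativity of the coaction then rewrites \<open>(s \<triangleright> W) (x y, c)\<close>.
\<close>

lemma act2_tprod_left:
  assumes G: "module R G" and s: "bifunctional s" and W: "bilinear R A A G W" and c: "c \<in> carrier A"
  shows "act2 G s W (tprod s a b) c
    = act2 G s (\<lambda>a b. act3 G (pull_mult s) (\<lambda>a b c. W (a \<otimes>\<^bsub>A\<^esub> b) c) a b c) a b"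
proof -
  have "act2 G s W (tprod s a b) c = act2 G s (\<lambda>x y. act2 G s W (x \<otimes>\<^bsub>A\<^esub> y) c) a b"
    by (rule act2_out[OF A_module G bilinear_left[OF act2_bilinear[OF G s W] c] s A_mult_closed])
  also have "\<dots> = act2 G s (\<lambda>a b. act3 G (pull_mult s) (\<lambda>a b c. W (a \<otimes>\<^bsub>A\<^esub> b) c) a b c) a b"
  proof -
    have inner: "act2 G s W (x \<otimes>\<^bsub>A\<^esub> y) c = act3 G (pull_mult s) (\<lambda>a b c. W (a \<otimes>\<^bsub>A\<^esub> b) c) x y c"
      if xy: "x \<in> carrier A" "y \<in> carrier A" for x y
    proof -
      have "bilinear R K A G (\<lambda>k x. coact G (\<lambda>k' x'. s k k' \<odot>\<^bsub>G\<^esub> W x x') c)"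
        by (rule Ac.sw_param_bilinear[OF G])
          (rule bilinear_scaled[OF G bilinear_left[OF s] bilinear_left[OF W]]; assumption)
      from coact_mult[OF G this xy] show ?thesis
        unfolding act2_def act3_def pull_mult_def .
    qed
    show ?thesis
      unfolding act2_def[of G s "\<lambda>x y. act2 G s W (x \<otimes>\<^bsub>A\<^esub> y) c"]
        act2_def[of G s "\<lambda>a b. act3 G (pull_mult s) (\<lambda>a b c. W (a \<otimes>\<^bsub>A\<^esub> b) c) a b c"]
      by (intro sweedler_cong refl) (simp only: inner)
  qed
  finally show ?thesis .
qed

lemma act2_tprod_right:
  assumes G: "module R G" and s: "bifunctional s" and W: "bilinear R A A G W" and a: "a \<in> carrier A"
  shows "act2 G s W a (tprod s b c)
    = act2 G s (\<lambda>b c. act3 G (\<lambda>k k' l. s k (k' \<otimes>\<^bsub>K\<^esub> l)) (\<lambda>a b c. W a (b \<otimes>\<^bsub>A\<^esub> c)) a b c) b c"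
proof -
  have "act2 G s W a (tprod s b c) = act2 G s (\<lambda>x y. act2 G s W a (x \<otimes>\<^bsub>A\<^esub> y)) b c"
    by (rule act2_out[OF A_module G bilinear_right[OF act2_bilinear[OF G s W] a] s A_mult_closed])
  also have "\<dots> = act2 G s (\<lambda>b c. act3 G (\<lambda>k k' l. s k (k' \<otimes>\<^bsub>K\<^esub> l)) (\<lambda>a b c. W a (b \<otimes>\<^bsub>A\<^esub> c)) a b c) b c"
  proof -
    have inner: "act2 G s W a (x \<otimes>\<^bsub>A\<^esub> y) = act3 G (\<lambda>k k' l. s k (k' \<otimes>\<^bsub>K\<^esub> l)) (\<lambda>a b c. W a (b \<otimes>\<^bsub>A\<^esub> c)) a x y"
      if xy: "x \<in> carrier A" "y \<in> carrier A" for x y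
      unfolding act2_def act3_def
      by (rule sweedler_cong[OF refl], rule coact_mult[OF G _ xy])
        (rule bilinear_scaled[OF G bilinear_right[OF s] bilinear_right[OF W]]; assumption)
    show ?thesis
      unfolding act2_def[of G s "\<lambda>x y. act2 G s W a (x \<otimes>\<^bsub>A\<^esub> y)"]
        act2_def[of G s "\<lambda>b c. act3 G (\<lambda>k k' l. s k (k' \<otimes>\<^bsub>K\<^esub> l)) (\<lambda>a b c. W a (b \<otimes>\<^bsub>A\<^esub> c)) a b c"]
      by (intro sweedler_cong refl) (simp only: inner)
  qed
  finally show ?thesis .
qed

lemma act3_cong_functional:
  assumes "\<And>k k' l. k \<in> carrier K \<Longrightarrow> k' \<in> carrier K \<Longrightarrow> l \<in> carrier K \<Longrightarrow> f k k' l = g k k' l"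
  shows "act3 G f F a b c = act3 G g F a b c"
  unfolding act3_def by (intro sweedler_cong refl) (simp only: assms)

text \<open>
  The identity \<open>s (g\<^sub>1, h\<^sub>1) s (g\<^sub>2 h\<^sub>2, k) = s (h\<^sub>1, k\<^sub>1) s (g, h\<^sub>2 k\<^sub>2)\<close>, each side read as a convolution with one
  variable held fixed.
\<close>

definition cocycle :: "('g \<Rightarrow> 'g \<Rightarrow> 'k) \<Rightarrow> bool"
  where "cocycle s \<longleftrightarrow> (\<forall>g\<in>carrier K. \<forall>h\<in>carrier K. \<forall>k\<in>carrier K.
    conv2 s (\<lambda>g h. s (g \<otimes>\<^bsub>K\<^esub> h) k) g h = conv2 s (\<lambda>h k. s g (h \<otimes>\<^bsub>K\<^esub> k)) h k)"

lemma cocycle_act: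
  assumes G: "module R G" and s: "bifunctional s" and cocycle: "cocycle s" and F: "trilinear R A A A G F"
  shows "act2 G s (\<lambda>a b. act3 G (pull_mult s) F a b c) a b
    = act2 G s (\<lambda>b c. act3 G (\<lambda>k k' l. s k (k' \<otimes>\<^bsub>K\<^esub> l)) F a b c) b c"
  unfolding act2_act3_left[OF G s pull_mult_trifunctional[OF s] F]
    act2_act3_right[OF G s pull_mult_trifunctional_right[OF s] F]
  using cocycle by (intro act3_cong_functional) (simp add: cocycle_def pull_mult_def)

context
  fixes B s
  assumes s: "bifunctional s" and cocycle: "cocycle s" and B: "B \<subseteq> carrier A"
    and stable: "\<And>b f. b \<in> B \<Longrightarrow> f \<in> linear_maps R K (ground_algebra R) \<Longrightarrow> coact A (\<lambda>k x. f k \<odot>\<^bsub>A\<^esub> x) b \<in> B"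
begin

text \<open>
  Write \<open>u = W (a b, c)\<close> and \<open>v = W (a, b c)\<close>. Both sides of the claim come from \<open>u\<close> and \<open>v\<close> by the same
  operation, by the cocycle identity, and \<open>u = v\<close> for \<open>b \<in> B\<close>.
\<close>

lemma twist_balanced:
  assumes G: "module R G" and W: "bilinear R A A G W"
    and bal: "\<And>a b c. a \<in> carrier A \<Longrightarrow> b \<in> B \<Longrightarrow> c \<in> carrier A \<Longrightarrow> W (a \<otimes>\<^bsub>A\<^esub> b) c = W a (b \<otimes>\<^bsub>A\<^esub> c)"
    and abc: "a \<in> carrier A" "b \<in> B" "c \<in> carrier A"
  shows "act2 G s W (tprod s a b) c = act2 G s W a (tprod s b c)"
proof -
  let ?u = "\<lambda>a b c. W (a \<otimes>\<^bsub>A\<^esub> b) c" and ?v = "\<lambda>a b c. W a (b \<otimes>\<^bsub>A\<^esub> c)"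
  note u = left_mult_trilinear[OF W] and v = right_mult_trilinear[OF W] and p = pull_mult_trifunctional[OF s]
  note u3 = act3_trilinear[OF G p u] and v3 = act3_trilinear[OF G p v]
  \<comment> \<open>Two layers of the action have to be crossed: the inner one in three variables, then the outer one
    in the variables \<open>a, b\<close>.\<close>
  have eq: "act3 G (pull_mult s) ?u a b c = act3 G (pull_mult s) ?v a b c" if "b \<in> B" for a b
    by (rule act3_cong_middle[OF G p stable u v bal that])
  have "act2 G s W (tprod s a b) c = act2 G s (\<lambda>a b. act3 G (pull_mult s) ?u a b c) a b"
    by (rule act2_tprod_left[OF G s W abc(3)])
  also have "\<dots> = act2 G s (\<lambda>a b. act3 G (pull_mult s) ?v a b c) a b"
    by (rule act2_cong_middle[OF G s stable trilinear_2[OF u3 _ abc(3)] trilinear_2[OF v3 _ abc(3)] eq abc(2)])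
  also have "\<dots> = act2 G s (\<lambda>b c. act3 G (\<lambda>k k' l. s k (k' \<otimes>\<^bsub>K\<^esub> l)) ?v a b c) b c"
    by (rule cocycle_act[OF G s cocycle v])
  also have "\<dots> = act2 G s W a (tprod s b c)"
    by (rule act2_tprod_right[OF G s W abc(1), symmetric])
  finally show ?thesis .
qed

text \<open>
  With \<open>u\<close> and \<open>v\<close> formed from \<open>t \<triangleright> W\<close>, the maps \<open>W (a \<bullet> b, c)\<close> and \<open>W (a, b \<bullet> c)\<close> arise from \<open>u\<close> and \<open>v\<close> by the
  operation of the cocycle identity. They agree for \<open>b \<in> B\<close>, and the operation is undone in two steps,
  first by \<open>t\<close> in the variables \<open>a, b\<close> and then by its pullback in all three; each step keeps the agreement.
\<close>

lemma untwist_balanced: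
  assumes G: "module R G" and W: "bilinear R A A G W" and t: "bifunctional t"
    and st: "\<And>k k'. k \<in> carrier K \<Longrightarrow> k' \<in> carrier K \<Longrightarrow> conv2 s t k k' = \<epsilon> k \<otimes>\<^bsub>R\<^esub> \<epsilon> k'"
    and ts: "\<And>k k'. k \<in> carrier K \<Longrightarrow> k' \<in> carrier K \<Longrightarrow> conv2 t s k k' = \<epsilon> k \<otimes>\<^bsub>R\<^esub> \<epsilon> k'"
    and bal: "\<And>a b c. a \<in> carrier A \<Longrightarrow> b \<in> B \<Longrightarrow> c \<in> carrier A \<Longrightarrow> W (tprod s a b) c = W a (tprod s b c)"
    and abc: "a \<in> carrier A" "b \<in> B" "c \<in> carrier A"
  shows "act2 G t W (a \<otimes>\<^bsub>A\<^esub> b) c = act2 G t W a (b \<otimes>\<^bsub>A\<^esub> c)"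
proof -
  let ?W = "act2 G t W"
  let ?u = "\<lambda>a b c. ?W (a \<otimes>\<^bsub>A\<^esub> b) c" and ?v = "\<lambda>a b c. ?W a (b \<otimes>\<^bsub>A\<^esub> c)"
  note W' = act2_bilinear[OF G t W] and tprod = act2_bilinear[OF A_module s A_mult_bilinear]
  note u = left_mult_trilinear[OF W'] and v = right_mult_trilinear[OF W']
  note ps = pull_mult_trifunctional[OF s] and pt = pull_mult_trifunctional[OF t]
  note u3 = act3_trilinear[OF G ps u] and v3 = act3_trilinear[OF G ps v]
  \<comment> \<open>As \<open>W = s \<triangleright> (t \<triangleright> W)\<close>, the product formulas apply to \<open>W\<close> itself.\<close>
  have inv: "act2 G s ?W a c = W a c" if "a \<in> carrier A" "c \<in> carrier A" for a c
    by (rule act2_inverse[OF G s t W st that])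
  have eq2: "act2 G s (\<lambda>a b. act3 G (pull_mult s) ?u a b c) a b = act2 G s (\<lambda>a b. act3 G (pull_mult s) ?v a b c) a b"
    if a: "a \<in> carrier A" and b: "b \<in> B" and c: "c \<in> carrier A" for a b c
  proof -
    have bA: "b \<in> carrier A" using b B by blast
    have "act2 G s (\<lambda>a b. act3 G (pull_mult s) ?u a b c) a b = W (tprod s a b) c"
      using act2_tprod_left[OF G s W' c, of a b] inv[OF bilinear_closed[OF tprod a bA] c] by (rule subst)
    also have "\<dots> = W a (tprod s b c)"
      by (rule bal[OF a b c])
    also have "\<dots> = act2 G s (\<lambda>b c. act3 G (\<lambda>k k' l. s k (k' \<otimes>\<^bsub>K\<^esub> l)) ?v a b c) b c"
      using inv[OF a bilinear_closed[OF tprod bA c]] act2_tprod_right[OF G s W' a, of b c] by (rule subst)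
    also have "\<dots> = act2 G s (\<lambda>a b. act3 G (pull_mult s) ?v a b c) a b"
      by (rule cocycle_act[OF G s cocycle v, symmetric])
    finally show ?thesis .
  qed
  have eq3: "act3 G (pull_mult s) ?u a b c = act3 G (pull_mult s) ?v a b c"
    if a: "a \<in> carrier A" and b: "b \<in> B" and c: "c \<in> carrier A" for a b c
  proof -
    have bA: "b \<in> carrier A" using b B by blast
    note uc = trilinear_12[OF u3 c] and vc = trilinear_12[OF v3 c]
    have "act3 G (pull_mult s) ?u a b c = act2 G t (act2 G s (\<lambda>a b. act3 G (pull_mult s) ?u a b c)) a b"
      by (rule act2_inverse[OF G t s uc ts a bA, symmetric])
    also have "\<dots> = act2 G t (act2 G s (\<lambda>a b. act3 G (pull_mult s) ?v a b c)) a b"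
      by (rule act2_cong_middle[OF G t stable bilinear_right[OF act2_bilinear[OF G s uc]]
          bilinear_right[OF act2_bilinear[OF G s vc]] eq2[OF _ _ c] b])
    also have "\<dots> = act3 G (pull_mult s) ?v a b c"
      by (rule act2_inverse[OF G t s vc ts a bA])
    finally show ?thesis .
  qed
  have bA: "b \<in> carrier A" using abc(2) B by blast
  have "?u a b c = act3 G (pull_mult t) (act3 G (pull_mult s) ?u) a b c"
    by (rule act3_inverse[OF G t s u ts abc(1) bA abc(3), symmetric])
  also have "\<dots> = act3 G (pull_mult t) (act3 G (pull_mult s) ?v) a b c"
    by (rule act3_cong_middle[OF G pt stable u3 v3 eq3 abc(2)])
  also have "\<dots> = ?v a b c"
    by (rule act3_inverse[OF G t s v ts abc(1) bA abc(3)])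
  finally show ?thesis .
qed

end

lemma cop2_eq_lift:
  assumes f: "\<And>k1 k2 k1' k2'. k1 \<in> carrier K \<Longrightarrow> k2 \<in> carrier K \<Longrightarrow> k1' \<in> carrier K \<Longrightarrow> k2' \<in> carrier K
      \<Longrightarrow> f k1 k2 k1' k2' \<in> carrier R"
    and k: "k \<in> carrier K" and k': "k' \<in> carrier K"
  shows "cop (ground_algebra R) (\<lambda>k1 k2. cop (ground_algebra R) (\<lambda>k1' k2'. f k1 k2 k1' k2') k') k
    = tensor_lift (add_monoid R) (\<lambda>k1 k2. tensor_lift (add_monoid R) (\<lambda>k1' k2'. f k1 k2 k1' k2') (\<Delta> k')) (\<Delta> k)"
proof -
  let ?g = "ground_algebra R"
  have ground: "tensor_lift (add_monoid ?g) h t = tensor_lift (add_monoid R) h t"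
    for h :: "'x \<Rightarrow> 'y \<Rightarrow> 'k" and t
    by (rule tensor_lift_monoid_cong) simp_all
  have "cop ?g (\<lambda>k1 k2. cop ?g (\<lambda>k1' k2'. f k1 k2 k1' k2') k') k
      = cop ?g (\<lambda>k1 k2. tensor_lift (add_monoid ?g) (\<lambda>k1' k2'. f k1 k2 k1' k2') (\<Delta> k')) k"
    by (rule sweedler_cong[OF refl], rule Kc.sw_eq[OF ground_module k']) (simp add: f)
  also have "\<dots> = tensor_lift (add_monoid ?g) (\<lambda>k1 k2. tensor_lift (add_monoid ?g) (\<lambda>k1' k2'. f k1 k2 k1' k2') (\<Delta> k')) (\<Delta> k)"
    by (rule Kc.sw_eq[OF ground_module k], rule lift_closed[OF ground_module Kc.supp[OF k']]) (simp add: f)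
  finally show ?thesis
    by (simp only: ground)
qed

end

section \<open>Coinvariants and the canonical map\<close>

abbreviation over_cls :: "('k, 'a) module \<Rightarrow> 'a set \<Rightarrow> 'a \<Rightarrow> 'a \<Rightarrow> ('a, 'a) tensors"
  where "over_cls A B \<equiv> balanced_data.cls A A B (monoid.mult A) (monoid.mult A)"

text \<open>
  \<open>A \<otimes>\<^sub>B A\<close> as a module over the ground ring. Its multiplication and unit are fillers required by the record
  type.
\<close>

definition over_module :: "('k, 'a) module \<Rightarrow> 'a set \<Rightarrow> ('k, ('a, 'a) tensors) module"
  where "over_module A B = \<lparr>carrier = carrier (tensor_over A B), monoid.mult = monoid.mult (tensor_over A B),
    one = one (tensor_over A B), ring.zero = one (tensor_over A B), add = monoid.mult (tensor_over A B),
    module.smult = (\<lambda>r. tensor_lift (tensor_over A B) (\<lambda>x y. over_cls A B (r \<odot>\<^bsub>A\<^esub> x) y))\<rparr>"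

lemma over_module_balanced:
  assumes A: "module R A" and mult: "bilinear R A A A (monoid.mult A)" and B: "B \<subseteq> carrier A"
    and scalars: "\<And>r. r \<in> carrier R \<Longrightarrow> \<exists>b\<in>B. (\<forall>x\<in>carrier A. x \<otimes>\<^bsub>A\<^esub> b = r \<odot>\<^bsub>A\<^esub> x) \<and>
      (\<forall>y\<in>carrier A. b \<otimes>\<^bsub>A\<^esub> y = r \<odot>\<^bsub>A\<^esub> y)"
  shows "balanced_module R A A B (monoid.mult A) (monoid.mult A) (over_module A B)"
proof -
  interpret A: module R A by (rule A)
  show ?thesis
  proof unfold_locales
    show "x \<otimes>\<^bsub>A\<^esub> s \<in> carrier A" "s \<otimes>\<^bsub>A\<^esub> x \<in> carrier A" if "x \<in> carrier A" "s \<in> B" for x s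
      using bilinear_closed[OF mult] that B by blast+
    show "r \<odot>\<^bsub>A\<^esub> x \<otimes>\<^bsub>A\<^esub> s = r \<odot>\<^bsub>A\<^esub> (x \<otimes>\<^bsub>A\<^esub> s)" if "r \<in> carrier R" "x \<in> carrier A" "s \<in> B" for r x s
      using linear_smult[OF bilinear_left[OF mult]] that B by blast
  qed (simp_all add: over_module_def tensor_over_def scalars)
qed

locale bicomodule_setting = left_comodule_setting R K \<Delta> \<epsilon> S A \<rho>
  for R :: "('k, 'l) ring_scheme" and K :: "('k, 'g) module"
    and \<Delta> :: "'g \<Rightarrow> ('g, 'g) tensors" and \<epsilon> :: "'g \<Rightarrow> 'k" and S :: "'g \<Rightarrow> 'g"
    and A :: "('k, 'a) module" and \<rho> :: "'a \<Rightarrow> ('g, 'a) tensors" +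
  fixes H :: "('k, 'h) module" and \<Delta>H \<epsilon>H SH \<delta>
  assumes hopf_H: "hopf_algebra R H \<Delta>H \<epsilon>H SH"
    and bicomodule: "bicomodule_algebra R K \<Delta> \<epsilon> H \<Delta>H \<epsilon>H A \<rho> \<delta>"
begin

lemma right_comodule_A: "right_comodule_algebra R H \<Delta>H \<epsilon>H A \<delta>"
  using bicomodule by (simp add: bicomodule_algebra_def)

lemma H_assoc_algebra: "assoc_algebra R H"
  using hopf_H by (simp add: hopf_algebra_def)

lemma H_module: "module R H"
  using assoc_algebra_module[OF H_assoc_algebra] .

lemma \<delta>_hom: "\<delta> \<in> algebra_homs R A (tensor R A H)"
  using right_comodule_algebra.right_coaction_hom[OF right_comodule_A] .

sublocale Dc: tensor_valued_map R A A H \<delta>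
  using A_module H_module \<delta>_hom by (simp add: tensor_valued_map_def algebra_homs_def)

abbreviation "rcoact \<equiv> sweedler A A H \<delta>"
abbreviation "AH \<equiv> tensor R A H"
abbreviation "pure \<equiv> pure_tensor R A H"
abbreviation "B \<equiv> coinvariants R H A \<delta>"

lemma AH_module: "module R AH"
  using tensor_module[OF A_module H_module] .

lemma pure_bilinear: "bilinear R A H AH pure"
  using pure_tensor_bilinear[OF A_module H_module] .

lemma H_one_closed: "\<one>\<^bsub>H\<^esub> \<in> carrier H"
proof -
  interpret H: assoc_algebra R H by (rule H_assoc_algebra)
  show ?thesis by simp
qed

lemma A_one: "\<one>\<^bsub>A\<^esub> \<in> carrier A" "x \<in> carrier A \<Longrightarrow> x \<otimes>\<^bsub>A\<^esub> \<one>\<^bsub>A\<^esub> = x" "x \<in> carrier A \<Longrightarrow> \<one>\<^bsub>A\<^esub> \<otimes>\<^bsub>A\<^esub> x = x"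
proof -
  interpret A: assoc_algebra R A by (rule A_assoc_algebra)
  show "\<one>\<^bsub>A\<^esub> \<in> carrier A" "x \<in> carrier A \<Longrightarrow> x \<otimes>\<^bsub>A\<^esub> \<one>\<^bsub>A\<^esub> = x" "x \<in> carrier A \<Longrightarrow> \<one>\<^bsub>A\<^esub> \<otimes>\<^bsub>A\<^esub> x = x"
    by simp_all
qed

lemma B_subset: "B \<subseteq> carrier A"
  by (auto simp: coinvariants_def)

lemma rcoact_coinvariant:
  assumes G: "module R G" and F: "bilinear R A H G F" and b: "b \<in> B"
  shows "rcoact G F b = F b \<one>\<^bsub>H\<^esub>"
proof -
  have b': "b \<in> carrier A" "\<delta> b = pure b \<one>\<^bsub>H\<^esub>"
    using b by (auto simp: coinvariants_def)
  have "rcoact G F b = tensor_lift (add_monoid G) F (pure b \<one>\<^bsub>H\<^esub>)"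
    using Dc.sw_eq[OF G b'(1) bilinear_closed[OF F]] by (simp only: b'(2))
  then show ?thesis
    by (simp only: tensor_lift_linear(2)[OF A_module H_module G F b'(1) H_one_closed])
qed

text \<open>
  This turns the right coaction itself into a Sweedler sum, so that the compatibility of the two coactions
  applies to it.
\<close>

lemma rcoact_pure:
  assumes "a \<in> carrier A" shows "rcoact AH pure a = \<delta> a"
  using Dc.sw_eq[OF AH_module assms bilinear_closed[OF pure_bilinear]]
    tensor_lift_pure[OF A_module H_module linear_closed[OF Dc.\<rho>_linear assms]] by simp

lemma coactions_commute:
  assumes "module R G" "trilinear R K A H G F"
  shows "rcoact G (\<lambda>x h. coact G (\<lambda>k y. F k y h) x) a = coact G (\<lambda>k x. rcoact G (\<lambda>y h. F k y h) x) a"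
proof (cases "a \<in> carrier A")
  case True
  show ?thesis
    using sweedler_coassoc[OF Dc.tensor_valued_map_axioms Ac.tensor_valued_map_axioms Ac.tensor_valued_map_axioms Dc.tensor_valued_map_axioms
        bicomodule_algebra.coactions_commute[OF bicomodule True] True assms] .
qed (simp add: sweedler_def)

text \<open>
  The functional applies to the leg in \<open>K\<close> and \<open>\<delta>\<close> to the leg in \<open>A\<close>, so they commute:
  \<open>\<delta> (f (b\<^sub>-\<^sub>1) b\<^sub>0) = f (b\<^sub>-\<^sub>1) (b\<^sub>0 \<otimes> 1)\<close> because \<open>\<delta> b = b \<otimes> 1\<close>.
\<close>

lemma coinvariants_stable:
  assumes b: "b \<in> B" and f: "f \<in> linear_maps R K (ground_algebra R)"
  shows "coact A (\<lambda>k x. f k \<odot>\<^bsub>A\<^esub> x) b \<in> B"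
proof -
  interpret A: module R A by (rule A_module)
  have fc: "f k \<in> carrier R" if "k \<in> carrier K" for k
    using linear_closed[OF f that] by simp
  let ?c = "coact A (\<lambda>k x. f k \<odot>\<^bsub>A\<^esub> x) b"
  note pc = bilinear_closed[OF pure_bilinear]
  have c: "?c \<in> carrier A"
    by (rule Ac.sw_closed[OF A_module]) (simp add: fc)
  have tri: "trilinear R K A H AH (\<lambda>k x h. f k \<odot>\<^bsub>AH\<^esub> pure x h)"
    by (rule trilinear_scaled[OF AH_module f pure_bilinear])
  have "\<delta> ?c = coact AH (\<lambda>k x. \<delta> (f k \<odot>\<^bsub>A\<^esub> x)) b"
    by (rule Ac.sw_out[OF A_module AH_module Dc.\<rho>_linear]) (simp add: fc)
  also have "\<dots> = coact AH (\<lambda>k x. f k \<odot>\<^bsub>AH\<^esub> rcoact AH pure x) b"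
    by (rule sweedler_cong[OF refl]) (simp only: linear_smult[OF Dc.\<rho>_linear] fc rcoact_pure)
  also have "\<dots> = coact AH (\<lambda>k x. rcoact AH (\<lambda>y h. f k \<odot>\<^bsub>AH\<^esub> pure y h) x) b"
    by (rule sweedler_cong[OF refl], rule Dc.sw_scale[OF AH_module fc pc])
  also have "\<dots> = rcoact AH (\<lambda>x h. coact AH (\<lambda>k y. f k \<odot>\<^bsub>AH\<^esub> pure y h) x) b"
    by (rule coactions_commute[OF AH_module tri, symmetric])
  also have "\<dots> = coact AH (\<lambda>k y. f k \<odot>\<^bsub>AH\<^esub> pure y \<one>\<^bsub>H\<^esub>) b"
  proof (rule rcoact_coinvariant[OF AH_module _ b], rule bilinearI)
    show "(\<lambda>x. coact AH (\<lambda>k y. f k \<odot>\<^bsub>AH\<^esub> pure y h) x) \<in> linear_maps R A AH" if "h \<in> carrier H" for h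
      by (rule Ac.sw_linear[OF AH_module bilinear_scaled[OF AH_module f bilinear_left[OF pure_bilinear that]]])
    show "(\<lambda>h. coact AH (\<lambda>k y. f k \<odot>\<^bsub>AH\<^esub> pure y h) x) \<in> linear_maps R H AH" if "x \<in> carrier A" for x
      by (rule Ac.sw_param_linear[OF AH_module]) (rule trilinear_3[OF tri])
  qed
  also have "\<dots> = coact AH (\<lambda>k y. pure (f k \<odot>\<^bsub>A\<^esub> y) \<one>\<^bsub>H\<^esub>) b"
    by (rule sweedler_cong[OF refl])
      (simp only: linear_smult[OF bilinear_left[OF pure_bilinear H_one_closed]] fc)
  also have "\<dots> = pure ?c \<one>\<^bsub>H\<^esub>"
    by (rule Ac.sw_out[OF A_module AH_module bilinear_left[OF pure_bilinear H_one_closed], symmetric])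
      (simp add: fc)
  finally show ?thesis
    using c by (simp add: coinvariants_def)
qed

lemma scalar_coinvariant:
  assumes r: "r \<in> carrier R" shows "r \<odot>\<^bsub>A\<^esub> \<one>\<^bsub>A\<^esub> \<in> B"
proof -
  interpret A: module R A by (rule A_module)
  have "\<delta> \<one>\<^bsub>A\<^esub> = \<one>\<^bsub>AH\<^esub>"
    using \<delta>_hom by (simp add: algebra_homs_def ring_hom_def)
  also have "\<dots> = pure \<one>\<^bsub>A\<^esub> \<one>\<^bsub>H\<^esub>"
    by (simp add: tensor_def Let_def)
  finally have "\<delta> (r \<odot>\<^bsub>A\<^esub> \<one>\<^bsub>A\<^esub>) = pure (r \<odot>\<^bsub>A\<^esub> \<one>\<^bsub>A\<^esub>) \<one>\<^bsub>H\<^esub>"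
    using linear_smult[OF Dc.\<rho>_linear r A_one(1)]
      linear_smult[OF bilinear_left[OF pure_bilinear H_one_closed] r A_one(1)] by simp
  then show ?thesis
    using r A_one(1) by (simp add: coinvariants_def)
qed

lemma rcoact_mult:
  assumes "module R G" "bilinear R A H G F" "a \<in> carrier A" "b \<in> carrier A"
  shows "rcoact G F (a \<otimes>\<^bsub>A\<^esub> b)
    = rcoact G (\<lambda>x h. rcoact G (\<lambda>x' h'. F (x \<otimes>\<^bsub>A\<^esub> x') (h \<otimes>\<^bsub>H\<^esub> h')) b) a"
  using \<delta>_hom A_mult_closed
  by (intro Dc.sw_mult assms mult_bilinear A_assoc_algebra H_assoc_algebra)
    (simp add: algebra_homs_def ring_hom_def)

text \<open>
  The canonical map on pairs, before passing to \<open>A \<otimes>\<^sub>B A\<close>.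
\<close>

definition chi :: "'a \<Rightarrow> 'a \<Rightarrow> ('a, 'h) tensors"
  where "chi a a' = rcoact AH (\<lambda>x h. pure (a \<otimes>\<^bsub>A\<^esub> x) h) a'"

lemma pure_mult_bilinear:
  assumes "a \<in> carrier A" shows "bilinear R A H AH (\<lambda>x h. pure (a \<otimes>\<^bsub>A\<^esub> x) h)"
proof (rule bilinearI)
  show "(\<lambda>x. pure (a \<otimes>\<^bsub>A\<^esub> x) h) \<in> linear_maps R A AH" if "h \<in> carrier H" for h
    by (rule linear_compose[OF bilinear_right[OF A_mult_bilinear assms] bilinear_left[OF pure_bilinear that]])
  show "(\<lambda>h. pure (a \<otimes>\<^bsub>A\<^esub> x) h) \<in> linear_maps R H AH" if "x \<in> carrier A" for x
    by (rule bilinear_right[OF pure_bilinear A_mult_closed[OF assms that]])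
qed

lemma chi_bilinear: "bilinear R A A AH chi"
proof (rule bilinearI)
  show "(\<lambda>a. chi a a') \<in> linear_maps R A AH" for a'
    unfolding chi_def
  proof (rule Dc.sw_param_linear[OF AH_module])
    show "(\<lambda>a. pure (a \<otimes>\<^bsub>A\<^esub> x) h) \<in> linear_maps R A AH" if "x \<in> carrier A" "h \<in> carrier H" for x h
      by (rule linear_compose[OF bilinear_left[OF A_mult_bilinear that(1)] bilinear_left[OF pure_bilinear that(2)]])
  qed
  show "(\<lambda>a'. chi a a') \<in> linear_maps R A AH" if "a \<in> carrier A" for a
    unfolding chi_def by (rule Dc.sw_linear[OF AH_module pure_mult_bilinear[OF that]])
qed

lemma chi_balanced:
  assumes a: "a \<in> carrier A" and b: "b \<in> B" and a': "a' \<in> carrier A"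
  shows "chi (a \<otimes>\<^bsub>A\<^esub> b) a' = chi a (b \<otimes>\<^bsub>A\<^esub> a')"
proof -
  interpret A: assoc_algebra R A by (rule A_assoc_algebra)
  interpret H: assoc_algebra R H by (rule H_assoc_algebra)
  have bA: "b \<in> carrier A" using b B_subset by blast
  note F = pure_mult_bilinear[OF a]
  have "chi a (b \<otimes>\<^bsub>A\<^esub> a') = rcoact AH (\<lambda>x h. rcoact AH (\<lambda>x' h'. pure (a \<otimes>\<^bsub>A\<^esub> (x \<otimes>\<^bsub>A\<^esub> x')) (h \<otimes>\<^bsub>H\<^esub> h')) a') b"
    unfolding chi_def by (rule rcoact_mult[OF AH_module F bA a'])
  also have "\<dots> = rcoact AH (\<lambda>x' h'. pure (a \<otimes>\<^bsub>A\<^esub> (b \<otimes>\<^bsub>A\<^esub> x')) (\<one>\<^bsub>H\<^esub> \<otimes>\<^bsub>H\<^esub> h')) a'"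
  proof (rule rcoact_coinvariant[OF AH_module _ b], rule Dc.sw_param_bilinear[OF AH_module], rule bilinearI)
    fix x' h' assume x': "x' \<in> carrier A" and h': "h' \<in> carrier H"
    show "(\<lambda>x. pure (a \<otimes>\<^bsub>A\<^esub> (x \<otimes>\<^bsub>A\<^esub> x')) (h \<otimes>\<^bsub>H\<^esub> h')) \<in> linear_maps R A AH" if h: "h \<in> carrier H" for h
      by (rule linear_compose[OF bilinear_left[OF A_mult_bilinear x'] bilinear_left[OF F H.m_closed[OF h h']]])
    show "(\<lambda>h. pure (a \<otimes>\<^bsub>A\<^esub> (x \<otimes>\<^bsub>A\<^esub> x')) (h \<otimes>\<^bsub>H\<^esub> h')) \<in> linear_maps R H AH" if x: "x \<in> carrier A" for x
      by (rule linear_compose[OF bilinear_left[OF mult_bilinear[OF H_assoc_algebra] h']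
          bilinear_right[OF F A_mult_closed[OF x x']]])
  qed
  also have "\<dots> = chi (a \<otimes>\<^bsub>A\<^esub> b) a'"
    unfolding chi_def
    by (rule sweedler_cong[OF refl]) (simp add: a bA A.m_assoc)
  finally show ?thesis by (rule sym)
qed

text \<open>
  The left-hand side is the canonical map on pairs formed with the twisted product. The left coaction
  enters on \<open>a'\<^sub>0\<close>, after \<open>\<delta>\<close>; as the coactions commute it may be applied to \<open>a'\<close> first.
\<close>

lemma chi_twist:
  assumes s: "bifunctional s" and a: "a \<in> carrier A"
  shows "rcoact AH (\<lambda>x h. pure (tprod s a x) h) a' = act2 AH s chi a a'"
proof -
  note sc = bifunctional_closed[OF s] and pc = bilinear_closed[OF pure_bilinear]
  have "rcoact AH (\<lambda>x h. pure (tprod s a x) h) a'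
      = rcoact AH (\<lambda>x h. act2 AH s (\<lambda>y y'. pure (y \<otimes>\<^bsub>A\<^esub> y') h) a x) a'"
    by (rule sweedler_cong[OF refl], rule act2_out[OF A_module AH_module bilinear_left[OF pure_bilinear] s A_mult_closed])
  also have "\<dots> = coact AH (\<lambda>k y. rcoact AH (\<lambda>x h. coact AH (\<lambda>k' y'. s k k' \<odot>\<^bsub>AH\<^esub> pure (y \<otimes>\<^bsub>A\<^esub> y') h) x) a') a"
    unfolding act2_def
    by (rule sweedler_swap[OF Dc.tensor_valued_map_axioms Ac.tensor_valued_map_axioms AH_module])
      (intro Ac.sw_closed[OF AH_module] smult_closed[OF AH_module] sc pc A_mult_closed; assumption)
  also have "\<dots> = coact AH (\<lambda>k y. coact AH (\<lambda>k' x. rcoact AH (\<lambda>y' h. s k k' \<odot>\<^bsub>AH\<^esub> pure (y \<otimes>\<^bsub>A\<^esub> y') h) x) a') a"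
    by (rule sweedler_cong[OF refl], rule coactions_commute[OF AH_module])
      (rule trilinear_scaled[OF AH_module bilinear_right[OF s] pure_mult_bilinear]; assumption)
  also have "\<dots> = act2 AH s chi a a'"
    unfolding act2_def chi_def
    by (rule sweedler_cong[OF refl], rule sweedler_cong[OF refl], rule Dc.sw_scale[OF AH_module, symmetric])
      (intro sc pc A_mult_closed; assumption)+
  finally show ?thesis .
qed

lemma coact_one:
  assumes G: "module R G" and F: "bilinear R K A G F"
  shows "coact G F \<one>\<^bsub>A\<^esub> = F \<one>\<^bsub>K\<^esub> \<one>\<^bsub>A\<^esub>"
proof -
  interpret K: assoc_algebra R K by (rule K_assoc_algebra)
  have "\<rho> \<one>\<^bsub>A\<^esub> = \<one>\<^bsub>tensor R K A\<^esub>"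
    using left_comodule_algebra.left_coaction_hom[OF comodule_A] by (simp add: algebra_homs_def ring_hom_def)
  also have "\<dots> = pure_tensor R K A \<one>\<^bsub>K\<^esub> \<one>\<^bsub>A\<^esub>"
    by (simp add: tensor_def Let_def)
  finally have one: "\<rho> \<one>\<^bsub>A\<^esub> = pure_tensor R K A \<one>\<^bsub>K\<^esub> \<one>\<^bsub>A\<^esub>" .
  have "coact G F \<one>\<^bsub>A\<^esub> = tensor_lift (add_monoid G) F (\<rho> \<one>\<^bsub>A\<^esub>)"
    by (rule Ac.sw_eq[OF G A_one(1) bilinear_closed[OF F]])
  then show ?thesis
    unfolding one using tensor_lift_linear(2)[OF K_module A_module G F _ A_one(1), of "\<one>\<^bsub>K\<^esub>"] by simp
qed

text \<open>
  Here the normalisation of the cocycle enters. Scalar multiples of the unit then act on \<open>A\<sigma>\<close> as the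
  scalars do, which makes \<open>A\<sigma> \<otimes>\<^sub>B A\<sigma>\<close> a module over the ground ring.
\<close>

lemma tprod_one:
  assumes s: "bifunctional s"
    and unit: "\<And>k. k \<in> carrier K \<Longrightarrow> s k \<one>\<^bsub>K\<^esub> = \<epsilon> k" "\<And>k. k \<in> carrier K \<Longrightarrow> s \<one>\<^bsub>K\<^esub> k = \<epsilon> k"
    and x: "x \<in> carrier A"
  shows "tprod s x \<one>\<^bsub>A\<^esub> = x" "tprod s \<one>\<^bsub>A\<^esub> x = x"
proof -
  interpret K: assoc_algebra R K by (rule K_assoc_algebra)
  note m = A_mult_bilinear
  have "tprod s x \<one>\<^bsub>A\<^esub> = coact A (\<lambda>k y. s k \<one>\<^bsub>K\<^esub> \<odot>\<^bsub>A\<^esub> (y \<otimes>\<^bsub>A\<^esub> \<one>\<^bsub>A\<^esub>)) x"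
    unfolding act2_def
    by (rule sweedler_cong[OF refl], rule coact_one[OF A_module])
      (rule bilinear_scaled[OF A_module bilinear_right[OF s] bilinear_right[OF m]]; assumption)
  also have "\<dots> = coact A (\<lambda>k y. \<epsilon> k \<odot>\<^bsub>A\<^esub> y) x"
    by (rule sweedler_cong[OF refl]) (simp only: unit A_one)
  also have "\<dots> = x"
    by (rule coact_counit[OF A_module linear_ident x])
  finally show "tprod s x \<one>\<^bsub>A\<^esub> = x" .
  have "tprod s \<one>\<^bsub>A\<^esub> x = coact A (\<lambda>k y. s \<one>\<^bsub>K\<^esub> k \<odot>\<^bsub>A\<^esub> (\<one>\<^bsub>A\<^esub> \<otimes>\<^bsub>A\<^esub> y)) x"
    unfolding act2_def
    by (rule coact_one[OF A_module], rule Ac.sw_param_bilinear[OF A_module])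
      (rule bilinear_scaled[OF A_module bilinear_left[OF s] bilinear_left[OF m]]; assumption)
  also have "\<dots> = coact A (\<lambda>k y. \<epsilon> k \<odot>\<^bsub>A\<^esub> y) x"
    by (rule sweedler_cong[OF refl]) (simp only: unit A_one)
  also have "\<dots> = x"
    by (rule coact_counit[OF A_module linear_ident x])
  finally show "tprod s \<one>\<^bsub>A\<^esub> x = x" .
qed

end

text \<open>
  The twisted algebra enters only through the listed properties of \<open>A'\<close>: the module structure is that of
  \<open>A\<close>, and on the carrier the product is the twisted one.
\<close>

locale cocycle_twist = bicomodule_setting R K \<Delta> \<epsilon> S A \<rho> H \<Delta>H \<epsilon>H SH \<delta>
  for R :: "('k, 'l) ring_scheme" and K :: "('k, 'g) module"
    and \<Delta> :: "'g \<Rightarrow> ('g, 'g) tensors" and \<epsilon> :: "'g \<Rightarrow> 'k" and S :: "'g \<Rightarrow> 'g"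
    and A :: "('k, 'a) module" and \<rho> :: "'a \<Rightarrow> ('g, 'a) tensors"
    and H :: "('k, 'h) module" and \<Delta>H \<epsilon>H SH \<delta> +
  fixes s t :: "'g \<Rightarrow> 'g \<Rightarrow> 'k" and A' :: "('k, 'a) module"
  assumes s: "bifunctional s" and t: "bifunctional t"
    and s_cocycle: "cocycle s"
    and st: "\<And>k k'. k \<in> carrier K \<Longrightarrow> k' \<in> carrier K \<Longrightarrow> conv2 s t k k' = \<epsilon> k \<otimes>\<^bsub>R\<^esub> \<epsilon> k'"
    and ts: "\<And>k k'. k \<in> carrier K \<Longrightarrow> k' \<in> carrier K \<Longrightarrow> conv2 t s k k' = \<epsilon> k \<otimes>\<^bsub>R\<^esub> \<epsilon> k'"
    and s_unit: "\<And>k. k \<in> carrier K \<Longrightarrow> s k \<one>\<^bsub>K\<^esub> = \<epsilon> k" "\<And>k. k \<in> carrier K \<Longrightarrow> s \<one>\<^bsub>K\<^esub> k = \<epsilon> k"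
    and A'_simps: "carrier A' = carrier A" "add A' = add A" "zero A' = zero A" "module.smult A' = module.smult A"
    and A'_mult: "\<And>a b. a \<in> carrier A \<Longrightarrow> b \<in> carrier A \<Longrightarrow> a \<otimes>\<^bsub>A'\<^esub> b = tprod s a b"
begin

lemma linear_maps_A': "linear_maps R A' G = linear_maps R A G" "linear_maps R G A' = linear_maps R G A"
  by (simp_all add: linear_maps_def A'_simps)

lemma bilinear_A': "bilinear R A' A' G f \<longleftrightarrow> bilinear R A A G f"
  by (simp add: bilinear_def linear_maps_A' A'_simps)

lemma A'_module: "module R A'"
proof -
  interpret A: module R A by (rule A_module)
  show ?thesis
    by (rule moduleI)
      (auto simp: A'_simps A.smult_l_distr A.smult_r_distr A.smult_assoc1 A.a_ac
        intro!: A.is_cring abelian_groupI bexI[of _ "\<ominus>\<^bsub>A\<^esub> _"] intro: A.l_neg)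
qed

lemma tprod_bilinear: "bilinear R A A A (tprod s)"
  by (rule act2_bilinear[OF A_module s A_mult_bilinear])

lemma bilinear_cong:
  assumes "bilinear R A A A f" "\<And>a b. a \<in> carrier A \<Longrightarrow> b \<in> carrier A \<Longrightarrow> g a b = f a b"
  shows "bilinear R A A A g"
proof -
  interpret A: module R A by (rule A_module)
  show ?thesis
    using assms by (auto simp: bilinear_def linear_maps_def Pi_iff)
qed

lemma A'_mult_bilinear: "bilinear R A' A' A' (monoid.mult A')"
  using bilinear_cong[OF tprod_bilinear A'_mult]
  by (simp add: bilinear_def linear_maps_A' A'_simps)

sublocale U: balanced_module R A A B "monoid.mult A" "monoid.mult A" "over_module A B"
proof (rule over_module_balanced[OF A_module A_mult_bilinear B_subset])
  fix r assume r: "r \<in> carrier R"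
  show "\<exists>b\<in>B. (\<forall>x\<in>carrier A. x \<otimes>\<^bsub>A\<^esub> b = r \<odot>\<^bsub>A\<^esub> x) \<and> (\<forall>y\<in>carrier A. b \<otimes>\<^bsub>A\<^esub> y = r \<odot>\<^bsub>A\<^esub> y)"
    using linear_smult[OF bilinear_left[OF A_mult_bilinear] r A_one(1)]
      linear_smult[OF bilinear_right[OF A_mult_bilinear] r A_one(1)]
    by (intro bexI[OF _ scalar_coinvariant[OF r]]) (simp add: A_one)
qed

sublocale U': balanced_module R A' A' B "monoid.mult A'" "monoid.mult A'" "over_module A' B"
proof (rule over_module_balanced[OF A'_module A'_mult_bilinear])
  show "B \<subseteq> carrier A'"
    using B_subset by (simp add: A'_simps)
  fix r assume r: "r \<in> carrier R"
  have rA: "r \<odot>\<^bsub>A\<^esub> \<one>\<^bsub>A\<^esub> \<in> carrier A"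
    using scalar_coinvariant[OF r] B_subset by blast
  show "\<exists>b\<in>B. (\<forall>x\<in>carrier A'. x \<otimes>\<^bsub>A'\<^esub> b = r \<odot>\<^bsub>A'\<^esub> x) \<and> (\<forall>y\<in>carrier A'. b \<otimes>\<^bsub>A'\<^esub> y = r \<odot>\<^bsub>A'\<^esub> y)"
    using linear_smult[OF bilinear_left[OF tprod_bilinear] r A_one(1)]
      linear_smult[OF bilinear_right[OF tprod_bilinear] r A_one(1)] rA
    by (intro bexI[OF _ scalar_coinvariant[OF r]])
      (simp add: A'_simps A'_mult tprod_one[OF s s_unit])
qed

abbreviation "UA \<equiv> over_module A B"
abbreviation "UA' \<equiv> over_module A' B"

lemma cls'_bilinear: "bilinear R A A UA' U'.cls"
  using U'.cls_bilinear by (simp add: bilinear_A')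

definition \<Phi> where "\<Phi> = tensor_lift (add_monoid UA) (act2 UA s U.cls)"
definition \<Psi> where "\<Psi> = tensor_lift (add_monoid UA') (act2 UA' t U'.cls)"

lemma \<Phi>_linear: "\<Phi> \<in> linear_maps R UA' UA"
  and \<Phi>_cls: "x \<in> carrier A \<Longrightarrow> y \<in> carrier A \<Longrightarrow> \<Phi> (U'.cls x y) = act2 UA s U.cls x y"
proof -
  have bil: "bilinear R A' A' UA (act2 UA s U.cls)"
    using act2_bilinear[OF U.module_U s U.cls_bilinear] by (simp add: bilinear_A')
  have bal: "act2 UA s U.cls (x \<otimes>\<^bsub>A'\<^esub> b) y = act2 UA s U.cls x (b \<otimes>\<^bsub>A'\<^esub> y)"
    if "x \<in> carrier A'" "b \<in> B" "y \<in> carrier A'" for x b y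
  proof -
    have x: "x \<in> carrier A" and b: "b \<in> carrier A" and y: "y \<in> carrier A"
      using that B_subset by (auto simp: A'_simps)
    have "act2 UA s U.cls (tprod s x b) y = act2 UA s U.cls x (tprod s b y)"
      by (rule twist_balanced[where B = B, OF s s_cocycle B_subset coinvariants_stable U.module_U U.cls_bilinear
            _ x that(2) y]) (assumption | rule U.cls_balanced)+
    then show ?thesis
      by (simp only: A'_mult[OF x b] A'_mult[OF b y])
  qed
  show "\<Phi> \<in> linear_maps R UA' UA"
    unfolding \<Phi>_def by (rule U'.lift_linear(1)[where f = "act2 UA s U.cls", OF U.module_U bil bal])
  show "\<Phi> (U'.cls x y) = act2 UA s U.cls x y" if "x \<in> carrier A" "y \<in> carrier A"
    unfolding \<Phi>_def using that by (intro U'.lift_linear(2)[where f = "act2 UA s U.cls", OF U.module_U bil bal]) (simp_all add: A'_simps)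
qed

lemma \<Psi>_linear: "\<Psi> \<in> linear_maps R UA UA'"
  and \<Psi>_cls: "x \<in> carrier A \<Longrightarrow> y \<in> carrier A \<Longrightarrow> \<Psi> (U.cls x y) = act2 UA' t U'.cls x y"
proof -
  have bil: "bilinear R A A UA' (act2 UA' t U'.cls)"
    using act2_bilinear[OF U'.module_U t cls'_bilinear] .
  have bal': "U'.cls (tprod s x b) y = U'.cls x (tprod s b y)"
    if "x \<in> carrier A" "b \<in> B" "y \<in> carrier A" for x b y
    using that B_subset U'.cls_balanced[of x b y] by (simp add: A'_simps A'_mult subset_iff)
  have bal: "act2 UA' t U'.cls (x \<otimes>\<^bsub>A\<^esub> b) y = act2 UA' t U'.cls x (b \<otimes>\<^bsub>A\<^esub> y)"
    if "x \<in> carrier A" "b \<in> B" "y \<in> carrier A" for x b y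
    by (rule untwist_balanced[where B = B and W = U'.cls and G = UA', OF s s_cocycle B_subset coinvariants_stable U'.module_U cls'_bilinear t st ts bal' that])
  show "\<Psi> \<in> linear_maps R UA UA'"
    unfolding \<Psi>_def by (rule U.lift_linear(1)[where f = "act2 UA' t U'.cls", OF U'.module_U bil bal])
  show "\<Psi> (U.cls x y) = act2 UA' t U'.cls x y" if "x \<in> carrier A" "y \<in> carrier A"
    unfolding \<Psi>_def by (rule U.lift_linear(2)[where f = "act2 UA' t U'.cls", OF U'.module_U bil bal that])
qed

lemma \<Phi>_bij: "bij_betw \<Phi> (carrier UA') (carrier UA)"
proof (rule bij_betw_byWitness[where f' = \<Psi>])
  show "\<forall>u\<in>carrier UA'. \<Psi> (\<Phi> u) = u"
  proof
    fix u assume u: "u \<in> carrier UA'"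
    show "\<Psi> (\<Phi> u) = u"
    proof (rule U'.linear_eqI[OF U'.module_U linear_compose[OF \<Phi>_linear \<Psi>_linear] linear_ident _ u])
      fix x y assume "x \<in> carrier A'" "y \<in> carrier A'"
      then have xy: "x \<in> carrier A" "y \<in> carrier A"
        by (simp_all add: A'_simps)
      have "\<Psi> (\<Phi> (U'.cls x y)) = act2 UA' s (\<lambda>x y. \<Psi> (U.cls x y)) x y"
        unfolding \<Phi>_cls[OF xy] by (rule act2_out[OF U.module_U U'.module_U \<Psi>_linear s bilinear_closed[OF U.cls_bilinear]])
      also have "\<dots> = act2 UA' s (act2 UA' t U'.cls) x y"
        unfolding act2_def[of UA' s] by (intro sweedler_cong refl) (simp only: \<Psi>_cls)
      also have "\<dots> = U'.cls x y"
        by (rule act2_inverse[OF U'.module_U s t cls'_bilinear st xy])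
      finally show "\<Psi> (\<Phi> (U'.cls x y)) = U'.cls x y" .
    qed
  qed
  show "\<forall>u\<in>carrier UA. \<Phi> (\<Psi> u) = u"
  proof
    fix u assume u: "u \<in> carrier UA"
    show "\<Phi> (\<Psi> u) = u"
    proof (rule U.linear_eqI[OF U.module_U linear_compose[OF \<Psi>_linear \<Phi>_linear] linear_ident _ u])
      fix x y assume xy: "x \<in> carrier A" "y \<in> carrier A"
      have "\<Phi> (\<Psi> (U.cls x y)) = act2 UA t (\<lambda>x y. \<Phi> (U'.cls x y)) x y"
        unfolding \<Psi>_cls[OF xy] by (rule act2_out[OF U'.module_U U.module_U \<Phi>_linear t bilinear_closed[OF cls'_bilinear]])
      also have "\<dots> = act2 UA t (act2 UA s U.cls) x y"
        unfolding act2_def[of UA t] by (intro sweedler_cong refl) (simp only: \<Phi>_cls)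
      also have "\<dots> = U.cls x y"
        by (rule act2_inverse[OF U.module_U t s U.cls_bilinear ts xy])
      finally show "\<Phi> (\<Psi> (U.cls x y)) = U.cls x y" .
    qed
  qed
qed (rule image_subsetI, erule linear_closed[OF \<Phi>_linear], rule image_subsetI, erule linear_closed[OF \<Psi>_linear])

lemma pure_tensor_A': "pure_tensor R A' H = pure_tensor R A H"
  and tensor_group_A': "tensor_group R A' H = tensor_group R A H"
  unfolding pure_tensor_def[abs_def] tensor_group_def balanced_tensor_def tensor_rels_def A'_simps
  by (rule refl)+

lemma coinvariants_A': "coinvariants R H A' \<delta> = B"
  by (simp add: coinvariants_def A'_simps pure_tensor_A')

lemma carrier_tensor_A': "carrier (tensor R A' H) = carrier AH"
  by (simp add: tensor_def Let_def tensor_group_A')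

lemma canonical_map_eq:
  assumes "u \<in> carrier UA" shows "canonical_map R H A \<delta> u = tensor_lift (add_monoid AH) chi u"
  unfolding canonical_map_def Let_def tensor_lift_tensor_group
proof (rule lift_cong[OF AH_module U.supported_U[OF assms]])
  fix a a' assume a: "a \<in> carrier A" and a': "a' \<in> carrier A"
  show "chi a a' \<in> carrier AH"
    by (rule bilinear_closed[OF chi_bilinear a a'])
  show "tensor_lift (add_monoid AH) (\<lambda>x h. pure (a \<otimes>\<^bsub>A\<^esub> x) h) (\<delta> a') = chi a a'"
    unfolding chi_def by (rule Dc.sw_eq[OF AH_module a' bilinear_closed[OF pure_mult_bilinear[OF a]], symmetric])
qed

lemma canonical_map_A'_eq:
  assumes u: "u \<in> carrier UA'"
  shows "canonical_map R H A' \<delta> u = canonical_map R H A \<delta> (\<Phi> u)"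
proof -
  note chi = U.lift_linear[OF AH_module chi_bilinear chi_balanced]
  note cls = bilinear_closed[OF U.cls_bilinear]
  have inner: "tensor_lift (add_monoid AH) (\<lambda>x h. pure (a \<otimes>\<^bsub>A'\<^esub> x) h) (\<delta> a') = act2 AH s chi a a'"
    if a: "a \<in> carrier A" and a': "a' \<in> carrier A" for a a'
  proof -
    have "tensor_lift (add_monoid AH) (\<lambda>x h. pure (a \<otimes>\<^bsub>A'\<^esub> x) h) (\<delta> a')
        = rcoact AH (\<lambda>x h. pure (a \<otimes>\<^bsub>A'\<^esub> x) h) a'"
      using bilinear_closed[OF pure_bilinear] bilinear_closed[OF tprod_bilinear] a
      by (intro Dc.sw_eq[OF AH_module a', symmetric]) (simp add: A'_mult)
    also have "\<dots> = rcoact AH (\<lambda>x h. pure (tprod s a x) h) a'"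
      by (rule sweedler_cong[OF refl]) (simp only: A'_mult[OF a])
    also have "\<dots> = act2 AH s chi a a'"
      by (rule chi_twist[OF s a])
    finally show ?thesis .
  qed
  have act2: "act2 AH s chi a a' = tensor_lift (add_monoid AH) chi (\<Phi> (U'.cls a a'))"
    if a: "a \<in> carrier A" and a': "a' \<in> carrier A" for a a'
  proof -
    have "tensor_lift (add_monoid AH) chi (\<Phi> (U'.cls a a'))
        = act2 AH s (\<lambda>x y. tensor_lift (add_monoid AH) chi (U.cls x y)) a a'"
      unfolding \<Phi>_cls[OF a a'] by (rule act2_out[OF U.module_U AH_module chi(1) s cls])
    also have "\<dots> = act2 AH s chi a a'"
      unfolding act2_def by (intro sweedler_cong refl) (simp only: chi(2))
    finally show ?thesis by (rule sym)
  qed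
  note chi\<Phi> = linear_compose[OF \<Phi>_linear chi(1)]
  have "canonical_map R H A' \<delta> u
      = tensor_lift (add_monoid AH) (\<lambda>a a'. tensor_lift (add_monoid AH) chi (\<Phi> (U'.cls a a'))) u"
    unfolding canonical_map_def Let_def tensor_group_A' pure_tensor_A' tensor_lift_tensor_group
    by (rule lift_cong[OF AH_module U'.supported_U[OF u]])
      (use inner act2 linear_closed[OF chi\<Phi> bilinear_closed[OF cls'_bilinear]] in \<open>auto simp: A'_simps\<close>)
  also have "\<dots> = tensor_lift (add_monoid AH) chi (\<Phi> (tensor_lift (add_monoid UA') U'.cls u))"
    by (rule lift_linear_out[OF U'.module_U AH_module chi\<Phi> U'.supported_U[OF u]
        bilinear_closed[OF U'.cls_bilinear], symmetric])
  also have "\<dots> = canonical_map R H A \<delta> (\<Phi> u)"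
    by (simp only: U'.lift_cls[OF u] canonical_map_eq[OF linear_closed[OF \<Phi>_linear u]])
  finally show ?thesis .
qed

text \<open>
  Both canonical maps have the same target, because \<open>A \<otimes> H\<close> is built without the product of \<open>A\<close>.
\<close>

theorem hopf_galois_twist:
  "hopf_galois_extension R H A \<delta> B \<longleftrightarrow> hopf_galois_extension R H A' \<delta> (coinvariants R H A' \<delta>)"
proof -
  have carriers: "carrier (tensor_over A B) = carrier UA" "carrier (tensor_over A' B) = carrier UA'"
    by (simp_all add: over_module_def)
  have "bij_betw (canonical_map R H A \<delta>) (carrier UA) (carrier AH)
      \<longleftrightarrow> bij_betw (canonical_map R H A \<delta> \<circ> \<Phi>) (carrier UA') (carrier AH)"
    by (rule bij_betw_comp_iff[OF \<Phi>_bij])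
  also have "\<dots> \<longleftrightarrow> bij_betw (canonical_map R H A' \<delta>) (carrier UA') (carrier AH)"
    by (rule bij_betw_cong) (simp add: canonical_map_A'_eq)
  finally show ?thesis
    by (simp add: hopf_galois_extension_def coinvariants_A' carriers carrier_tensor_A')
qed

end

theorem corollary4p11:
  fixes R :: "'k ring"
    and K :: "('k, 'g) module" and H :: "('k, 'h) module" and A :: "('k, 'a) module"
  assumes "R \<simeq> (ring_of_type_algebra :: complex ring) \<or>
      R \<simeq> (ring_of_type_algebra :: complex fps ring)"
    and "hopf_algebra R K \<Delta>K \<epsilon>K SK"
    and "hopf_algebra R H \<Delta>H \<epsilon>H SH"
    and "bij_betw SH (carrier H) (carrier H)"
    and "bicomodule_algebra R K \<Delta>K \<epsilon>K H \<Delta>H \<epsilon>H A \<rho> \<delta>"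
    and "B = coinvariants R H A \<delta>"
    and "two_cocycle R K \<Delta>K \<epsilon>K \<sigma>"
    and "A\<sigma> = twisted_algebra R K \<sigma> \<rho> A"
    and "B\<sigma> = coinvariants R H A\<sigma> \<delta>"
  shows "hopf_galois_extension R H A \<delta> B \<longleftrightarrow> hopf_galois_extension R H A\<sigma> \<delta> B\<sigma>"
proof -
  interpret bicomodule_setting R K \<Delta>K \<epsilon>K SK A \<rho> H \<Delta>H \<epsilon>H SH \<delta>
    using assms(2,3,5)
    by (simp add: bicomodule_setting_def bicomodule_setting_axioms_def left_comodule_setting_def
        bicomodule_algebra_def)
  let ?KK = "tensor R K K" and ?g = "ground_algebra R"
  obtain \<tau> where \<sigma>: "\<sigma> \<in> linear_maps R ?KK ?g" and \<tau>: "\<tau> \<in> linear_maps R ?KK ?g"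
    and cocycle: "\<forall>g\<in>carrier K. \<forall>h\<in>carrier K. \<forall>k\<in>carrier K.
       tensor_lift (add_monoid R) (\<lambda>g1 g2. tensor_lift (add_monoid R) (\<lambda>h1 h2.
         \<sigma> (pure_tensor R K K g1 h1) \<otimes>\<^bsub>R\<^esub> \<sigma> (pure_tensor R K K (g2 \<otimes>\<^bsub>K\<^esub> h2) k)) (\<Delta>K h)) (\<Delta>K g)
       = tensor_lift (add_monoid R) (\<lambda>h1 h2. tensor_lift (add_monoid R) (\<lambda>k1 k2.
         \<sigma> (pure_tensor R K K h1 k1) \<otimes>\<^bsub>R\<^esub> \<sigma> (pure_tensor R K K g (h2 \<otimes>\<^bsub>K\<^esub> k2))) (\<Delta>K k)) (\<Delta>K h)"
    and inv: "\<forall>g\<in>carrier K. \<forall>h\<in>carrier K.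
       convolution R K \<Delta>K \<sigma> \<tau> g h = \<epsilon>K g \<otimes>\<^bsub>R\<^esub> \<epsilon>K h \<and>
       convolution R K \<Delta>K \<tau> \<sigma> g h = \<epsilon>K g \<otimes>\<^bsub>R\<^esub> \<epsilon>K h"
    and unit: "\<forall>h\<in>carrier K. \<sigma> (pure_tensor R K K h \<one>\<^bsub>K\<^esub>) = \<epsilon>K h \<and> \<sigma> (pure_tensor R K K \<one>\<^bsub>K\<^esub> h) = \<epsilon>K h"
    using assms(7) unfolding two_cocycle_def by blast
  define s where "s = (\<lambda>g h. \<sigma> (pure_tensor R K K g h))"
  define t where "t = (\<lambda>g h. \<tau> (pure_tensor R K K g h))"
  have bif: "bifunctional (\<lambda>g h. f (pure_tensor R K K g h))" if "f \<in> linear_maps R ?KK ?g" for f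
    by (rule bilinear_compose[OF pure_tensor_bilinear[OF K_module K_module] that])
  have s: "bifunctional s" and t: "bifunctional t"
    unfolding s_def t_def using bif \<sigma> \<tau> by auto
  note sc = bifunctional_closed[OF s] and tc = bifunctional_closed[OF t]
  interpret R: cring R by (rule R_cring)
  have conv: "conv2 (\<lambda>g h. f (pure_tensor R K K g h)) (\<lambda>g h. f' (pure_tensor R K K g h)) g h
      = convolution R K \<Delta>K f f' g h"
    if "f \<in> linear_maps R ?KK ?g" "f' \<in> linear_maps R ?KK ?g" "g \<in> carrier K" "h \<in> carrier K" for f f' g h
    unfolding conv2_def convolution_def using bifunctional_closed[OF bif] that
    by (intro cop2_eq_lift) auto
  have coc: "left_comodule_setting.cocycle R K \<Delta>K s"
    unfolding cocycle_def conv2_def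
  proof (intro ballI)
    fix g h k assume g: "g \<in> carrier K" and h: "h \<in> carrier K" and k: "k \<in> carrier K"
    have "cop ?g (\<lambda>k1 k2. cop ?g (\<lambda>k1' k2'. s k1 k1' \<otimes>\<^bsub>R\<^esub> s (k2 \<otimes>\<^bsub>K\<^esub> k2') k) h) g
        = tensor_lift (add_monoid R) (\<lambda>g1 g2. tensor_lift (add_monoid R) (\<lambda>h1 h2.
            s g1 h1 \<otimes>\<^bsub>R\<^esub> s (g2 \<otimes>\<^bsub>K\<^esub> h2) k) (\<Delta>K h)) (\<Delta>K g)"
      using sc K_mult_closed k by (intro cop2_eq_lift g h) auto
    also have "\<dots> = tensor_lift (add_monoid R) (\<lambda>h1 h2. tensor_lift (add_monoid R) (\<lambda>k1 k2.
            s h1 k1 \<otimes>\<^bsub>R\<^esub> s g (h2 \<otimes>\<^bsub>K\<^esub> k2)) (\<Delta>K k)) (\<Delta>K h)"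
      unfolding s_def using cocycle g h k by blast
    also have "\<dots> = cop ?g (\<lambda>k1 k2. cop ?g (\<lambda>k1' k2'. s k1 k1' \<otimes>\<^bsub>R\<^esub> s g (k2 \<otimes>\<^bsub>K\<^esub> k2')) k) h"
      using sc K_mult_closed g by (intro cop2_eq_lift[symmetric] h k) auto
    finally show "cop ?g (\<lambda>k1 k2. cop ?g (\<lambda>k1' k2'. s k1 k1' \<otimes>\<^bsub>R\<^esub> s (k2 \<otimes>\<^bsub>K\<^esub> k2') k) h) g
        = cop ?g (\<lambda>k1 k2. cop ?g (\<lambda>k1' k2'. s k1 k1' \<otimes>\<^bsub>R\<^esub> s g (k2 \<otimes>\<^bsub>K\<^esub> k2')) k) h" .
  qed
  interpret A: module R A by (rule A_module)
  have mult: "a \<otimes>\<^bsub>A\<sigma>\<^esub> b = tprod s a b" if a: "a \<in> carrier A" and b: "b \<in> carrier A" for a b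
  proof -
    have c: "s g g' \<odot>\<^bsub>A\<^esub> (x \<otimes>\<^bsub>A\<^esub> x') \<in> carrier A"
      if "g \<in> carrier K" "g' \<in> carrier K" "x \<in> carrier A" "x' \<in> carrier A" for g g' x x'
      using that sc A_mult_closed by simp
    have "tprod s a b = coact A (\<lambda>g x. tensor_lift (add_monoid A) (\<lambda>g' x'. s g g' \<odot>\<^bsub>A\<^esub> (x \<otimes>\<^bsub>A\<^esub> x')) (\<rho> b)) a"
      unfolding act2_def by (rule sweedler_cong[OF refl], rule Ac.sw_eq[OF A_module b c])
    also have "\<dots> = tensor_lift (add_monoid A) (\<lambda>g x. tensor_lift (add_monoid A)
        (\<lambda>g' x'. s g g' \<odot>\<^bsub>A\<^esub> (x \<otimes>\<^bsub>A\<^esub> x')) (\<rho> b)) (\<rho> a)"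
      by (rule Ac.sw_eq[OF A_module a], rule lift_closed[OF A_module Ac.supp[OF b] c])
    finally show ?thesis
      by (simp add: assms(8) twisted_algebra_def s_def)
  qed
  interpret cocycle_twist R K \<Delta>K \<epsilon>K SK A \<rho> H \<Delta>H \<epsilon>H SH \<delta> s t A\<sigma>
  proof unfold_locales
    show "conv2 s t k k' = \<epsilon>K k \<otimes>\<^bsub>R\<^esub> \<epsilon>K k'" "conv2 t s k k' = \<epsilon>K k \<otimes>\<^bsub>R\<^esub> \<epsilon>K k'"
      if "k \<in> carrier K" "k' \<in> carrier K" for k k'
      using inv that conv[OF \<sigma> \<tau>] conv[OF \<tau> \<sigma>] by (simp_all add: s_def t_def)
  qed (use s t coc mult unit in \<open>auto simp: s_def assms(8) twisted_algebra_def\<close>)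
  show ?thesis
    using hopf_galois_twist by (simp add: assms(6,9))
qed

end
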